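(* Let $X$ be a spectrally positive Lévy process, let $c_1,c_2\ge 0$, let $T$ be an exponential random variable with mean $1/\lambda>0$ independent of $X$, and let $V$ be a positive random variable independent of $X$ and $T$. Let $c(t)=c_1t$ for $t\in[0,T]$ and $c(t)=c_2(t-T)+c_1T$ for $t\in(T,\infty)$ (a drift broken at the random time $T$). Put $\varphi_1(\gamma)=\ln\mathbb{E}\exp(-\gamma(X(1)-c_1))$ for $\gamma\ge0$, and let $\overleftarrow{\varphi}_1$ be the inverse function of $\varphi_1$. Then for any $\gamma>\overleftarrow{\varphi}_1(\lambda)$ $$\mathbb{E}e^{-\gamma\sup_{t<T+V}(X(t)-c(t))}=\mathbb{E}e^{-\gamma\sup_{t<T}(X(t)-c_1t)}$$ $$\qquad+\frac{\gamma\lambda}{\varphi_1(\gamma)-\lambda}\left[\frac{1-\mathbb{E}e^{-\gamma\sup_{t<V}(X(t)-c_2t)}}{\gamma}-\frac{1-\mathbb{E}e^{-\overleftarrow{\varphi}_1(\lambda)\sup_{t<V}(X(t)-c_2t)}}{\overleftarrow{\varphi}_1(\lambda)}\right].$$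
   Context: All processes are real-valued with time parameter $t\in[0,\infty)$. A spectrally positive Lévy process is a Lévy process (started at $0$) with no negative jumps. The random elements $X$, $T$, $V$ are mutually independent. $\sup_{t<r}$ means the supremum over $t\in[0,r)$. For $\lambda>0$, $\overleftarrow{\varphi}_1(\lambda)$ is the unique $\gamma>0$ with $\varphi_1(\gamma)=\lambda$ (unique because $\varphi_1$ is convex with $\varphi_1(0)=0$); it is assumed that such a $\gamma$ exists. *)

theory Defs
  imports "HOL-Probability.Probability"
begin

definition cadlag :: "(real \<Rightarrow> real) \<Rightarrow> bool" where
  "cadlag f \<longleftrightarrow> (\<forall>t\<ge>0. continuous (at_right t) f) \<and> (\<forall>t>0. \<exists>l. (f \<longlongrightarrow> l) (at_left t))"

(* Only the values X t with t \<ge> 0 are constrained, and path properties are required almost surely. *)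
locale levy_process = prob_space M for M :: "'a measure" +
  fixes X :: "real \<Rightarrow> 'a \<Rightarrow> real"
  assumes random_variable: "\<And>t. 0 \<le> t \<Longrightarrow> random_variable borel (X t)"
    and start: "AE \<omega> in M. X 0 \<omega> = 0"
    and independent_increments: "\<And>n (\<tau> :: nat \<Rightarrow> real). 0 \<le> \<tau> 0 \<Longrightarrow> (\<forall>i<n. \<tau> i < \<tau> (Suc i)) \<Longrightarrow>
          indep_vars (\<lambda>_. borel) (\<lambda>i \<omega>. X (\<tau> (Suc i)) \<omega> - X (\<tau> i) \<omega>) {..<n}"
    and stationary_increments: "\<And>s t. 0 \<le> s \<Longrightarrow> 0 \<le> t \<Longrightarrow>
          distr M borel (\<lambda>\<omega>. X (s + t) \<omega> - X s \<omega>) = distr M borel (X t)"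
    and cadlag_paths: "AE \<omega> in M. cadlag (\<lambda>t. X t \<omega>)"

locale spectrally_positive_levy_process = levy_process +
  assumes no_negative_jumps: "AE \<omega> in M. \<forall>t>0. Lim (at_left t) (\<lambda>s. X s \<omega>) \<le> X t \<omega>"

(* The process as a single random element of the product space of functions on [0,\<infinity>). *)
definition sample_path :: "(real \<Rightarrow> 'a \<Rightarrow> real) \<Rightarrow> 'a \<Rightarrow> real \<Rightarrow> real" where
  "sample_path X \<omega> = (\<lambda>t\<in>{0..}. X t \<omega>)"

(* Like indep_vars for three random elements, but allowing different value types. *)
definition (in prob_space) indep_vars3 ::
  "'b measure \<Rightarrow> ('a \<Rightarrow> 'b) \<Rightarrow> 'c measure \<Rightarrow> ('a \<Rightarrow> 'c) \<Rightarrow> 'd measure \<Rightarrow> ('a \<Rightarrow> 'd) \<Rightarrow> bool" where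
  "indep_vars3 N1 Y1 N2 Y2 N3 Y3 \<longleftrightarrow>
     random_variable N1 Y1 \<and> random_variable N2 Y2 \<and> random_variable N3 Y3 \<and>
     indep_sets (\<lambda>i::nat.
         if i = 0 then {Y1 -` A \<inter> space M | A. A \<in> sets N1}
         else if i = 1 then {Y2 -` A \<inter> space M | A. A \<in> sets N2}
         else {Y3 -` A \<inter> space M | A. A \<in> sets N3}) {0, 1, 2}"

definition broken_drift :: "real \<Rightarrow> real \<Rightarrow> real \<Rightarrow> real \<Rightarrow> real" where
  "broken_drift c1 c2 T t = (if t \<le> T then c1 * t else c2 * (t - T) + c1 * T)"

definition sup_before :: "real \<Rightarrow> (real \<Rightarrow> real) \<Rightarrow> real" where
  "sup_before r f = (SUP t\<in>{0..<r}. f t)"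

(* Since paths are only almost surely cadlag, suprema over uncountable time sets need not be
   M-measurable, only measurable up to a null set; hence the completion. For M-measurable Y this
   is the integral with respect to M. *)
definition laplace_transform :: "'a measure \<Rightarrow> ('a \<Rightarrow> real) \<Rightarrow> real \<Rightarrow> real" where
  "laplace_transform M Y \<gamma> = (\<integral>\<omega>. exp (- \<gamma> * Y \<omega>) \<partial>completion M)"

definition laplace_exponent :: "'a measure \<Rightarrow> (real \<Rightarrow> 'a \<Rightarrow> real) \<Rightarrow> real \<Rightarrow> real \<Rightarrow> real" where
  "laplace_exponent M X c \<gamma> = ln (laplace_transform M (\<lambda>\<omega>. X 1 \<omega> - c) \<gamma>)"

definition laplace_exponent_inv :: "'a measure \<Rightarrow> (real \<Rightarrow> 'a \<Rightarrow> real) \<Rightarrow> real \<Rightarrow> real \<Rightarrow> real" where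
  "laplace_exponent_inv M X c l = (THE \<gamma>. \<gamma> > 0 \<and> laplace_exponent M X c \<gamma> = l)"

end

theory Submission
  imports Defs "HOL-Real_Asymp.Real_Asymp"
begin

text \<open>
  Let \<open>Y t = X t - c1 * t\<close>, let \<open>I\<close> be its running infimum and \<open>\<beta>\<close> the root of \<open>\<phi> \<beta> = l\<close>.
  For fixed \<open>T = t\<close> and \<open>V = v\<close> the supremum over \<open>[0, t + v)\<close> is the maximum of the supremum of \<open>Y\<close>
  over \<open>[0, t)\<close> and \<open>Y t + Z\<close>, where \<open>Z\<close> is an independent copy of the supremum of \<open>X s - c2 * s\<close> over
  \<open>[0, v)\<close>. Reversing time turns this into \<open>Y t + max (- I t) Z\<close>. So it suffices to find, for a constant
  \<open>z \<ge> 0\<close>, the Laplace transform \<open>g t\<close> of \<open>Y t + max (- I t) z = Y t - J t\<close> with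
  \<open>J t = min (- z) (I t)\<close>, averaged over an exponential time \<open>t\<close>.

  On the grid of mesh \<open>1 / n\<close> one has \<open>g (k + 1) = exp (\<phi> \<gamma> / n) * g k - E (exp (\<gamma> * o) - 1)\<close>, where \<open>o\<close> is
  the decrement of \<open>J\<close> in that step. Since \<open>X\<close> has no negative jumps, these decrements are uniformly small,
  and \<open>exp (\<gamma> * o) - 1\<close> may be replaced by \<open>\<gamma> / \<beta>\<close> times \<open>exp (\<beta> * o) - 1\<close>. For the exponent \<open>\<beta>\<close> growth and
  discounting cancel, so the discounted decrements sum to \<open>exp (- \<beta> * z)\<close>. This gives
  \<open>(\<phi> \<gamma> - l) / l\<close> times the average of \<open>g\<close> as \<open>\<gamma> / \<beta> * exp (- \<beta> * z) - exp (- \<gamma> * z)\<close>, without any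
  fluctuation identity, and with \<open>z = 0\<close> also the uniqueness of \<open>\<beta>\<close>.
\<close>

subsection \<open>Paths without negative jumps\<close>

text \<open>The hypothesis on \<beta> provides one exponential moment of \<open>X 1\<close>, whereas
  the estimates use those of order \<gamma> and \<open>2 * \<gamma>\<close> for arbitrarily large
  \<gamma>. They are extracted from the absence of negative jumps by truncating the grid increments.
  There are about \<open>n\<close> steps per unit of time. Hence, when a loss of order \<gamma> is
  replaced by \<open>\<gamma> / \<beta>\<close> times the loss of order \<beta>, the error in one
  step has to be either a small multiple of the latter loss, whose discounted sum is known, or
  \<open>o(1 / n)\<close>. Small decrements give an error of the first kind, the rare big drops one
  of the second kind: almost every path eventually has no grid increment below
  \<open>- \<delta>\<close> on \<open>[0, 1]\<close>, so \<open>n\<close> times the probability of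
  such a drop vanishes, and second moments carry this over to the exponentials. The remaining
  obstacle is measurability in the time variables, which is why extrema are encoded through rational
  times and why \<open_time> is avoided in favour of grid limits. The theorem then is a difference:
  averaging over \<open>z = Z\<close> gives the transform at \<open>T + V\<close>, and
  \<open>z = 0\<close> the one at \<open>T\<close>.\<close>

definition spos_path :: "(real \<Rightarrow> real) \<Rightarrow> bool" where
  "spos_path f \<longleftrightarrow> f 0 = 0 \<and> (\<forall>t\<ge>0. (f \<longlongrightarrow> f t) (at_right t)) \<and>
     (\<forall>t>0. \<exists>l\<le>f t. (f \<longlongrightarrow> l) (at_left t))"

lemma spos_pathD:
  assumes "spos_path f"
  shows "f 0 = 0" "\<And>t. t \<ge> 0 \<Longrightarrow> (f \<longlongrightarrow> f t) (at_right t)"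
    "\<And>t. t > 0 \<Longrightarrow> \<exists>l\<le>f t. (f \<longlongrightarrow> l) (at_left t)"
  using assms by (auto simp: spos_path_def)

lemma tendsto_at_right_real_iff:
  fixes f :: "real \<Rightarrow> real"
  shows "(f \<longlongrightarrow> l) (at_right x) \<longleftrightarrow> (\<forall>e>0. \<exists>d>0. \<forall>y. x < y \<and> y < x + d \<longrightarrow> \<bar>f y - l\<bar> < e)"
proof -
  have "y \<in> {x<..} \<and> y \<noteq> x \<and> \<bar>y - x\<bar> < d \<longleftrightarrow> x < y \<and> y < x + d" for y d :: real by auto
  then show ?thesis
    by (simp only: tendsto_iff eventually_at dist_real_def Ball_def imp_conjL[symmetric])
qed

lemma tendsto_at_left_real_iff:
  fixes f :: "real \<Rightarrow> real"
  shows "(f \<longlongrightarrow> l) (at_left x) \<longleftrightarrow> (\<forall>e>0. \<exists>d>0. \<forall>y. x - d < y \<and> y < x \<longrightarrow> \<bar>f y - l\<bar> < e)"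
proof -
  have "y \<in> {..<x} \<and> y \<noteq> x \<and> \<bar>y - x\<bar> < d \<longleftrightarrow> x - d < y \<and> y < x" for y d :: real by auto
  then show ?thesis
    by (simp only: tendsto_iff eventually_at dist_real_def Ball_def imp_conjL[symmetric])
qed

lemma eventually_divide_nat_less:
  fixes c d :: real
  assumes "d > 0"
  shows "\<forall>\<^sub>F n in sequentially. c / real n < d"
proof -
  have "(\<lambda>n. c / real n) \<longlonglongrightarrow> 0" by real_asymp
  then show ?thesis using assms by (rule order_tendstoD)
qed

text \<open>A single \<open>d\<close> for both sides of \<open>x\<close> serves the compactness
  arguments that follow. The guards \<open>y \<ge> 0\<close>, \<open>0 \<le> x\<close> and
  \<open>x > 0\<close> are there because nothing is known about \<open>f\<close> at negative times;
  for \<open>x \<le> 0\<close> the left part is vacuous.\<close>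

lemma spos_path_near:
  assumes f: "spos_path f" and "e > 0"
  shows "\<exists>l d. d > 0 \<and> (x > 0 \<longrightarrow> l \<le> f x) \<and>
    (\<forall>y\<ge>0. x - d < y \<and> y < x \<longrightarrow> \<bar>f y - l\<bar> < e) \<and>
    (\<forall>y\<ge>0. 0 \<le> x \<and> x \<le> y \<and> y < x + d \<longrightarrow> \<bar>f y - f x\<bar> < e)"
proof -
  have R: "\<exists>d>0. \<forall>y. 0 \<le> x \<and> x \<le> y \<and> y < x + d \<longrightarrow> \<bar>f y - f x\<bar> < e"
  proof (cases "x \<ge> 0")
    case True
    obtain d where "d > 0" "\<forall>y. x < y \<and> y < x + d \<longrightarrow> \<bar>f y - f x\<bar> < e"
      using spos_pathD(2)[OF f True] \<open>e > 0\<close> unfolding tendsto_at_right_real_iff by blast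
    then show ?thesis using \<open>e > 0\<close> by (intro exI[of _ d]) (auto simp: order_le_less)
  qed (auto intro: exI[of _ 1])
  have L: "\<exists>l. \<exists>d>0. (x > 0 \<longrightarrow> l \<le> f x) \<and> (\<forall>y\<ge>0. x - d < y \<and> y < x \<longrightarrow> \<bar>f y - l\<bar> < e)"
  proof (cases "x > 0")
    case True
    then show ?thesis
      using spos_pathD(3)[OF f True] \<open>e > 0\<close> unfolding tendsto_at_left_real_iff by metis
  qed (auto intro: exI[of _ 1])
  from R L obtain l d1 d2 where "d1 > 0" "d2 > 0" "x > 0 \<longrightarrow> l \<le> f x"
    "\<forall>y\<ge>0. x - d2 < y \<and> y < x \<longrightarrow> \<bar>f y - l\<bar> < e"
    "\<forall>y. 0 \<le> x \<and> x \<le> y \<and> y < x + d1 \<longrightarrow> \<bar>f y - f x\<bar> < e" by blast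
  then show ?thesis by (intro exI[of _ l] exI[of _ "min d1 d2"]) auto
qed

text \<open>One-sided limits bound \<open>f\<close> near each point, and bisection makes the bound
  global. The predicate keeps the guard \<open>0 \<le> y\<close> because small intervals around 0
  reach into negative times.\<close>

lemma spos_path_bounded:
  assumes f: "spos_path f" and "0 \<le> b"
  shows "bounded (f ` {0..b})"
proof -
  have "\<exists>B. \<forall>y\<in>{0..b}. 0 \<le> y \<longrightarrow> \<bar>f y\<bar> \<le> B"
    using \<open>0 \<le> b\<close>
  proof (induction rule: Bolzano[where P = "\<lambda>a b. \<exists>B. \<forall>y\<in>{a..b}. 0 \<le> y \<longrightarrow> \<bar>f y\<bar> \<le> B"])
    case (trans a b c)
    then obtain B1 B2 where "\<forall>y\<in>{a..b}. 0 \<le> y \<longrightarrow> \<bar>f y\<bar> \<le> B1" "\<forall>y\<in>{b..c}. 0 \<le> y \<longrightarrow> \<bar>f y\<bar> \<le> B2" by blast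
    then have "\<forall>y\<in>{a..c}. 0 \<le> y \<longrightarrow> \<bar>f y\<bar> \<le> max B1 B2"
      by (metis atLeastAtMost_iff linear max.coboundedI1 max.coboundedI2)
    then show ?case by blast
  next
    case (local x)
    obtain l d where d: "d > 0" "\<forall>y\<ge>0. x - d < y \<and> y < x \<longrightarrow> \<bar>f y - l\<bar> < 1"
      "\<forall>y\<ge>0. 0 \<le> x \<and> x \<le> y \<and> y < x + d \<longrightarrow> \<bar>f y - f x\<bar> < 1"
      using spos_path_near[OF f zero_less_one] by blast
    have *: "\<bar>f y\<bar> \<le> \<bar>l\<bar> + \<bar>f x\<bar> + 1" if "y \<ge> 0" "x - d < y" "y < x + d" for y
    proof (cases "y < x")
      case True
      then have "\<bar>f y - l\<bar> < 1" using that d by auto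
      then show ?thesis by linarith
    next
      case False
      then have "\<bar>f y - f x\<bar> < 1" using that d local by auto
      then show ?thesis by linarith
    qed
    show ?case
    proof (rule exI[of _ d], intro conjI allI impI d(1))
      fix a c assume ac: "a \<le> x \<and> x \<le> c \<and> c - a < d"
      have "\<bar>f y\<bar> \<le> \<bar>l\<bar> + \<bar>f x\<bar> + 1" if "y \<in> {a..c}" "0 \<le> y" for y
        using * [OF that(2)] that ac by simp
      then show "\<exists>B. \<forall>y\<in>{a..c}. 0 \<le> y \<longrightarrow> \<bar>f y\<bar> \<le> B" by blast
    qed
  qed
  then show ?thesis by (auto simp: bounded_iff)
qed

text \<open>Uniform continuity from below: a jump between \<open>s\<close> and \<open>u\<close> is
  upward and can only increase \<open>f u - f s\<close>. A Lebesgue number of the cover by the local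
  balls makes the radius uniform on \<open>[0, b]\<close>.\<close>

lemma spos_path_lower_modulus:
  assumes f: "spos_path f" and "e > 0"
  shows "\<exists>d>0. \<forall>s u. 0 \<le> s \<and> s \<le> u \<and> u \<le> b \<and> u - s < d \<longrightarrow> f u - f s > - e"
proof -
  have "\<exists>d>0. \<forall>s\<ge>0. \<forall>u. x - d < s \<and> s \<le> u \<and> u < x + d \<longrightarrow> f u - f s > - e" if "x \<in> {0..b}" for x
  proof -
    obtain l d where d: "d > 0" "x > 0 \<longrightarrow> l \<le> f x" "\<forall>y\<ge>0. x - d < y \<and> y < x \<longrightarrow> \<bar>f y - l\<bar> < e / 3"
      "\<forall>y\<ge>0. 0 \<le> x \<and> x \<le> y \<and> y < x + d \<longrightarrow> \<bar>f y - f x\<bar> < e / 3"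
      using spos_path_near[OF f, of "e/3" x] \<open>e > 0\<close> by force
    show ?thesis
    proof (intro exI[of _ d] conjI allI impI d(1))
      fix s u assume su: "0 \<le> s" "x - d < s \<and> s \<le> u \<and> u < x + d"
      \<comment> \<open>The limiting levels that \<open>f s\<close> and \<open>f u\<close> are close
        to, depending on the side of \<open>x\<close>. As \<open>s \<le> u\<close>, the one bad
        pair, \<open>f x\<close> for \<open>s\<close> and \<open>l\<close> for \<open>u\<close>,
        cannot occur.\<close>
      define a b where "a = (if s < x then l else f x)" and "b = (if u < x then l else f x)"
      have "\<bar>f s - a\<bar> < e/3" "\<bar>f u - b\<bar> < e/3"
        using su d(3,4) that by (auto simp: a_def b_def)
      moreover have "a \<le> b"
        using d(2) su by (auto simp: a_def b_def)
      ultimately show "f u - f s > - e"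
        using \<open>e > 0\<close> unfolding abs_less_iff by linarith
    qed
  qed
  then obtain D where D: "\<And>x. x \<in> {0..b} \<Longrightarrow> D x > 0"
    "\<And>x s u. x \<in> {0..b} \<Longrightarrow> s \<ge> 0 \<Longrightarrow> x - D x < s \<Longrightarrow> s \<le> u \<Longrightarrow> u < x + D x \<Longrightarrow> f u - f s > - e"
    by metis
  have c: "compact {0..b}" by simp
  have "\<exists>r>0. \<forall>x\<in>{0..b}. \<exists>G\<in>(\<lambda>x. ball x (D x)) ` {0..b}. ball x r \<subseteq> G"
  proof (rule Heine_Borel_lemma[OF c])
    show "{0..b} \<subseteq> \<Union> ((\<lambda>x. ball x (D x)) ` {0..b})"
    proof
      fix x assume "x \<in> {0..b}"
      then show "x \<in> \<Union> ((\<lambda>x. ball x (D x)) ` {0..b})" using D(1)[of x] by (intro UN_I[of x]) auto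
    qed
  qed auto
  then obtain r where r: "r > 0" "\<And>x. x\<in>{0..b} \<Longrightarrow> \<exists>y\<in>{0..b}. ball x r \<subseteq> ball y (D y)" by auto
  show ?thesis
  proof (intro exI[of _ r] conjI allI impI r(1))
    fix s u assume su: "0 \<le> s \<and> s \<le> u \<and> u \<le> b \<and> u - s < r"
    then obtain y where y: "y\<in>{0..b}" "ball s r \<subseteq> ball y (D y)" using r(2)[of s] by auto
    have "s \<in> ball s r" "u \<in> ball s r" using su r(1) by (auto simp: dist_real_def)
    then have "s \<in> ball y (D y)" "u \<in> ball y (D y)" using subsetD[OF y(2)] by blast+
    then show "f u - f s > - e" using D(2)[OF y(1), of s u] su by (auto simp: dist_real_def)
  qed
qed

text \<open>Right-continuity and right-density bound the minima from above. For the lower bound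
  \<open>low\<close> takes the place of \<open>A n \<subseteq> S\<close>, because a grid that ends
  at \<open>\<lceil>n * t\<rceil> / n\<close> may overshoot \<open>t\<close>.\<close>

lemma Min_tendsto_INF:
  fixes f :: "real \<Rightarrow> real" and A :: "nat \<Rightarrow> real set"
  assumes bdd: "bdd_below (f ` S)" and S: "S \<noteq> {}"
    and rc: "\<And>s. s \<in> S \<Longrightarrow> (f \<longlongrightarrow> f s) (at_right s)"
    and dense: "\<And>s e. s \<in> S \<Longrightarrow> e > 0 \<Longrightarrow> \<forall>\<^sub>F n in sequentially. \<exists>a\<in>A n. s \<le> a \<and> a < s + e"
    and fin: "\<And>n. finite (A n)" "\<forall>\<^sub>F n in sequentially. A n \<noteq> {}"
    and low: "\<And>e. e > 0 \<Longrightarrow> \<forall>\<^sub>F n in sequentially. \<forall>a\<in>A n. \<exists>s\<in>S. f s < f a + e"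
  shows "(\<lambda>n. Min (f ` A n)) \<longlonglongrightarrow> (INF s\<in>S. f s)"
proof (rule order_tendstoI)
  fix y assume "y < (INF s\<in>S. f s)"
  then obtain y' where y': "y < y'" "y' < (INF s\<in>S. f s)" using Orderings.dense by blast
  have "\<forall>\<^sub>F n in sequentially. \<forall>a\<in>A n. \<exists>s\<in>S. f s < f a + (y' - y)"
    using low[of "y' - y"] y' by simp
  with fin(2) show "\<forall>\<^sub>F n in sequentially. y < Min (f ` A n)"
  proof eventually_elim
    case (elim n)
    have "y < f a" if a: "a \<in> A n" for a
    proof -
      obtain s where "s \<in> S" "f s < f a + (y' - y)" using elim(2) a by blast
      moreover have "(INF s\<in>S. f s) \<le> f s" using bdd \<open>s \<in> S\<close> by (rule cINF_lower)
      ultimately show ?thesis using y' by linarith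
    qed
    then show ?case using elim fin(1) by simp
  qed
next
  fix y assume "(INF s\<in>S. f s) < y"
  then obtain s where s: "s \<in> S" "f s < y" using bdd S by (subst (asm) cINF_less_iff) auto
  obtain d where d: "d > 0" "\<forall>y'. s < y' \<and> y' < s + d \<longrightarrow> \<bar>f y' - f s\<bar> < y - f s"
    using rc[OF s(1)] s(2) unfolding tendsto_at_right_real_iff
    by (metis diff_gt_0_iff_gt)
  from dense[OF s(1) d(1)] show "\<forall>\<^sub>F n in sequentially. Min (f ` A n) < y"
  proof eventually_elim
    case (elim n)
    then obtain a where a: "a \<in> A n" "s \<le> a" "a < s + d" by auto
    then have "f a < y" using d(2)[rule_format, of a] s(2) by (cases "a = s") auto
    then show ?case using fin(1)[of n] a(1) by (subst Min_less_iff) auto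
  qed
qed

lemma INF_right_dense:
  fixes f :: "real \<Rightarrow> real"
  assumes bdd: "bdd_below (f ` S)" and C: "C \<subseteq> S" and S: "S \<noteq> {}"
    and rc: "\<And>s. s \<in> S \<Longrightarrow> (f \<longlongrightarrow> f s) (at_right s)"
    and dense: "\<And>s e. s \<in> S \<Longrightarrow> e > 0 \<Longrightarrow> \<exists>a\<in>C. s \<le> a \<and> a < s + e"
  shows "(INF s\<in>C. f s) = (INF s\<in>S. f s)"
proof (rule antisym)
  have C0: "C \<noteq> {}" using S dense[of _ 1] by auto
  have bddC: "bdd_below (f ` C)" using bdd C by (meson bdd_below_mono image_mono)
  show "(INF s\<in>S. f s) \<le> (INF s\<in>C. f s)"
    using C0 bdd C by (intro cINF_superset_mono) auto
  show "(INF s\<in>C. f s) \<le> (INF s\<in>S. f s)"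
  proof (rule cINF_greatest[OF S], rule field_le_epsilon)
    fix s e :: real assume s: "s \<in> S" "e > 0"
    obtain d where d: "d > 0" "\<forall>y. s < y \<and> y < s + d \<longrightarrow> \<bar>f y - f s\<bar> < e"
      using rc[OF s(1)] s(2) unfolding tendsto_at_right_real_iff by blast
    obtain a where a: "a \<in> C" "s \<le> a" "a < s + d" using dense[OF s(1) d(1)] by blast
    have "(INF s\<in>C. f s) \<le> f a" by (rule cINF_lower[OF bddC a(1)])
    also have "f a \<le> f s + e"
      using d(2)[rule_format, of a] a s by (cases "a = s") auto
    finally show "(INF s\<in>C. f s) \<le> f s + e" .
  qed
qed

subsection \<open>Reflected random walks\<close>

text \<open>The discrete form of the process \<open>J\<close>: a running minimum that starts from
  the level \<open>- z\<close>.\<close>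

definition capped_min :: "real \<Rightarrow> (nat \<Rightarrow> real) \<Rightarrow> nat \<Rightarrow> real" where
  "capped_min z u k = min (- z) (Min (u ` {..k}))"

lemma capped_min_0: "capped_min z u 0 = min (- z) (u 0)"
  by (simp add: capped_min_def)

lemma capped_min_Suc: "capped_min z u (Suc k) = min (capped_min z u k) (u (Suc k))"
  by (simp add: capped_min_def atMost_Suc min.commute min.left_commute)

lemma capped_min_le: "capped_min z u k \<le> u k"
  by (auto simp: capped_min_def min_le_iff_disj)

lemma capped_min_cong: "(\<And>i. i \<le> k \<Longrightarrow> u i = v i) \<Longrightarrow> capped_min z u k = capped_min z v k"
  unfolding capped_min_def by (metis (no_types, lifting) atMost_iff image_cong)

text \<open>If the walk stays above the old minimum, the last bracket is 0 and the minimum is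
  unchanged. Otherwise the new reflected value is 0 and both sides equal 1. So the loss in one step
  depends on the decrement of the minimum alone.\<close>

lemma capped_min_decrement:
  "exp (- \<gamma> * (u (Suc k) - capped_min z u (Suc k))) =
   exp (- \<gamma> * (u (Suc k) - capped_min z u k)) - (exp (\<gamma> * max 0 (capped_min z u k - u (Suc k))) - 1)"
  by (auto simp: capped_min_Suc min_def max_def algebra_simps)

lemma borel_measurable_capped_min [measurable (raw)]:
  assumes "\<And>i. i \<le> k \<Longrightarrow> (\<lambda>x. u x i) \<in> borel_measurable N" "(\<lambda>x. z x) \<in> borel_measurable N"
  shows "(\<lambda>x. capped_min (z x) (u x) k) \<in> borel_measurable N"
  unfolding capped_min_def using assms by (intro borel_measurable_min borel_measurable_Min) auto

lemma (in prob_space) indep_var_past_next: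
  fixes \<xi> :: "nat \<Rightarrow> 'a \<Rightarrow> real" and f :: "(nat \<Rightarrow> real) \<Rightarrow> real" and h :: "real \<Rightarrow> real"
  assumes "indep_vars (\<lambda>_. borel) \<xi> {..<Suc k}"
    and f: "f \<in> borel_measurable (Pi\<^sub>M {..<k} (\<lambda>_. borel))" and h: "h \<in> borel_measurable borel"
  shows "indep_var borel (\<lambda>\<omega>. f (\<lambda>i\<in>{..<k}. \<xi> i \<omega>)) borel (\<lambda>\<omega>. h (\<xi> k \<omega>))"
proof -
  have "indep_var (Pi\<^sub>M {..<k} (\<lambda>_. borel)) (\<lambda>\<omega>. \<lambda>i\<in>{..<k}. \<xi> i \<omega>) (Pi\<^sub>M {k} (\<lambda>_. borel)) (\<lambda>\<omega>. \<lambda>i\<in>{k}. \<xi> i \<omega>)"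
    by (rule indep_var_restrict[OF assms(1)]) auto
  then have "indep_var borel (f \<circ> (\<lambda>\<omega>. \<lambda>i\<in>{..<k}. \<xi> i \<omega>)) borel ((\<lambda>x. h (x k)) \<circ> (\<lambda>\<omega>. \<lambda>i\<in>{k}. \<xi> i \<omega>))"
    by (rule indep_var_compose) (use f h in measurable)
  then show ?thesis by (simp add: comp_def)
qed

text \<open>With the minimum frozen at step \<open>k\<close>, the exponential of the next reflected
  value is a function of the past times the exponential of the new increment, and independence
  factorises its expectation. Updating the minimum costs exactly the term of
  \<open>capped_min_decrement\<close>.\<close>

lemma (in prob_space) reflected_walk_step:
  fixes \<xi> :: "nat \<Rightarrow> 'a \<Rightarrow> real" and \<gamma> z :: real
  defines "U \<equiv> \<lambda>\<omega> j. \<Sum>i<j. \<xi> i \<omega>"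
  assumes ind: "indep_vars (\<lambda>_. borel) \<xi> {..<Suc k}"
    and int: "integrable M (\<lambda>\<omega>. exp (- \<gamma> * \<xi> k \<omega>))" and "\<gamma> \<ge> 0"
  shows "integrable M (\<lambda>\<omega>. exp (\<gamma> * max 0 (capped_min z (U \<omega>) k - U \<omega> (Suc k))))"
    and "expectation (\<lambda>\<omega>. exp (- \<gamma> * (U \<omega> (Suc k) - capped_min z (U \<omega>) (Suc k)))) =
      expectation (\<lambda>\<omega>. exp (- \<gamma> * \<xi> k \<omega>)) * expectation (\<lambda>\<omega>. exp (- \<gamma> * (U \<omega> k - capped_min z (U \<omega>) k)))
      - expectation (\<lambda>\<omega>. exp (\<gamma> * max 0 (capped_min z (U \<omega>) k - U \<omega> (Suc k))) - 1)"
proof -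
  let ?E0 = "\<lambda>\<omega>. exp (- \<gamma> * (U \<omega> k - capped_min z (U \<omega>) k))"
    and ?E1 = "\<lambda>\<omega>. exp (- \<gamma> * (U \<omega> (Suc k) - capped_min z (U \<omega>) k))"
    and ?E2 = "\<lambda>\<omega>. exp (- \<gamma> * (U \<omega> (Suc k) - capped_min z (U \<omega>) (Suc k)))"
    and ?O = "\<lambda>\<omega>. exp (\<gamma> * max 0 (capped_min z (U \<omega>) k - U \<omega> (Suc k)))"
  have rv [measurable]: "\<xi> i \<in> borel_measurable M" if "i \<le> k" for i
    using ind that by (auto simp: indep_vars_def)
  have U [measurable]: "(\<lambda>\<omega>. U \<omega> j) \<in> borel_measurable M" if "j \<le> Suc k" for j
    unfolding U_def using that by (intro borel_measurable_sum rv) auto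
  \<comment> \<open>Recovers the reflected value from the first \<open>k\<close> increments, so that
    it is visibly a measurable function of the past.\<close>
  define G where "G x = exp (- \<gamma> * ((\<Sum>i<k. x i) - capped_min z (\<lambda>j. \<Sum>i<j. x i) k))" for x :: "nat \<Rightarrow> real"
  have G: "G \<in> borel_measurable (Pi\<^sub>M {..<k} (\<lambda>_. borel))"
    unfolding G_def by measurable
  have GU: "G (\<lambda>i\<in>{..<k}. \<xi> i \<omega>) = ?E0 \<omega>" for \<omega>
  proof -
    have "capped_min z (\<lambda>j. \<Sum>i<j. (\<lambda>i\<in>{..<k}. \<xi> i \<omega>) i) k = capped_min z (U \<omega>) k"
      unfolding U_def by (rule capped_min_cong) (auto intro!: sum.cong)
    then show ?thesis by (simp add: G_def U_def)
  qed
  have iv: "indep_var borel (\<lambda>\<omega>. ?E0 \<omega>) borel (\<lambda>\<omega>. exp (- \<gamma> * \<xi> k \<omega>))"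
    using indep_var_past_next[OF ind G, of "\<lambda>x. exp (- \<gamma> * x)"] by (simp add: GU)
  have cm [measurable]: "(\<lambda>\<omega>. capped_min z (U \<omega>) j) \<in> borel_measurable M" if "j \<le> Suc k" for j
    using that by (intro borel_measurable_capped_min U) auto
  have le1: "exp (- \<gamma> * (U \<omega> j - capped_min z (U \<omega>) j)) \<le> 1" for \<omega> j
    using capped_min_le[of z "U \<omega>" j] \<open>\<gamma> \<ge> 0\<close> by (simp add: mult_left_mono)
  have ib: "integrable M (\<lambda>\<omega>. exp (- \<gamma> * (U \<omega> j - capped_min z (U \<omega>) j)))" if "j \<le> Suc k" for j
    by (rule integrable_const_bound[where B = 1]) (use le1 that in auto)
  have S: "?E1 \<omega> =
    ?E0 \<omega> * exp (- \<gamma> * \<xi> k \<omega>)" for \<omega>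
    by (simp add: U_def algebra_simps flip: exp_add)
  have I: "integrable M (\<lambda>\<omega>. ?E1 \<omega>)"
    unfolding S by (rule indep_var_integrable[OF iv ib int]) simp
  have E: "expectation (\<lambda>\<omega>. ?E1 \<omega>) =
    expectation (\<lambda>\<omega>. ?E0 \<omega>) * expectation (\<lambda>\<omega>. exp (- \<gamma> * \<xi> k \<omega>))"
    unfolding S by (rule indep_var_lebesgue_integral[OF iv ib int]) simp
  \<comment> \<open>Solving the decrement identity for the exponential of the decrement gives its
    integrability for free, since the other terms are already integrable.\<close>
  have O: "?O \<omega> = 
    1 + ?E1 \<omega> - ?E2 \<omega>" for \<omega>
    using capped_min_decrement[of \<gamma> "U \<omega>" k z] by simp
  show *: "integrable M (\<lambda>\<omega>. ?O \<omega>)"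
    unfolding O by (intro Bochner_Integration.integrable_add Bochner_Integration.integrable_diff I ib) auto
  have "expectation (\<lambda>\<omega>. ?E2 \<omega>) =
      expectation (\<lambda>\<omega>. ?E1 \<omega>)
      - expectation (\<lambda>\<omega>. ?O \<omega> - 1)"
    unfolding capped_min_decrement
    by (rule Bochner_Integration.integral_diff[OF I Bochner_Integration.integrable_diff[OF *]]) simp
  then show "expectation (\<lambda>\<omega>. ?E2 \<omega>) =
      expectation (\<lambda>\<omega>. exp (- \<gamma> * \<xi> k \<omega>)) * expectation (\<lambda>\<omega>. ?E0 \<omega>)
      - expectation (\<lambda>\<omega>. ?O \<omega> - 1)"
    by (simp only: E mult.commute[of "expectation (\<lambda>\<omega>. exp (- \<gamma> * \<xi> k \<omega>))"])
qed

text \<open>A partial sum of \<open>k\<close> reversed terms is the total minus the first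
  \<open>n - k\<close> original terms. As \<open>k\<close> runs through
  \<open>0, ..., n - 1\<close>, the number \<open>n - k\<close> runs through
  \<open>1, ..., n\<close>; hence the two different index ranges.\<close>

lemma reversed_walk_Max:
  fixes x :: "nat \<Rightarrow> real"
  assumes "n > 0"
  defines "x' \<equiv> \<lambda>i. x (n - 1 - i)"
  shows "(\<Sum>i<n. x' i) = (\<Sum>i<n. x i)"
    and "Max ((\<lambda>k. \<Sum>i<k. x' i) ` {..<n}) = (\<Sum>i<n. x i) - Min ((\<lambda>k. \<Sum>i<k. x i) ` {1..n})"
proof -
  have P: "(\<Sum>i<k. x' i) = (\<Sum>i<n. x i) - (\<Sum>i<n - k. x i)" if "k \<le> n" for k
    using that
  proof (induction k)
    case (Suc k)
    have "{..<n - k} = insert (n - Suc k) {..<n - Suc k}" using Suc.prems by auto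
    then have "(\<Sum>i<n - k. x i) = x (n - Suc k) + (\<Sum>i<n - Suc k. x i)" by simp
    then show ?case using Suc by (simp add: x'_def)
  qed simp
  show "(\<Sum>i<n. x' i) = (\<Sum>i<n. x i)" using P[of n] by simp
  let ?s = "\<Sum>i<n. x i" and ?m = "Min ((\<lambda>k. \<Sum>i<k. x i) ` {1..n})"
  show "Max ((\<lambda>k. \<Sum>i<k. x' i) ` {..<n}) = ?s - ?m"
  proof (rule Max_eqI)
    fix y assume "y \<in> (\<lambda>k. \<Sum>i<k. x' i) ` {..<n}"
    then obtain k where k: "k < n" "y = (\<Sum>i<k. x' i)" by auto
    have "?m \<le> (\<Sum>i<n - k. x i)" using k by (intro Min_le) auto
    then show "y \<le> ?s - ?m" using P[of k] k by simp
  next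
    have "?m \<in> (\<lambda>k. \<Sum>i<k. x i) ` {1..n}" using \<open>n > 0\<close> by (intro Min_in) auto
    then obtain k where k: "1 \<le> k" "k \<le> n" "?m = (\<Sum>i<k. x i)" by auto
    then have "?s - ?m = (\<Sum>i<n - k. x' i)" using P[of "n - k"] by simp
    then show "?s - ?m \<in> (\<lambda>k. \<Sum>i<k. x' i) ` {..<n}" using k by auto
  qed simp
qed

lemma (in prob_space) distr_iid_eq:
  fixes \<xi> \<xi>' :: "nat \<Rightarrow> 'a \<Rightarrow> real"
  assumes n: "n > 0" and ind: "indep_vars (\<lambda>_. borel) \<xi> {..<n}" "indep_vars (\<lambda>_. borel) \<xi>' {..<n}"
    and law: "\<And>i. i < n \<Longrightarrow> distr M borel (\<xi> i) = distr M borel (\<xi>' i)"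
  shows "distr M (Pi\<^sub>M {..<n} (\<lambda>_. borel)) (\<lambda>\<omega>. \<lambda>i\<in>{..<n}. \<xi> i \<omega>) =
    distr M (Pi\<^sub>M {..<n} (\<lambda>_. borel)) (\<lambda>\<omega>. \<lambda>i\<in>{..<n}. \<xi>' i \<omega>)"
proof -
  have "distr M (Pi\<^sub>M {..<n} (\<lambda>_. borel)) (\<lambda>\<omega>. \<lambda>i\<in>{..<n}. \<xi> i \<omega>) = Pi\<^sub>M {..<n} (\<lambda>i. distr M borel (\<xi> i))"
    using n ind by (subst indep_vars_iff_distr_eq_PiM'[THEN iffD1]) (auto simp: indep_vars_def)
  also have "\<dots> = Pi\<^sub>M {..<n} (\<lambda>i. distr M borel (\<xi>' i))"
    by (intro PiM_cong) (auto simp: law)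
  also have "\<dots> = distr M (Pi\<^sub>M {..<n} (\<lambda>_. borel)) (\<lambda>\<omega>. \<lambda>i\<in>{..<n}. \<xi>' i \<omega>)"
    using n ind by (subst indep_vars_iff_distr_eq_PiM'[THEN iffD1]) (auto simp: indep_vars_def)
  finally show ?thesis .
qed

subsection \<open>Discounted sums\<close>

text \<open>Both sides vanish at \<open>x = 0\<close>, and their derivatives are \<gamma> times
  \<open>exp (\<beta> * x)\<close> and \<gamma> times \<open>exp (\<gamma> * x)\<close>.\<close>

lemma exp_excess_nonneg:
  fixes \<beta> \<gamma> x :: real
  assumes "0 < \<beta>" "\<beta> \<le> \<gamma>" "0 \<le> x"
  shows "\<gamma> / \<beta> * (exp (\<beta> * x) - 1) \<le> exp (\<gamma> * x) - 1"
proof -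
  define h where "h x = exp (\<gamma> * x) - 1 - \<gamma> / \<beta> * (exp (\<beta> * x) - 1)" for x :: real
  have "h 0 \<le> h x"
  proof (rule DERIV_nonneg_imp_nondecreasing[OF \<open>0 \<le> x\<close>])
    fix y :: real assume "0 \<le> y" "y \<le> x"
    then have "\<gamma> * exp (\<beta> * y) \<le> \<gamma> * exp (\<gamma> * y)"
      using assms by (intro mult_left_mono) (auto intro!: mult_right_mono)
    moreover have "(h has_real_derivative (\<gamma> * exp (\<gamma> * y) - \<gamma> * exp (\<beta> * y))) (at y)"
      unfolding h_def using assms by (auto intro!: derivative_eq_intros)
    ultimately show "\<exists>y'. (h has_real_derivative y') (at y) \<and> 0 \<le> y'" by force
  qed
  then show ?thesis by (simp add: h_def)
qed

text \<open>Meant for a decrement \<open>x\<close> of the running minimum caused by an increment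
  \<open>y\<close>. If \<open>x \<le> \<delta>\<close>, the bound
  \<open>exp s \<le> 1 + s + s^2\<close> for \<open>s = \<gamma> * x \<le> 1\<close> leaves a
  quadratic error, of which one factor is absorbed by \<delta>. If \<open>x > \<delta>\<close>, then
  \<open>y\<close> lies below \<open>- \<delta>\<close> and the tail term dominates
  everything.\<close>

lemma exp_excess_le:
  fixes \<beta> \<gamma> \<delta> x y :: real
  assumes "0 < \<beta>" "\<beta> \<le> \<gamma>" "0 \<le> x" "x \<le> max 0 (- y)" "\<gamma> * \<delta> \<le> 1" "0 < \<delta>"
  shows "exp (\<gamma> * x) - 1 - \<gamma> / \<beta> * (exp (\<beta> * x) - 1) \<le>
    \<gamma>\<^sup>2 * \<delta> / \<beta> * (exp (\<beta> * x) - 1) + (if y < - \<delta> then exp (- \<gamma> * y) else 0)"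
proof (cases "x \<le> \<delta>")
  case True
  have e: "\<beta> * x \<le> exp (\<beta> * x) - 1" using exp_ge_add_one_self[of "\<beta> * x"] by linarith
  have "\<gamma> * x \<le> \<gamma> * \<delta>" using True assms by (intro mult_left_mono) auto
  then have "\<gamma> * x \<le> 1" using assms(5) by (rule order_trans)
  moreover have "0 \<le> \<gamma> * x" using assms by auto
  ultimately have "exp (\<gamma> * x) \<le> 1 + \<gamma> * x + (\<gamma> * x)\<^sup>2" by (intro exp_bound)
  moreover have "\<gamma> * x \<le> \<gamma> / \<beta> * (exp (\<beta> * x) - 1)"
    using mult_left_mono[OF e, of "\<gamma> / \<beta>"] assms by simp
  moreover have "(\<gamma> * x)\<^sup>2 \<le> \<gamma>\<^sup>2 * \<delta> / \<beta> * (exp (\<beta> * x) - 1)"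
  proof -
    have "(\<gamma> * x)\<^sup>2 = \<gamma>\<^sup>2 * (x * x)" by (simp add: power2_eq_square)
    also have "\<dots> \<le> \<gamma>\<^sup>2 * (\<delta> * x)"
      using True assms(3) by (intro mult_left_mono mult_right_mono) auto
    also have "\<dots> = \<gamma>\<^sup>2 * \<delta> * x" by simp
    also have "\<dots> = \<gamma>\<^sup>2 * \<delta> / \<beta> * (\<beta> * x)" using assms by simp
    also have "\<dots> \<le> \<gamma>\<^sup>2 * \<delta> / \<beta> * (exp (\<beta> * x) - 1)" using e assms by (intro mult_left_mono) auto
    finally show ?thesis .
  qed
  moreover have "0 \<le> (if y < - \<delta> then exp (- \<gamma> * y) else 0)" by simp
  ultimately show ?thesis by linarith
next
  case False
  then have y: "y < - \<delta>" "x \<le> - y" using assms by auto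
  have "exp (\<gamma> * x) \<le> exp (- \<gamma> * y)"
    using y assms mult_left_mono[of x "- y" \<gamma>] by simp
  moreover have "0 \<le> \<gamma> / \<beta> * (exp (\<beta> * x) - 1)" "0 \<le> \<gamma>\<^sup>2 * \<delta> / \<beta> * (exp (\<beta> * x) - 1)"
    using assms by (auto intro!: mult_nonneg_nonneg)
  moreover have "(if y < - \<delta> then exp (- \<gamma> * y) else 0) = exp (- \<gamma> * y)" using y by simp
  ultimately show ?thesis by linarith
qed

text \<open>Here \<open>d\<close> and \<open>e\<close> are the losses of two geometrically growing sequences \<open>g\<close> and \<open>h\<close>, the
  growth rate of \<open>h\<close> being exactly the discount rate \<open>l\<close>. Summing with discount, the losses of \<open>h\<close> add up
  to \<open>b\<close>, hence those of \<open>g\<close> to \<open>c * b\<close> in the limit.\<close>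
lemma renewal_limit:
  fixes g h d e :: "nat \<Rightarrow> nat \<Rightarrow> real" and \<phi> l a b c :: real
  assumes "l > 0" "c \<ge> 0"
    and g: "\<And>n k. n > 0 \<Longrightarrow> \<bar>g n k\<bar> \<le> 1" "\<And>n. n > 0 \<Longrightarrow> g n 0 = a"
      "\<And>n k. n > 0 \<Longrightarrow> g n (Suc k) = exp (\<phi> / n) * g n k - d n k"
    and h: "\<And>n k. n > 0 \<Longrightarrow> \<bar>h n k\<bar> \<le> 1" "\<And>n. n > 0 \<Longrightarrow> h n 0 = b"
      "\<And>n k. n > 0 \<Longrightarrow> h n (Suc k) = exp (l / n) * h n k - e n k"
    and ge: "\<And>n k. n > 0 \<Longrightarrow> c * e n k \<le> d n k"
    and le: "\<And>\<kappa>. \<kappa> > 0 \<Longrightarrow> \<exists>r::nat \<Rightarrow> real. (\<lambda>n. n * r n) \<longlonglongrightarrow> 0 \<and>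
      (\<forall>n>0. \<forall>k. d n k - c * e n k \<le> \<kappa> * e n k + r n)"
    and Q: "(\<lambda>n. (1 - exp (- l / n)) * (\<Sum>k. exp (- l / n) ^ k * g n (Suc k))) \<longlonglongrightarrow> Q"
  shows "Q * ((\<phi> - l) / l) = c * b - a"
proof -
  define w where "w n = exp (- l / real n)" for n
  define S where "S n x = (\<Sum>k. w n ^ k * x k)" for n and x :: "nat \<Rightarrow> real"
  have w: "0 < w n" "w n < 1" if "n > 0" for n using that \<open>l > 0\<close> by (auto simp: w_def)
  have sum: "summable (\<lambda>k. w n ^ k * x k)" if "n > 0" "\<And>k. \<bar>x k\<bar> \<le> C" for n x C
  proof (rule summable_comparison_test')
    show "summable (\<lambda>k. w n ^ k * C)" using w[OF that(1)] by (intro summable_mult2 summable_geometric) auto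
    show "norm (w n ^ k * x k) \<le> w n ^ k * C" for k
      using w[OF that(1)] that(2)[of k] by (simp add: abs_mult mult_left_mono)
  qed
  \<comment> \<open>Discounted summation of the recursion, proved once for both sequences. For
    \<psi> equal to \<open>l\<close> the coefficient of the remaining sum vanishes, so the losses of
    \<open>h\<close> sum to \<open>exp (l / n) * b\<close> exactly.\<close>
  have D: "S n (d' n) = exp (\<psi> / n) * a' + (exp ((\<psi> - l) / n) - 1) * S n (\<lambda>k. g' n (Suc k))" 
      "summable (\<lambda>k. w n ^ k * d' n k)"
    if n: "n > 0" and g': "\<And>n k. n > 0 \<Longrightarrow> \<bar>g' n k\<bar> \<le> 1" "\<And>n. n > 0 \<Longrightarrow> g' n 0 = a'"
      "\<And>n k. n > 0 \<Longrightarrow> g' n (Suc k) = exp (\<psi> / n) * g' n k - d' n k" for n \<psi> a' and g' d' :: "nat \<Rightarrow> nat \<Rightarrow> real"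
  proof -
    have s: "summable (\<lambda>k. w n ^ k * g' n k)" and s': "summable (\<lambda>k. w n ^ k * g' n (Suc k))"
      using sum[OF n, of _ 1] g'(1)[OF n] by auto
    have d': "d' n k = exp (\<psi> / n) * g' n k - g' n (Suc k)" for k using g'(3)[OF n, of k] by simp
    have dd: "w n ^ k * d' n k = exp (\<psi> / n) * (w n ^ k * g' n k) - w n ^ k * g' n (Suc k)" for k
      unfolding d' by (simp add: algebra_simps)
    show "summable (\<lambda>k. w n ^ k * d' n k)"
      unfolding dd by (intro summable_diff summable_mult s s')
    have "S n (d' n) = exp (\<psi> / n) * S n (g' n) - S n (\<lambda>k. g' n (Suc k))"
      unfolding S_def dd by (subst suminf_diff[symmetric]) (auto intro: s s' summable_mult simp: suminf_mult[OF s])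
    moreover have "S n (g' n) = a' + w n * S n (\<lambda>k. g' n (Suc k))"
      unfolding S_def using suminf_split_head[OF s] g'(2)[OF n] suminf_mult[OF s', of "w n"]
      by (simp add: mult.assoc)
    moreover have "exp (\<psi> / n) * w n = exp ((\<psi> - l) / n)"
      by (simp add: w_def diff_divide_distrib flip: exp_add)
    ultimately show "S n (d' n) = exp (\<psi> / n) * a' + (exp ((\<psi> - l) / n) - 1) * S n (\<lambda>k. g' n (Suc k))"
      by (simp add: algebra_simps)
  qed
  note Dd = D[of _ g a \<phi> d, OF _ g] and De = D[of _ h b l e, OF _ h, simplified]
  \<comment> \<open>The discounted gap between the losses of \<open>g\<close> and \<open>c\<close>
    times those of \<open>h\<close>. Its limit is computed from \<open>D\<close>; the hypotheses
    \<open>ge\<close> and \<open>le\<close> then squeeze that limit to 0.\<close>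
  define x where "x n = S n (d n) - c * S n (e n)" for n
  have lim: "x \<longlonglongrightarrow> a + Q * ((\<phi> - l) / l) - c * b"
  proof (rule Lim_transform_eventually)
    have q: "(\<lambda>n. (1 - w n) * S n (\<lambda>k. g n (Suc k))) \<longlonglongrightarrow> Q"
      using Q unfolding S_def w_def .
    have r: "(\<lambda>n. (exp ((\<phi> - l) / real n) - 1) / (1 - exp (- l / real n))) \<longlonglongrightarrow> (\<phi> - l) / l"
      using \<open>l > 0\<close> by real_asymp (simp add: divide_inverse)
    have e: "(\<lambda>n. exp (\<psi> / real n)) \<longlonglongrightarrow> 1" for \<psi>
      by real_asymp
    show "(\<lambda>n. exp (\<phi> / n) * a + ((1 - w n) * S n (\<lambda>k. g n (Suc k))) *
        ((exp ((\<phi> - l) / real n) - 1) / (1 - exp (- l / real n))) - c * (exp (l / n) * b))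
        \<longlonglongrightarrow> a + Q * ((\<phi> - l) / l) - c * b"
      by (rule tendsto_eq_intros q r e refl | simp)+
    show "\<forall>\<^sub>F n in sequentially. exp (\<phi> / n) * a + ((1 - w n) * S n (\<lambda>k. g n (Suc k))) *
        ((exp ((\<phi> - l) / real n) - 1) / (1 - exp (- l / real n))) - c * (exp (l / n) * b) = x n"
      using eventually_gt_at_top[of 0]
    proof eventually_elim
      case (elim n)
      have "1 - w n \<noteq> 0" using w[OF elim] by simp
      then show ?case
        unfolding x_def using Dd(1)[OF elim] De(1)[OF elim] by (simp add: w_def mult.commute)
    qed
  qed
  have nn: "0 \<le> a + Q * ((\<phi> - l) / l) - c * b"
  proof (rule tendsto_lowerbound[OF lim])
    show "\<forall>\<^sub>F n in sequentially. 0 \<le> x n"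
      using eventually_gt_at_top[of 0]
    proof eventually_elim
      case (elim n)
      have "c * S n (e n) = (\<Sum>k. c * (w n ^ k * e n k))"
        unfolding S_def by (rule suminf_mult[OF De(2)[OF elim], symmetric])
      also have "\<dots> \<le> S n (d n)"
        unfolding S_def
      proof (intro suminf_le summable_mult Dd(2)[OF elim] De(2)[OF elim])
        show "c * (w n ^ k * e n k) \<le> w n ^ k * d n k" for k
          using mult_left_mono[OF ge[OF elim, of k], of "w n ^ k"] w[OF elim]
          by (simp add: mult.left_commute)
      qed
      finally show ?case by (simp add: x_def)
    qed
  qed simp
  \<comment> \<open>Summed against the geometric weights, an error \<open>r n\<close> per step costs
    \<open>r n / (1 - w n)\<close>, which behaves like \<open>n * r n / l\<close> and
    vanishes.\<close>
  have up: "a + Q * ((\<phi> - l) / l) - c * b \<le> \<kappa> * b" if "\<kappa> > 0" for \<kappa>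
  proof -
    obtain r :: "nat \<Rightarrow> real" where r: "(\<lambda>n. n * r n) \<longlonglongrightarrow> 0" "\<And>n k. n > 0 \<Longrightarrow> d n k - c * e n k \<le> \<kappa> * e n k + r n"
      using le[OF \<open>\<kappa> > 0\<close>] by blast
    have e: "(\<lambda>n. exp (l / real n)) \<longlonglongrightarrow> 1" by real_asymp
    have q: "(\<lambda>n. 1 / (real n * (1 - exp (- l / real n)))) \<longlonglongrightarrow> 1 / l"
      using \<open>l > 0\<close> by real_asymp (simp add: divide_inverse)
    have "(\<lambda>n. \<kappa> * (exp (l / n) * b) + real n * r n * (1 / (real n * (1 - exp (- l / real n)))))
      \<longlonglongrightarrow> \<kappa> * (1 * b) + 0 * (1 / l)"
      by (intro e q r(1) tendsto_add tendsto_mult tendsto_const)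
    moreover have "\<forall>\<^sub>F n in sequentially. x n \<le> \<kappa> * (exp (l / n) * b) + n * r n * (1 / (n * (1 - exp (- l / n))))"
      using eventually_gt_at_top[of 0]
    proof eventually_elim
      case (elim n)
      have sd: "summable (\<lambda>k. w n ^ k * d n k)" and se: "summable (\<lambda>k. w n ^ k * e n k)"
        using Dd(2)[OF elim] De(2)[OF elim] by auto
      have sw: "summable (\<lambda>k. w n ^ k)" using w[OF elim] by (intro summable_geometric) auto
      have "x n = (\<Sum>k. w n ^ k * d n k - c * (w n ^ k * e n k))"
        unfolding x_def S_def
        by (intro sums_unique sums_diff sums_mult summable_sums sd se)
      also have "\<dots> \<le> (\<Sum>k. \<kappa> * (w n ^ k * e n k) + r n * w n ^ k)"
      proof (rule suminf_le)
        fix k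
        have "w n ^ k * (d n k - c * e n k) \<le> w n ^ k * (\<kappa> * e n k + r n)"
          using w[OF elim] r(2)[OF elim] by (intro mult_left_mono) auto
        then show "w n ^ k * d n k - c * (w n ^ k * e n k) \<le> \<kappa> * (w n ^ k * e n k) + r n * w n ^ k"
          by (simp add: algebra_simps)
      qed (intro summable_diff summable_add summable_mult sd se sw)+
      also have "\<dots> = \<kappa> * S n (e n) + r n * (1 / (1 - w n))"
        unfolding S_def using w[OF elim]
        by (intro sums_unique[symmetric] sums_add sums_mult summable_sums[OF se] geometric_sums) auto
      also have "\<dots> = \<kappa> * (exp (l / n) * b) + n * r n * (1 / (n * (1 - exp (- l / n))))"
        using elim De(1)[OF elim] by (simp add: w_def)
      finally show ?case .
    qed
    ultimately show ?thesis using tendsto_le[OF sequentially_bot _ lim] by force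
  qed
  have "a + Q * ((\<phi> - l) / l) - c * b \<le> 0"
  proof (rule field_le_epsilon)
    fix \<epsilon> :: real assume "\<epsilon> > 0"
    \<comment> \<open>The denominator \<open>\<bar>b\<bar> + 1\<close> avoids any case distinction
      on \<open>b\<close>.\<close>
    have "a + Q * ((\<phi> - l) / l) - c * b \<le> \<epsilon> / (\<bar>b\<bar> + 1) * b"
      by (rule up) (use \<open>\<epsilon> > 0\<close> in simp)
    also have "\<dots> \<le> \<epsilon>"
    proof -
      have "\<epsilon> * b \<le> \<epsilon> * (\<bar>b\<bar> + 1)" using \<open>\<epsilon> > 0\<close> by (intro mult_left_mono) auto
      then show ?thesis by (simp add: divide_le_eq)
    qed
    finally show "a + Q * ((\<phi> - l) / l) - c * b \<le> 0 + \<epsilon>" by simp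
  qed
  with nn show ?thesis by linarith
qed

section \<open>Discretising an exponential time\<close>

lemma (in prob_space) AE_exponential_pos:
  assumes T: "distributed M lborel T (exponential_density l)" and "l > 0"
  shows "AE \<omega> in M. 0 < T \<omega>"
proof -
  have [measurable]: "T \<in> borel_measurable M" using T by (auto simp: distributed_def)
  have "prob {\<omega>\<in>space M. 0 < T \<omega>} = 1"
    using exponential_distributedD_gt[OF T, of 0] \<open>l > 0\<close> by simp
  then show ?thesis by (subst (asm) prob_Collect_eq_1) auto
qed

text \<open>Rounding \<open>n * T\<close> up turns the exponential law into a geometric one. Since
  \<open>T > 0\<close> almost surely, the rounded value is at least 1, and \<open>Suc k\<close> has
  probability \<open>exp (- l / n) ^ k * (1 - exp (- l / n))\<close>.\<close>

lemma (in prob_space) expectation_ceiling_exponential: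
  fixes G :: "nat \<Rightarrow> real"
  assumes T: "distributed M lborel T (exponential_density l)" and "l > 0" "n > 0"
    and G: "\<And>k. \<bar>G k\<bar> \<le> B"
  shows "expectation (\<lambda>\<omega>. G (nat \<lceil>real n * T \<omega>\<rceil>)) =
    (1 - exp (- l / n)) * (\<Sum>k. exp (- l / n) ^ k * G (Suc k))"
proof -
  have [measurable]: "T \<in> borel_measurable M" using T by (auto simp: distributed_def)
  define A where "A k = {\<omega>\<in>space M. real k / n < T \<omega> \<and> T \<omega> \<le> real (Suc k) / n}" for k
  have A [measurable]: "A k \<in> sets M" for k unfolding A_def by measurable
  have KA: "nat \<lceil>real n * T \<omega>\<rceil> = Suc k" if "\<omega> \<in> A k" for \<omega> k
  proof -
    have "real k < real n * T \<omega>" "real n * T \<omega> \<le> real k + 1"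
      using that \<open>n > 0\<close> by (auto simp: A_def field_simps)
    then have "\<lceil>real n * T \<omega>\<rceil> = int k + 1" by linarith
    then show ?thesis by simp
  qed
  have disj: "A i \<inter> A j = {}" if "i \<noteq> j" for i j using KA that by (metis disjoint_iff nat.inject)
  have pos: "AE \<omega> in M. 0 < T \<omega>" by (rule AE_exponential_pos[OF T \<open>l > 0\<close>])
  have un: "AE \<omega> in M. \<omega> \<in> (\<Union>k. A k)"
    using pos AE_space
  proof eventually_elim
    case (elim \<omega>)
    define k where "k = nat (\<lceil>real n * T \<omega>\<rceil> - 1)"
    have "0 < real n * T \<omega>" using elim \<open>n > 0\<close> by simp
    then have "\<lceil>real n * T \<omega>\<rceil> \<ge> 1" by linarith
    then have "real k < real n * T \<omega>" "real n * T \<omega> \<le> real k + 1" unfolding k_def by linarith+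
    then have "\<omega> \<in> A k" using elim \<open>n > 0\<close> by (auto simp: A_def field_simps)
    then show ?case by auto
  qed
  have PA: "prob (A k) = exp (- l / n) ^ k * (1 - exp (- l / n))" for k
  proof -
    have "A k = {\<omega>\<in>space M. real k / n < T \<omega>} - {\<omega>\<in>space M. real (Suc k) / n < T \<omega>}"
      by (auto simp: A_def)
    also have "prob \<dots> = prob {\<omega>\<in>space M. real k / n < T \<omega>} - prob {\<omega>\<in>space M. real (Suc k) / n < T \<omega>}"
      using \<open>n > 0\<close> by (intro finite_measure_Diff) (auto simp: field_simps intro: order.strict_trans1)
    also have "\<dots> = exp (- (real k / n) * l) - exp (- (real (Suc k) / n) * l)"
      using exponential_distributedD_gt[OF T _ \<open>l > 0\<close>] by simp
    also have "\<dots> = exp (- l / n) ^ k * (1 - exp (- l / n))"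
      by (simp add: algebra_simps exp_of_nat_mult[symmetric] add_divide_distrib diff_divide_distrib flip: exp_add)
    finally show ?thesis .
  qed
  have int: "integrable M (\<lambda>\<omega>. G (nat \<lceil>real n * T \<omega>\<rceil>))"
    by (rule integrable_const_bound[where B = B]) (use G in auto)
  have "expectation (\<lambda>\<omega>. G (nat \<lceil>real n * T \<omega>\<rceil>)) = (LINT \<omega>:(\<Union>k. A k)|M. G (nat \<lceil>real n * T \<omega>\<rceil>))"
    unfolding set_lebesgue_integral_def using un
    by (intro integral_cong_AE) (auto simp: indicator_def)
  also have "\<dots> = (\<Sum>k. LINT \<omega>:A k|M. G (nat \<lceil>real n * T \<omega>\<rceil>))"
  proof (rule lebesgue_integral_countable_add[OF A disj])
    show "set_integrable M (\<Union>k. A k) (\<lambda>\<omega>. G (nat \<lceil>real n * T \<omega>\<rceil>))"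
      unfolding set_integrable_def by (intro integrable_mult_indicator int) auto
  qed
  also have "\<dots> = (\<Sum>k. (1 - exp (- l / n)) * (exp (- l / n) ^ k * G (Suc k)))"
  proof (rule suminf_cong)
    fix k
    have "(LINT \<omega>:A k|M. G (nat \<lceil>real n * T \<omega>\<rceil>)) = (LINT \<omega>:A k|M. G (Suc k))"
      unfolding set_lebesgue_integral_def
      by (intro Bochner_Integration.integral_cong) (auto simp: KA indicator_def)
    also have "\<dots> = prob (A k) * G (Suc k)"
      by (simp add: set_lebesgue_integral_def)
    finally show "(LINT \<omega>:A k|M. G (nat \<lceil>real n * T \<omega>\<rceil>)) = (1 - exp (- l / n)) * (exp (- l / n) ^ k * G (Suc k))"
      by (simp add: PA)
  qed
  also have "\<dots> = (1 - exp (- l / n)) * (\<Sum>k. exp (- l / n) ^ k * G (Suc k))"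
  proof (rule suminf_mult, rule summable_comparison_test')
    show "summable (\<lambda>k. exp (- l / n) ^ k * B)"
      using \<open>l > 0\<close> \<open>n > 0\<close> by (intro summable_mult2 summable_geometric) auto
    show "norm (exp (- l / n) ^ k * G (Suc k)) \<le> exp (- l / n) ^ k * B" for k
      using G by (simp add: abs_mult mult_left_mono)
  qed
  finally show ?thesis .
qed

subsection \<open>Increments and exponential moments\<close>

context levy_process
begin

lemma grid_increments_indep:
  assumes "0 \<le> s" "0 < h"
  shows "indep_vars (\<lambda>_. borel) (\<lambda>i \<omega>. X (s + real (Suc i) * h) \<omega> - X (s + real i * h) \<omega>) {..<n}"
  using independent_increments[of "\<lambda>i. s + real i * h" n] assms by simp

lemma grid_increments_distr:
  assumes "0 \<le> s" "0 < h"
  shows "distr M borel (\<lambda>\<omega>. X (s + real (Suc i) * h) \<omega> - X (s + real i * h) \<omega>) = distr M borel (X h)"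
  using stationary_increments[of "s + real i * h" h] assms by (simp add: algebra_simps)

lemma levy_process_drift: "levy_process M (\<lambda>t \<omega>. X t \<omega> - c * t)"
proof
  note [measurable] = random_variable
  show "(\<lambda>\<omega>. X t \<omega> - c * t) \<in> borel_measurable M" if "0 \<le> t" for t
    using that by measurable
  show "AE \<omega> in M. X 0 \<omega> - c * 0 = 0" using start by simp
  show "indep_vars (\<lambda>_. borel) (\<lambda>i \<omega>. X (\<tau> (Suc i)) \<omega> - c * \<tau> (Suc i) - (X (\<tau> i) \<omega> - c * \<tau> i)) {..<n}"
    if "0 \<le> \<tau> 0" "\<forall>i<n. \<tau> i < \<tau> (Suc i)" for n \<tau>
    using indep_vars_compose2[OF independent_increments[OF that], of "\<lambda>i x. x - c * (\<tau> (Suc i) - \<tau> i)" "\<lambda>_. borel"]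
    by (simp add: algebra_simps)
  show "distr M borel (\<lambda>\<omega>. X (s + t) \<omega> - c * (s + t) - (X s \<omega> - c * s)) = distr M borel (\<lambda>\<omega>. X t \<omega> - c * t)"
    if "0 \<le> s" "0 \<le> t" for s t
  proof -
    have [measurable]: "X t \<in> borel_measurable M" "X s \<in> borel_measurable M" "X (s + t) \<in> borel_measurable M"
      using that by (auto intro!: random_variable)
    have "distr M borel (\<lambda>\<omega>. X (s + t) \<omega> - c * (s + t) - (X s \<omega> - c * s)) =
      distr (distr M borel (\<lambda>\<omega>. X (s + t) \<omega> - X s \<omega>)) borel (\<lambda>x. x - c * t)"
      by (subst distr_distr) (auto simp: comp_def algebra_simps)
    also have "\<dots> = distr M borel (\<lambda>\<omega>. X t \<omega> - c * t)"
      unfolding stationary_increments[OF that] by (subst distr_distr) (auto simp: comp_def)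
    finally show ?thesis .
  qed
  show "AE \<omega> in M. cadlag (\<lambda>t. X t \<omega> - c * t)"
    using cadlag_paths
  proof eventually_elim
    case (elim \<omega>)
    show ?case
      unfolding cadlag_def
    proof safe
      fix t :: real assume "0 \<le> t"
      with elim show "continuous (at_right t) (\<lambda>t. X t \<omega> - c * t)"
        by (intro continuous_intros) (auto simp: cadlag_def)
    next
      fix t :: real assume "0 < t"
      with elim obtain l where "((\<lambda>t. X t \<omega>) \<longlongrightarrow> l) (at_left t)" by (auto simp: cadlag_def)
      then have "((\<lambda>t. X t \<omega> - c * t) \<longlongrightarrow> l - c * t) (at_left t)"
        by (intro tendsto_intros)
      then show "\<exists>l. ((\<lambda>t. X t \<omega> - c * t) \<longlongrightarrow> l) (at_left t)" ..
    qed
  qed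
qed

end

context spectrally_positive_levy_process
begin

lemma spectrally_positive_drift: "spectrally_positive_levy_process M (\<lambda>t \<omega>. X t \<omega> - c * t)"
proof (intro spectrally_positive_levy_process.intro levy_process_drift spectrally_positive_levy_process_axioms.intro)
  show "AE \<omega> in M. \<forall>t>0. Lim (at_left t) (\<lambda>s. X s \<omega> - c * s) \<le> X t \<omega> - c * t"
    using no_negative_jumps cadlag_paths
  proof eventually_elim
    case (elim \<omega>)
    show ?case
    proof safe
      fix t :: real assume "0 < t"
      with elim obtain l where l: "((\<lambda>t. X t \<omega>) \<longlongrightarrow> l) (at_left t)" by (auto simp: cadlag_def)
      then have "((\<lambda>t. X t \<omega> - c * t) \<longlongrightarrow> l - c * t) (at_left t)"
        by (intro tendsto_intros)
      then show "Lim (at_left t) (\<lambda>s. X s \<omega> - c * s) \<le> X t \<omega> - c * t"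
        using elim(1) \<open>0 < t\<close> tendsto_Lim[OF trivial_limit_at_left_real l] tendsto_Lim[OF trivial_limit_at_left_real]
        by fastforce
    qed
  qed
qed

text \<open>The term \<open>Lim\<close> in \<open>no_negative_jumps\<close> becomes an actual left
  limit because the path is cadlag.\<close>

lemma AE_spos_path: "AE \<omega> in M. spos_path (\<lambda>t. X t \<omega>)"
  using no_negative_jumps cadlag_paths start
proof eventually_elim
  case (elim \<omega>)
  have "\<exists>l\<le>X t \<omega>. ((\<lambda>t. X t \<omega>) \<longlongrightarrow> l) (at_left t)" if t0: "t > 0" for t
  proof -
    obtain l where l: "((\<lambda>t. X t \<omega>) \<longlongrightarrow> l) (at_left t)" using elim t0 unfolding cadlag_def by blast
    then show ?thesis
      using elim(1) t0 tendsto_Lim[OF trivial_limit_at_left_real l] by auto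
  qed
  then show ?case
    using elim by (auto simp: spos_path_def cadlag_def continuous_within)
qed

text \<open>The lower modulus of continuity on \<open>[0, 1]\<close>, as soon as the mesh
  \<open>1 / n\<close> is below it. This is how the sign of the jumps enters the moment
  estimates.\<close>

lemma AE_grid_increments_gt:
  assumes "e > 0"
  shows "AE \<omega> in M. \<forall>\<^sub>F n in sequentially. \<forall>i<n. X (real (Suc i) / n) \<omega> - X (real i / n) \<omega> > - e"
  using AE_spos_path
proof eventually_elim
  case (elim \<omega>)
  obtain d where d: "d > 0" "\<forall>s u. 0 \<le> s \<and> s \<le> u \<and> u \<le> 1 \<and> u - s < d \<longrightarrow> X u \<omega> - X s \<omega> > - e"
    using spos_path_lower_modulus[OF elim assms] by blast
  from eventually_divide_nat_less[where c = 1, OF d(1)]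
  show ?case
    using eventually_gt_at_top[of 0]
  proof eventually_elim
    case (elim n)
    show ?case
    proof safe
      fix i assume "i < n"
      then show "X (real (Suc i) / n) \<omega> - X (real i / n) \<omega> > - e"
        using elim by (intro d(2)[rule_format]) (auto simp: field_simps)
    qed
  qed
qed

end

section \<open>Exponential moments of the process\<close>

lemma nn_integral_distr_cong:
  assumes "distr M N f = distr M N g" "f \<in> M \<rightarrow>\<^sub>M N" "g \<in> M \<rightarrow>\<^sub>M N" "F \<in> borel_measurable N"
  shows "(\<integral>\<^sup>+x. F (f x) \<partial>M) = (\<integral>\<^sup>+x. F (g x) \<partial>M)"
  using assms nn_integral_distr[of f M N F] nn_integral_distr[of g M N F] by simp

lemma integral_distr_cong:
  fixes F :: "'b \<Rightarrow> real"
  assumes "distr M N f = distr M N g" "f \<in> M \<rightarrow>\<^sub>M N" "g \<in> M \<rightarrow>\<^sub>M N" "F \<in> borel_measurable N"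
  shows "(\<integral>x. F (f x) \<partial>M) = (\<integral>x. F (g x) \<partial>M)"
  using assms integral_distr[of f M N F] integral_distr[of g M N F] by simp

text \<open>For \<open>u\<close> close to 1 in the mean, as \<open>exp (- b * \<xi>)\<close> is for
  an increment \<xi> over a short time, the right-hand side has expectation
  \<open>1 + O(1 / n)\<close>. The truncation at \<open>U\<close> lets the bound on
  \<open>[0, U]\<close> extend to all \<open>u\<close>, since the right-hand side increases beyond
  \<open>U \<ge> 1\<close>.\<close>

lemma power_le_quadratic:
  fixes U :: real
  assumes "U \<ge> 1"
  shows "\<exists>B\<ge>0. \<forall>u::real. 0 \<le> u \<longrightarrow> min u U ^ p \<le> 1 + p * (u - 1) + B * (u - 1)\<^sup>2"
proof -
  have "\<exists>B\<ge>0. \<forall>u::real. 0 \<le> u \<and> u \<le> U \<longrightarrow> u ^ p \<le> 1 + p * (u - 1) + B * (u - 1)\<^sup>2"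
  proof (induction p)
    case (Suc p)
    then obtain B where B: "B \<ge> 0" "\<And>u::real. 0 \<le> u \<Longrightarrow> u \<le> U \<Longrightarrow> u ^ p \<le> 1 + p * (u - 1) + B * (u - 1)\<^sup>2"
      by blast
    show ?case
    \<comment> \<open>Multiplying the bound for \<open>p\<close> by \<open>u = 1 + (u - 1)\<close>
      produces the quadratic coefficient \<open>p + B * u\<close>, and
      \<open>u \<le> U\<close>.\<close>
    proof (intro exI[of _ "p + B * U"] conjI allI impI)
      show "0 \<le> p + B * U" using B assms by simp
      fix u :: real assume u: "0 \<le> u \<and> u \<le> U"
      have "u ^ Suc p \<le> u * (1 + p * (u - 1) + B * (u - 1)\<^sup>2)"
        using mult_left_mono[OF B(2)[of u], of u] u by simp
      also have "\<dots> = 1 + real (Suc p) * (u - 1) + (p + B * u) * (u - 1)\<^sup>2"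
        by (simp add: power2_eq_square algebra_simps)
      also have "\<dots> \<le> 1 + real (Suc p) * (u - 1) + (p + B * U) * (u - 1)\<^sup>2"
        using u B by (intro add_left_mono mult_right_mono mult_left_mono) auto
      finally show "u ^ Suc p \<le> 1 + real (Suc p) * (u - 1) + (p + B * U) * (u - 1)\<^sup>2" .
    qed
  qed (auto intro: exI[of _ 0])
  then obtain B where B: "B \<ge> 0" "\<And>u::real. 0 \<le> u \<Longrightarrow> u \<le> U \<Longrightarrow> u ^ p \<le> 1 + p * (u - 1) + B * (u - 1)\<^sup>2"
    by blast
  have "min u U ^ p \<le> 1 + p * (u - 1) + B * (u - 1)\<^sup>2" if "0 \<le> u" for u :: real
  proof (cases "u \<le> U")
    case False
    have "U ^ p \<le> 1 + p * (U - 1) + B * (U - 1)\<^sup>2" using B(2)[of U] assms by simp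
    also have "\<dots> \<le> 1 + p * (u - 1) + B * (u - 1)\<^sup>2"
      using False B(1) assms by (intro add_mono mult_left_mono power_mono) auto
    finally show ?thesis using False by (simp add: min_def)
  qed (use B that in \<open>simp add: min_def\<close>)
  with B(1) show ?thesis by blast
qed

context levy_process
begin

text \<open>Nonnegative integrals allow infinite values, so the identity is available before any
  integrability is known.\<close>

lemma nn_exp_moment_power:
  assumes "h > 0"
  shows "(\<integral>\<^sup>+w. ennreal (exp (\<theta> * X (real n * h) w)) \<partial>M) = (\<integral>\<^sup>+w. ennreal (exp (\<theta> * X h w)) \<partial>M) ^ n"
proof -
  define \<xi> where "\<xi> i w = X (real (Suc i) * h) w - X (real i * h) w" for i w
  have ind: "indep_vars (\<lambda>_. borel) \<xi> {..<n}"
    using grid_increments_indep[of 0 h n] assms by (simp add: \<xi>_def[abs_def])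
  have law: "distr M borel (\<xi> i) = distr M borel (X h)" for i
    using grid_increments_distr[of 0 h i] assms by (simp add: \<xi>_def[abs_def])
  have [measurable]: "\<xi> i \<in> borel_measurable M" "X h \<in> borel_measurable M" for i
    unfolding \<xi>_def using assms by (auto intro!: random_variable borel_measurable_diff)
  have "(\<integral>\<^sup>+w. ennreal (exp (\<theta> * X (real n * h) w)) \<partial>M) = (\<integral>\<^sup>+w. (\<Prod>i<n. ennreal (exp (\<theta> * \<xi> i w))) \<partial>M)"
  proof (rule nn_integral_cong_AE)
    show "AE w in M. ennreal (exp (\<theta> * X (real n * h) w)) = (\<Prod>i<n. ennreal (exp (\<theta> * \<xi> i w)))"
      using start
    proof eventually_elim
      case (elim w)
      have "(\<Sum>i<n. \<xi> i w) = X (real n * h) w"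
        unfolding \<xi>_def using sum_lessThan_telescope[of "\<lambda>i. X (real i * h) w" n] elim by simp
      then show ?case
        by (simp add: prod_ennreal exp_sum[symmetric] sum_distrib_left[symmetric])
    qed
  qed
  also have "\<dots> = (\<Prod>i<n. \<integral>\<^sup>+w. ennreal (exp (\<theta> * \<xi> i w)) \<partial>M)"
    by (rule indep_vars_nn_integral[OF _ indep_vars_compose2[OF ind]]) auto
  also have "\<dots> = (\<Prod>i<n. \<integral>\<^sup>+w. ennreal (exp (\<theta> * X h w)) \<partial>M)"
    by (intro prod.cong refl nn_integral_distr_cong[OF law, where F = "\<lambda>x. ennreal (exp (\<theta> * x))"]) auto
  finally show ?thesis by simp
qed

text \<open>The moment at time 1 is the \<open>n\<close>-th power of the one at time
  \<open>1 / n\<close>; a finite power has a finite base, and the \<open>n\<close>-th root is read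
  off through \<open>ln\<close>.\<close>

lemma exp_moment_inverse_nat:
  assumes int: "integrable M (\<lambda>w. exp (\<theta> * X 1 w))" and "n > 0"
  shows "integrable M (\<lambda>w. exp (\<theta> * X (1 / real n) w))"
    and "expectation (\<lambda>w. exp (\<theta> * X (1 / real n) w)) = exp (ln (expectation (\<lambda>w. exp (\<theta> * X 1 w))) / n)"
    and "0 < expectation (\<lambda>w. exp (\<theta> * X 1 w))"
proof -
  have [measurable]: "X (1 / real n) \<in> borel_measurable M" "X 1 \<in> borel_measurable M"
    by (auto intro!: random_variable)
  have eq: "(\<integral>\<^sup>+w. ennreal (exp (\<theta> * X 1 w)) \<partial>M) = (\<integral>\<^sup>+w. ennreal (exp (\<theta> * X (1 / n) w)) \<partial>M) ^ n"
    using nn_exp_moment_power[of "1 / n" \<theta> n] \<open>n > 0\<close> by simp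
  have nn1: "(\<integral>\<^sup>+w. ennreal (exp (\<theta> * X 1 w)) \<partial>M) = ennreal (expectation (\<lambda>w. exp (\<theta> * X 1 w)))"
    by (rule nn_integral_eq_integral[OF int]) simp
  then have "(\<integral>\<^sup>+w. ennreal (exp (\<theta> * X (1 / n) w)) \<partial>M) ^ n < \<infinity>"
    using eq by simp
  then have fin: "(\<integral>\<^sup>+w. ennreal (exp (\<theta> * X (1 / n) w)) \<partial>M) < \<infinity>"
    using \<open>n > 0\<close> by (simp add: power_less_top_ennreal)
  then show int': "integrable M (\<lambda>w. exp (\<theta> * X (1 / real n) w))"
    by (intro integrableI_bounded) (auto simp: )
  let ?E1 = "expectation (\<lambda>w. exp (\<theta> * X 1 w))" and ?En = "expectation (\<lambda>w. exp (\<theta> * X (1 / n) w))"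
  have "(\<integral>\<^sup>+w. ennreal (exp (\<theta> * X (1 / n) w)) \<partial>M) = ennreal ?En"
    by (rule nn_integral_eq_integral[OF int']) simp
  then have "ennreal ?E1 = ennreal (?En ^ n)"
    using eq nn1 by (simp add: ennreal_power)
  then have p: "?E1 = ?En ^ n" by (simp add: integral_nonneg_AE)
  have pos: "0 < ?En"
  proof -
    have "?En \<noteq> 0"
      using integral_nonneg_eq_0_iff_AE[OF int'] by (auto simp: AE_False)
    moreover have "0 \<le> ?En" by (simp add: integral_nonneg_AE)
    ultimately show ?thesis by linarith
  qed
  show "0 < ?E1" unfolding p using pos by simp
  show "?En = exp (ln ?E1 / n)"
    unfolding p using pos \<open>n > 0\<close> by (simp add: ln_realpow)
qed

end

text \<open>The exponential of order \<open>b\<close> is at most 1 where \<open>Y\<close> is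
  nonnegative and at most the one of order \<open>a\<close> elsewhere.\<close>

lemma (in prob_space) integrable_exp_mono:
  fixes a b :: real and Y :: "'a \<Rightarrow> real"
  assumes "integrable M (\<lambda>w. exp (- a * Y w))" "0 \<le> b" "b \<le> a" "Y \<in> borel_measurable M"
  shows "integrable M (\<lambda>w. exp (- b * Y w))"
proof (rule Bochner_Integration.integrable_bound)
  show "integrable M (\<lambda>w. 1 + exp (- a * Y w))" using assms by simp
  have "exp (- b * y) \<le> 1 + exp (- a * y)" for y
  proof (cases "y \<ge> 0")
    case True
    then have "0 \<le> b * y" using assms(2) by simp
    then have "exp (- b * y) \<le> 1" by simp
    then show ?thesis by (smt (verit) exp_gt_zero)
  next
    case False
    then have "- b * y \<le> - a * y" using assms by (simp add: mult_le_cancel_right)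
    then show ?thesis by (smt (verit) exp_le_cancel_iff)
  qed
  then show "AE w in M. norm (exp (- b * Y w)) \<le> norm (1 + exp (- a * Y w))"
    by (auto simp: abs_of_nonneg add_nonneg_nonneg)
qed (use assms in measurable)

context spectrally_positive_levy_process
begin

text \<open>Truncating the grid increments at \<open>-1\<close> does not change the limit, because the paths have no
  negative jumps. With \<open>b = \<beta> / 2\<close> and \<open>u\<close> standing for \<open>exp (- b * \<xi>)\<close>, the truncated moments of order
  \<open>p * b\<close> are bounded through \<open>u\<close> and \<open>u\<^sup>2\<close>, whose expectations are controlled by the given
  moment of order \<open>\<beta>\<close>; Fatou's lemma then transfers the bound.\<close>
lemma integrable_exp_all:
  assumes int: "integrable M (\<lambda>w. exp (- \<beta> * X 1 w))" and "\<beta> > 0" "\<gamma> \<ge> 0"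
  shows "integrable M (\<lambda>w. exp (- \<gamma> * X 1 w))"
proof -
  have X1 [measurable]: "X 1 \<in> borel_measurable M" by (rule random_variable) simp
  define b where "b = \<beta> / 2"
  have b: "b > 0" using \<open>\<beta> > 0\<close> by (simp add: b_def)
  obtain p :: nat where p: "p * b \<ge> \<gamma>" using b real_arch_simple[of "\<gamma> / b"] by (auto simp: field_simps)
  \<comment> \<open>The value of \<open>exp (- b * \<xi>)\<close> at the truncation level
    \<open>\<xi> = - 1\<close>.\<close>
  define U where "U = exp b"
  obtain B where B: "B \<ge> 0" "\<And>u::real. 0 \<le> u \<Longrightarrow> min u U ^ p \<le> 1 + p * (u - 1) + B * (u - 1)\<^sup>2"
    using power_le_quadratic[of U p] b unfolding U_def by (metis less_imp_le one_le_exp_iff)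
  have intb: "integrable M (\<lambda>w. exp (- b * X 1 w))"
    using int by (rule integrable_exp_mono) (use \<open>\<beta> > 0\<close> in \<open>auto simp: b_def\<close>)
  define f1 where "f1 = ln (expectation (\<lambda>w. exp (- b * X 1 w)))"
  define f2 where "f2 = ln (expectation (\<lambda>w. exp (- \<beta> * X 1 w)))"
  \<comment> \<open>The expectation of the quadratic bound minus 1 for an increment over time
    \<open>1 / n\<close>; the square \<open>exp (- b * \<xi>)^2\<close> has order \<beta> because
    \<open>b\<close> is half of \<beta>. It is \<open>O(1 / n)\<close>.\<close>
  define q where "q n = p * (exp (f1 / n) - 1) + B * (exp (f2 / n) - 2 * exp (f1 / n) + 1)" for n :: nat
  have "(\<lambda>n. n * q n) \<longlonglongrightarrow> p * f1 + B * (f2 - 2 * f1)"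
    unfolding q_def by real_asymp
  then have "Bseq (\<lambda>n. n * q n)" by (auto intro!: convergent_imp_Bseq convergentI)
  then obtain C where C: "\<And>n. n * q n \<le> C" unfolding Bseq_def by (metis abs_le_D1 real_norm_def)
  define \<xi> where "\<xi> n i w = X (real (Suc i) / n) w - X (real i / n) w" for n i :: nat and w
  have m\<xi> [measurable]: "\<xi> n i \<in> borel_measurable M" for n i
    unfolding \<xi>_def by (auto intro!: random_variable borel_measurable_diff)
  let ?P = "\<lambda>n w. \<Prod>i<n. ennreal (min (exp (- b * \<xi> n i w)) U ^ p)"
  have bound: "(\<integral>\<^sup>+w. ?P n w \<partial>M) \<le> ennreal (exp C)" if "n > 0" for n
  proof -
    have [measurable]: "X (1 / real n) \<in> borel_measurable M" by (auto intro!: random_variable)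
    let ?I = "\<integral>\<^sup>+w. ennreal (min (exp (- b * X (1 / n) w)) U ^ p) \<partial>M"
    have ind: "indep_vars (\<lambda>_. borel) (\<xi> n) {..<n}"
      using grid_increments_indep[of 0 "1 / n" n] that by (simp add: \<xi>_def[abs_def])
    have law: "distr M borel (\<xi> n i) = distr M borel (X (1 / n))" for i
      using grid_increments_distr[of 0 "1 / n" i] that by (simp add: \<xi>_def[abs_def])
    have "(\<integral>\<^sup>+w. ?P n w \<partial>M) = 
        (\<Prod>i<n. \<integral>\<^sup>+w. ennreal (min (exp (- b * \<xi> n i w)) U ^ p) \<partial>M)"
      by (rule indep_vars_nn_integral[OF _ indep_vars_compose2[OF ind]]) auto
    also have "\<dots> = (\<Prod>i<n. \<integral>\<^sup>+w. ennreal (min (exp (- b * X (1 / n) w)) U ^ p) \<partial>M)"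
      by (intro prod.cong refl nn_integral_distr_cong[OF law, where F = "\<lambda>x. ennreal (min (exp (- b * x)) U ^ p)"]) auto
    also have "\<dots> = ?I ^ n"
      by simp
    also have "\<dots> \<le> ennreal (1 + q n) ^ n"
    proof (rule power_mono)
      let ?e = "\<lambda>w. exp (- b * X (1 / n) w)"
      have i1: "integrable M ?e" "expectation ?e = exp (f1 / n)"
        using exp_moment_inverse_nat[OF intb that] by (auto simp: f1_def)
      have sq: "(?e w)\<^sup>2 = exp (- \<beta> * X (1 / n) w)" for w
        by (simp add: b_def power2_eq_square flip: exp_add)
      have i2: "integrable M (\<lambda>w. (?e w)\<^sup>2)" "expectation (\<lambda>w. (?e w)\<^sup>2) = exp (f2 / n)"
        unfolding sq using exp_moment_inverse_nat[OF int that] by (auto simp: f2_def)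
      have rhs: "1 + p * (u - 1) + B * (u - 1)\<^sup>2 = (1 - real p + B) + (real p - 2 * B) * u + B * u\<^sup>2" for u :: real
        by (simp add: power2_eq_square algebra_simps)
      have i3: "integrable M (\<lambda>w. 1 + p * (?e w - 1) + B * (?e w - 1)\<^sup>2)"
        unfolding rhs using i1 i2 by simp
      have le: "min (?e w) U ^ p \<le> 1 + p * (?e w - 1) + B * (?e w - 1)\<^sup>2" for w
        by (rule B(2)) simp
      have nn: "0 \<le> 1 + p * (?e w - 1) + B * (?e w - 1)\<^sup>2" for w
        using le[of w] by (rule order_trans[rotated]) (simp add: U_def)
      have "(\<integral>\<^sup>+w. ennreal (min (?e w) U ^ p) \<partial>M) \<le> (\<integral>\<^sup>+w. ennreal (1 + p * (?e w - 1) + B * (?e w - 1)\<^sup>2) \<partial>M)"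
        by (intro nn_integral_mono ennreal_leI le)
      also have "\<dots> = ennreal (expectation (\<lambda>w. 1 + p * (?e w - 1) + B * (?e w - 1)\<^sup>2))"
        by (intro nn_integral_eq_integral[OF i3] AE_I2 nn)
      also have "expectation (\<lambda>w. 1 + p * (?e w - 1) + B * (?e w - 1)\<^sup>2) = 1 + q n"
        unfolding rhs using i1 i2 by (simp add: prob_space q_def algebra_simps)
      finally show "(\<integral>\<^sup>+w. ennreal (min (?e w) U ^ p) \<partial>M) \<le> ennreal (1 + q n)" .
    qed simp
    \<comment> \<open>From \<open>1 + q \<le> exp q\<close>; the exponent \<open>n * q n\<close>
      stays below \<open>C\<close>.\<close>
    also have "\<dots> \<le> ennreal (exp (q n)) ^ n"
      by (intro power_mono ennreal_leI exp_ge_add_one_self) auto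
    also have "\<dots> = ennreal (exp (n * q n))"
      by (simp add: ennreal_power exp_of_nat_mult)
    also have "\<dots> \<le> ennreal (exp C)" using C by (intro ennreal_leI) simp
    finally show ?thesis .
  qed
  \<comment> \<open>For large \<open>n\<close> no increment lies below \<open>- 1\<close>, so no
    truncation is active and the product telescopes to a power of order \<open>p * b\<close> at time
    1.\<close>
  have lim: "AE w in M. liminf (\<lambda>n. ?P n w) = ennreal (exp (- (p * b) * X 1 w))"
    using AE_grid_increments_gt[OF zero_less_one] start
  proof eventually_elim
    case (elim w)
    have "\<forall>\<^sub>F n in sequentially. ?P n w = ennreal (exp (- (p * b) * X 1 w))"
      using elim(1) eventually_gt_at_top[of 0]
    proof eventually_elim
      case (elim n)
      have "min (exp (- b * \<xi> n i w)) U ^ p = exp (- (p * b) * \<xi> n i w)" if "i < n" for i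
      proof -
        have "- 1 < \<xi> n i w" using elim that by (simp add: \<xi>_def)
        then have "b * (- \<xi> n i w) \<le> b * 1" using b by (intro mult_left_mono) auto
        then have "min (exp (- b * \<xi> n i w)) U = exp (- b * \<xi> n i w)" by (simp add: U_def min_def)
        then show ?thesis by (simp add: exp_of_nat_mult[symmetric] algebra_simps)
      qed
      then have "?P n w = (\<Prod>i<n. ennreal (exp (- (p * b) * \<xi> n i w)))"
        by (intro prod.cong) auto
      also have "\<dots> = ennreal (exp (- (p * b) * (\<Sum>i<n. \<xi> n i w)))"
        by (simp only: sum_distrib_left exp_sum prod_ennreal finite_lessThan) (simp add: prod_ennreal)
      also have "(\<Sum>i<n. \<xi> n i w) = X 1 w"
        unfolding \<xi>_def using sum_lessThan_telescope[of "\<lambda>i. X (real i / n) w" n] elim \<open>X 0 w = 0\<close> by simp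
      finally show ?case .
    qed
    then have "(\<lambda>n. ?P n w) \<longlonglongrightarrow> ennreal (exp (- (p * b) * X 1 w))"
      by (rule tendsto_eventually)
    then show ?case by (intro lim_imp_Liminf) auto
  qed
  have "(\<integral>\<^sup>+w. ennreal (exp (- (p * b) * X 1 w)) \<partial>M) = (\<integral>\<^sup>+w. liminf (\<lambda>n. ?P n w) \<partial>M)"
    by (rule nn_integral_cong_AE) (use lim in \<open>auto simp: eq_commute\<close>)
  also have "\<dots> \<le> liminf (\<lambda>n. \<integral>\<^sup>+w. ?P n w \<partial>M)"
    by (rule nn_integral_liminf) measurable
  also have "\<dots> \<le> ennreal (exp C)"
  proof (rule Liminf_le)
    show "\<forall>\<^sub>F n in sequentially. (\<integral>\<^sup>+w. ?P n w \<partial>M) \<le> ennreal (exp C)"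
      using eventually_gt_at_top[of 0] by eventually_elim (rule bound)
  qed simp
  finally have "(\<integral>\<^sup>+w. ennreal (exp (- (p * b) * X 1 w)) \<partial>M) < \<infinity>"
    by (rule order_le_less_trans) simp
  then have "integrable M (\<lambda>w. exp (- (p * b) * X 1 w))"
    by (intro integrableI_bounded) auto
  then show ?thesis
    by (rule integrable_exp_mono) (use p \<open>\<gamma> \<ge> 0\<close> in auto)
qed

text \<open>The \<open>n\<close> grid increments on \<open>[0, 1]\<close> are independent, so
  \<open>(1 - P n) ^ n\<close> is the probability that none of them is below
  \<open>- \<delta>\<close>. It tends to 1 by dominated convergence, and \<open>n * P n\<close> is
  at most minus its logarithm.\<close>

lemma lower_tail_prob:
  assumes "\<delta> > 0"
  shows "(\<lambda>n. n * prob {w\<in>space M. X (1 / real n) w < - \<delta>}) \<longlonglongrightarrow> 0"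
proof -
  define P where "P n = prob {w\<in>space M. X (1 / real n) w < - \<delta>}" for n :: nat
  define \<xi> where "\<xi> n i w = X (real (Suc i) / n) w - X (real i / n) w" for n i :: nat and w
  have m\<xi> [measurable]: "\<xi> n i \<in> borel_measurable M" for n i
    unfolding \<xi>_def by (auto intro!: random_variable borel_measurable_diff)
  define I where "I x = (if x < - \<delta> then 0 else 1 :: real)" for x
  have [measurable]: "I \<in> borel_measurable borel" unfolding I_def by measurable
  have lim: "(\<lambda>n. expectation (\<lambda>w. \<Prod>i<n. I (\<xi> n i w))) \<longlonglongrightarrow> expectation (\<lambda>w. 1)"
  proof (rule integral_dominated_convergence[where w = "\<lambda>_. 1"])
    show "AE w in M. (\<lambda>n. \<Prod>i<n. I (\<xi> n i w)) \<longlonglongrightarrow> 1"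
      using AE_grid_increments_gt[OF assms]
    proof eventually_elim
      case (elim w)
      then have "\<forall>\<^sub>F n in sequentially. (\<Prod>i<n. I (\<xi> n i w)) = 1"
        by eventually_elim (auto intro!: prod.neutral simp: I_def \<xi>_def)
      then show ?case by (rule tendsto_eventually)
    qed
    show "AE w in M. norm (\<Prod>i<n. I (\<xi> n i w)) \<le> 1" for n
      by (auto simp: I_def abs_prod intro!: prod_le_1)
  qed auto
  have eq: "expectation (\<lambda>w. \<Prod>i<n. I (\<xi> n i w)) = (1 - P n) ^ n" if "n > 0" for n
  proof -
    have [measurable]: "X (1 / real n) \<in> borel_measurable M" by (auto intro!: random_variable)
    have ind: "indep_vars (\<lambda>_. borel) (\<xi> n) {..<n}"
      using grid_increments_indep[of 0 "1 / n" n] that by (simp add: \<xi>_def[abs_def])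
    have law: "distr M borel (\<xi> n i) = distr M borel (X (1 / n))" for i
      using grid_increments_distr[of 0 "1 / n" i] that by (simp add: \<xi>_def[abs_def])
    have "expectation (\<lambda>w. \<Prod>i<n. I (\<xi> n i w)) = (\<Prod>i<n. expectation (\<lambda>w. I (\<xi> n i w)))"
      by (rule indep_vars_lebesgue_integral[OF _ indep_vars_compose2[OF ind]])
        (auto intro!: integrable_const_bound[where B = 1] simp: I_def)
    also have "\<dots> = (\<Prod>i<n. 1 - P n)"
    proof (rule prod.cong)
      fix i
      have "expectation (\<lambda>w. I (\<xi> n i w)) = expectation (\<lambda>w. I (X (1 / n) w))"
        by (rule integral_distr_cong[OF law]) auto
      also have "\<dots> = expectation (\<lambda>w. 1 - indicator {w\<in>space M. X (1 / real n) w < - \<delta>} w)"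
        by (intro Bochner_Integration.integral_cong) (auto simp: I_def)
      also have "\<dots> = 1 - P n"
        by (subst Bochner_Integration.integral_diff)
          (auto simp: prob_space P_def less_top[symmetric] intro!: integrable_real_indicator)
      finally show "expectation (\<lambda>w. I (\<xi> n i w)) = 1 - P n" .
    qed simp
    finally show ?thesis by simp
  qed
  have lim1: "(\<lambda>n. (1 - P n) ^ n) \<longlonglongrightarrow> 1"
  proof (rule Lim_transform_eventually)
    show "(\<lambda>n. expectation (\<lambda>w. \<Prod>i<n. I (\<xi> n i w))) \<longlonglongrightarrow> 1" using lim by (simp add: prob_space)
    show "\<forall>\<^sub>F n in sequentially. expectation (\<lambda>w. \<Prod>i<n. I (\<xi> n i w)) = (1 - P n) ^ n"
      using eventually_gt_at_top[of 0] by eventually_elim (rule eq)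
  qed
  have "(\<lambda>n. - ln ((1 - P n) ^ n)) \<longlonglongrightarrow> - ln 1"
    by (intro tendsto_intros lim1) auto
  then have lim2: "(\<lambda>n. - ln ((1 - P n) ^ n)) \<longlonglongrightarrow> 0" by simp
  show ?thesis
    unfolding P_def[symmetric]
  proof (rule tendsto_sandwich[OF _ _ tendsto_const lim2])
    show "\<forall>\<^sub>F n in sequentially. 0 \<le> n * P n" by (simp add: P_def)
    have "\<forall>\<^sub>F n in sequentially. 0 < (1 - P n) ^ n"
      using lim1 by (rule order_tendstoD) simp
    then show "\<forall>\<^sub>F n in sequentially. n * P n \<le> - ln ((1 - P n) ^ n)"
    proof eventually_elim
      case (elim n)
      have "1 - P n \<le> exp (- P n)" using exp_ge_add_one_self[of "- P n"] by simp
      moreover have "0 \<le> 1 - P n" by (simp add: P_def)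
      ultimately have "(1 - P n) ^ n \<le> exp (- P n) ^ n" by (intro power_mono)
      also have "\<dots> = exp (- (n * P n))" by (simp add: exp_of_nat_mult[symmetric])
      finally have "ln ((1 - P n) ^ n) \<le> - (n * P n)" using elim by (metis ln_exp ln_le_cancel_iff exp_gt_zero)
      then show ?case by simp
    qed
  qed
qed

text \<open>The moment is bounded by \<open>e\<close> times a quantity of order \<open>1 / n\<close>
  plus \<open>1 / e\<close> times the tail probability, which is \<open>o(1 / n)\<close>. Fixing
  \<open>e\<close> small before letting \<open>n\<close> grow makes \<open>n\<close> times the sum
  arbitrarily small.\<close>

lemma lower_tail_exp_moment:
  assumes int: "\<And>\<theta>. \<theta> \<ge> 0 \<Longrightarrow> integrable M (\<lambda>w. exp (- \<theta> * X 1 w))" and "\<gamma> > 0" "\<delta> > 0"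
  shows "(\<lambda>n. n * expectation (\<lambda>w. if X (1 / real n) w < - \<delta> then exp (- \<gamma> * X (1 / real n) w) else 0)) \<longlonglongrightarrow> 0"
proof -
  define f where "f \<theta> = ln (expectation (\<lambda>w. exp (- \<theta> * X 1 w)))" for \<theta>
  define q where "q n = exp (f (2 * \<gamma>) / n) - 2 * exp (f \<gamma> / n) + 1" for n :: nat
  \<comment> \<open>On the tail event \<open>u = exp (- \<gamma> * X)\<close> satisfies
    \<open>u * exp (- \<gamma> * \<delta>) \<ge> 1\<close>, hence
    \<open>u - 1 \<ge> (1 - exp (- \<gamma> * \<delta>)) * u\<close> and
    \<open>(u - 1)^2 \<ge> c * u^2\<close>. Unlike \<open>u^2\<close>, the expression
    \<open>(u - 1)^2\<close> has expectation of order \<open>1 / n\<close>.\<close>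
  define c where "c = (1 - exp (- \<gamma> * \<delta>))\<^sup>2"
  have c: "c > 0" using assms by (simp add: c_def)
  define P where "P n = prob {w\<in>space M. X (1 / real n) w < - \<delta>}" for n :: nat
  define r where "r n = expectation (\<lambda>w. if X (1 / real n) w < - \<delta> then exp (- \<gamma> * X (1 / real n) w) else 0)" for n :: nat
  have le: "r n \<le> e / c * q n + P n / e" if "n > 0" "e > 0" for n e
  proof -
    have [measurable]: "X (1 / real n) \<in> borel_measurable M" by (auto intro!: random_variable)
    let ?e = "\<lambda>w. exp (- \<gamma> * X (1 / n) w)" and ?i = "indicator {w\<in>space M. X (1 / real n) w < - \<delta>}"
    have i1: "integrable M ?e" "expectation ?e = exp (f \<gamma> / n)"
      using exp_moment_inverse_nat[OF int \<open>n > 0\<close>, of \<gamma>] \<open>\<gamma> > 0\<close> by (auto simp: f_def)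
    have sq: "(?e w)\<^sup>2 = exp (- (2 * \<gamma>) * X (1 / n) w)" for w
      by (simp add: power2_eq_square flip: exp_add)
    have i2: "integrable M (\<lambda>w. (?e w)\<^sup>2)" "expectation (\<lambda>w. (?e w)\<^sup>2) = exp (f (2 * \<gamma>) / n)"
      unfolding sq using exp_moment_inverse_nat[OF int \<open>n > 0\<close>, of "2 * \<gamma>"] \<open>\<gamma> > 0\<close> by (auto simp: f_def)
    have rhs: "(u - 1)\<^sup>2 = u\<^sup>2 - 2 * u + 1" for u :: real
      by (simp add: power2_eq_square algebra_simps)
    have i3: "integrable M (\<lambda>w. (?e w - 1)\<^sup>2)" "expectation (\<lambda>w. (?e w - 1)\<^sup>2) = q n"
      unfolding rhs using i1 i2 by (simp_all add: prob_space q_def)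
    have i4: "integrable M (?i :: 'a \<Rightarrow> real)" by (intro integrable_real_indicator) (auto simp: less_top[symmetric])
    have "r n \<le> expectation (\<lambda>w. e / c * (?e w - 1)\<^sup>2 + ?i w / e)"
      unfolding r_def
    proof (rule integral_mono)
      show "integrable M (\<lambda>w. if X (1 / real n) w < - \<delta> then ?e w else 0)"
        by (rule Bochner_Integration.integrable_bound[OF i1(1)]) auto
      show "integrable M (\<lambda>w. e / c * (?e w - 1)\<^sup>2 + ?i w / e)" using i3 i4 by simp
      fix w assume "w \<in> space M"
      show "(if X (1 / real n) w < - \<delta> then ?e w else 0) \<le> e / c * (?e w - 1)\<^sup>2 + ?i w / e"
      proof (cases "X (1 / real n) w < - \<delta>")
        case True
        let ?u = "?e w"
        have "\<gamma> * X (1 / n) w \<le> \<gamma> * (- \<delta>)" using True \<open>\<gamma> > 0\<close> by (intro mult_left_mono) auto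
        then have "1 \<le> ?u * exp (- \<gamma> * \<delta>)" by (simp flip: exp_add)
        then have a: "(1 - exp (- \<gamma> * \<delta>)) * ?u \<le> ?u - 1" by (simp add: algebra_simps)
        have "((1 - exp (- \<gamma> * \<delta>)) * ?u)\<^sup>2 \<le> (?u - 1)\<^sup>2"
          using a \<open>\<gamma> > 0\<close> \<open>\<delta> > 0\<close> by (intro power_mono) auto
        then have "c * ?u\<^sup>2 \<le> (?u - 1)\<^sup>2" by (simp add: c_def power_mult_distrib)
        then have b: "?u\<^sup>2 \<le> (?u - 1)\<^sup>2 / c" using c by (simp add: field_simps)
        have "?u \<le> e * ?u\<^sup>2 + 1 / e"
        proof -
          have "0 \<le> (e * ?u - 1)\<^sup>2 + e * ?u" using \<open>e > 0\<close> by simp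
          then have "e * ?u \<le> e * (e * ?u\<^sup>2 + 1 / e)"
            using \<open>e > 0\<close> by (simp add: power2_eq_square algebra_simps)
          then show ?thesis using \<open>e > 0\<close> by (simp only: mult_le_cancel_left_pos)
        qed
        also have "\<dots> \<le> e * ((?u - 1)\<^sup>2 / c) + 1 / e"
          using b \<open>e > 0\<close> by (intro add_mono mult_left_mono) auto
        finally show ?thesis using True \<open>w \<in> space M\<close> by simp
      qed (use \<open>e > 0\<close> c in auto)
    qed
    also have "\<dots> = e / c * q n + P n / e"
      using i3 i4 by (simp add: P_def)
    finally show ?thesis .
  qed
  have q: "(\<lambda>n. n * q n) \<longlonglongrightarrow> f (2 * \<gamma>) - 2 * f \<gamma>"
    unfolding q_def by real_asymp
  then have "Bseq (\<lambda>n. n * q n)" by (auto intro!: convergent_imp_Bseq convergentI)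
  then obtain K where K: "K > 0" "\<And>n. n * q n \<le> K" unfolding Bseq_def by (metis abs_le_D1 real_norm_def)
  show ?thesis
    unfolding r_def[symmetric]
  proof (rule LIMSEQ_I)
    fix s :: real assume "s > 0"
    \<comment> \<open>Makes the quadratic part contribute at most \<open>s / 2\<close> once
      \<open>n * q n \<le> K\<close>.\<close>
    define e where "e = s * c / (2 * K)"
    have e: "e > 0" using \<open>s > 0\<close> c K by (simp add: e_def)
    have "\<forall>\<^sub>F n in sequentially. n * P n < s * e / 2"
      using lower_tail_prob[OF \<open>\<delta> > 0\<close>] unfolding P_def[symmetric]
      by (rule order_tendstoD) (use \<open>s > 0\<close> e in simp)
    then have "\<forall>\<^sub>F n in sequentially. norm (n * r n - 0) < s"
      using eventually_gt_at_top[of 0]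
    proof eventually_elim
      case (elim n)
      have "0 \<le> r n" unfolding r_def by (intro integral_nonneg_AE) auto
      have "n * r n \<le> n * (e / c * q n + P n / e)"
        using le[OF elim(2) e] by (intro mult_left_mono) auto
      also have "\<dots> = e / c * (n * q n) + n * P n / e"
        by (simp add: algebra_simps)
      also have "\<dots> < e / c * K + s / 2"
      proof (rule add_le_less_mono)
        show "e / c * (n * q n) \<le> e / c * K" using K e c by (intro mult_left_mono) auto
        show "n * P n / e < s / 2" using elim(1) e by (simp add: field_simps)
      qed
      also have "e / c * K = s / 2" using c K by (simp add: e_def)
      finally have "n * r n < s" by simp
      with \<open>0 \<le> r n\<close> show ?case by simp
    qed
    then show "\<exists>no. \<forall>n\<ge>no. norm (n * r n - 0) < s" by (simp add: eventually_sequentially)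
  qed
qed

end

subsection \<open>The reflected process at an exponential time\<close>

lemma spos_path_bdd:
  assumes "spos_path f"
  shows "bdd_below (f ` {0..t})" "bdd_above (f ` {0..t})"
proof -
  have "bounded (f ` {0..t})"
    by (cases "0 \<le> t") (auto intro: spos_path_bounded[OF assms])
  then show "bdd_below (f ` {0..t})" "bdd_above (f ` {0..t})"
    by (auto intro: bounded_imp_bdd_below bounded_imp_bdd_above)
qed

text \<open>The time \<open>t\<close> is approached from above because the path is continuous only
  from the right there. Grid points beyond \<open>t\<close> lie within \<open>1 / n\<close> of it,
  where \<open>f\<close> is close to \<open>f t\<close>, so they do not disturb the infimum over
  \<open>[0, t]\<close>.\<close>

lemma spos_path_grid_above:
  assumes f: "spos_path f" and "t \<ge> 0"
  shows "(\<lambda>n. f (real (nat \<lceil>real n * t\<rceil>) / n)) \<longlonglongrightarrow> f t"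
    and "(\<lambda>n. Min ((\<lambda>j. f (real j / n)) ` {..nat \<lceil>real n * t\<rceil>})) \<longlonglongrightarrow> (INF s\<in>{0..t}. f s)"
proof -
  define c where "c n = real (nat \<lceil>real n * t\<rceil>)" for n
  have c: "real n * t \<le> c n" "c n < real n * t + 1" for n
    using \<open>t \<ge> 0\<close> by (auto simp: c_def of_nat_ceiling) (use ceiling_correct[of "real n * t"] in linarith)
  have c': "t \<le> c n / n" "c n / n < t + 1 / n" if "n > 0" for n
    using c[of n] that by (auto simp: field_simps)
  have near: "\<forall>\<^sub>F n in sequentially. \<forall>y. t \<le> y \<and> y \<le> c n / n \<longrightarrow> \<bar>f y - f t\<bar> < e" if e: "e > 0" for e
  proof -
    obtain d where d: "d > 0" "\<forall>y. t < y \<and> y < t + d \<longrightarrow> \<bar>f y - f t\<bar> < e"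
      using spos_pathD(2)[OF f \<open>t \<ge> 0\<close>] e unfolding tendsto_at_right_real_iff by blast
    from eventually_divide_nat_less[where c = 1, OF d(1)] eventually_gt_at_top[of 0] show ?thesis
    proof eventually_elim
      case (elim n)
      show ?case
      proof safe
        fix y assume "t \<le> y" "y \<le> c n / n"
        then show "\<bar>f y - f t\<bar> < e"
          using d(2)[rule_format, of y] c'(2)[OF elim(2)] elim(1) e by (cases "y = t") auto
      qed
    qed
  qed
  show "(\<lambda>n. f (real (nat \<lceil>real n * t\<rceil>) / n)) \<longlonglongrightarrow> f t"
    unfolding c_def[symmetric] tendsto_iff dist_real_def
  proof safe
    fix e :: real assume "e > 0"
    from near[OF this] eventually_gt_at_top[of 0]
    show "\<forall>\<^sub>F n in sequentially. \<bar>f (c n / n) - f t\<bar> < e"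
      by eventually_elim (use c' in blast)
  qed
  have "(\<lambda>n. Min (f ` ((\<lambda>j. real j / n) ` {..nat \<lceil>real n * t\<rceil>}))) \<longlonglongrightarrow> (INF s\<in>{0..t}. f s)"
  proof (rule Min_tendsto_INF)
    show "bdd_below (f ` {0..t})" by (rule spos_path_bdd[OF f])
    show "{0..t} \<noteq> {}" using \<open>t \<ge> 0\<close> by simp
    show "(f \<longlongrightarrow> f s) (at_right s)" if "s \<in> {0..t}" for s
      using that by (intro spos_pathD(2)[OF f]) auto
    show "\<forall>\<^sub>F n in sequentially. \<exists>a\<in>(\<lambda>j. real j / n) ` {..nat \<lceil>real n * t\<rceil>}. s \<le> a \<and> a < s + e"
      if s: "s \<in> {0..t}" "e > 0" for s e
      using eventually_divide_nat_less[where c = 1, OF s(2)] eventually_gt_at_top[of 0]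
    proof eventually_elim
      case (elim n)
      have "s \<le> real (nat \<lceil>real n * s\<rceil>) / n" "real (nat \<lceil>real n * s\<rceil>) / n < s + 1 / n"
        using elim s by (auto simp: field_simps of_nat_ceiling) (use ceiling_correct[of "real n * s"] in linarith)
      moreover have "nat \<lceil>real n * s\<rceil> \<le> nat \<lceil>real n * t\<rceil>"
        using s by (intro nat_mono ceiling_mono mult_left_mono) auto
      ultimately show ?case using elim by (intro bexI[OF _ imageI[of "nat \<lceil>real n * s\<rceil>"]]) auto
    qed
    show "\<forall>\<^sub>F n in sequentially. \<forall>a\<in>(\<lambda>j. real j / n) ` {..nat \<lceil>real n * t\<rceil>}. \<exists>s\<in>{0..t}. f s < f a + e"
      if e: "e > 0" for e
      using near[OF e] eventually_gt_at_top[of 0]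
    proof eventually_elim
      case (elim n)
      show ?case
      proof safe
        fix j assume j: "j \<le> nat \<lceil>real n * t\<rceil>"
        show "\<exists>s\<in>{0..t}. f s < f (real j / n) + e"
        proof (cases "real j / n \<le> t")
          case True
          then show ?thesis using e by (intro bexI[of _ "real j / n"]) auto
        next
          case False
          have "real j / n \<le> c n / n" using j by (simp add: c_def divide_right_mono)
          then have "\<bar>f (real j / n) - f t\<bar> < e" using elim False by auto
          then show ?thesis using \<open>t \<ge> 0\<close> by (intro bexI[of _ t]) auto
        qed
      qed
    qed
  qed auto
  then show "(\<lambda>n. Min ((\<lambda>j. f (real j / n)) ` {..nat \<lceil>real n * t\<rceil>})) \<longlonglongrightarrow> (INF s\<in>{0..t}. f s)"
    by (simp add: image_image)
qed

context levy_process
begin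

text \<open>Countably many times suffice by right-continuity; \<open>t\<close> itself has to be added as it may be
  irrational.\<close>
definition run_inf :: "real \<Rightarrow> 'a \<Rightarrow> real" where
  "run_inf t w = (INF s\<in>insert t ({0..t} \<inter> \<rat>). X s w)"

text \<open>\<open>min (- z) (run_inf t)\<close> is the negative of \<open>max z (- inf X)\<close>. Replacing \<open>t\<close> by
  \<open>max 0 t\<close> makes this measurable in all of \<open>t\<close>.\<close>
definition reflected_laplace :: "real \<Rightarrow> real \<Rightarrow> real \<Rightarrow> real" where
  "reflected_laplace \<gamma> z t =
    expectation (\<lambda>w. exp (- \<gamma> * (X (max 0 t) w - min (- z) (run_inf (max 0 t) w))))"

lemma borel_measurable_run_inf [measurable]:
  assumes "t \<ge> 0"
  shows "run_inf t \<in> borel_measurable M"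
  unfolding run_inf_def using assms
  by (intro borel_measurable_cINF_real random_variable) (auto intro: countable_rat)

lemma run_inf_eq:
  assumes f: "spos_path (\<lambda>t. X t w)" and "t \<ge> 0"
  shows "run_inf t w = (INF s\<in>{0..t}. X s w)"
  unfolding run_inf_def
proof (rule INF_right_dense)
  show "bdd_below ((\<lambda>s. X s w) ` {0..t})" by (rule spos_path_bdd[OF f])
  show "((\<lambda>s. X s w) \<longlongrightarrow> X s w) (at_right s)" if "s \<in> {0..t}" for s
    using that by (intro spos_pathD(2)[OF f]) auto
  show "\<exists>a\<in>insert t ({0..t} \<inter> \<rat>). s \<le> a \<and> a < s + e" if se: "s \<in> {0..t}" "0 < e" for s e
  proof (cases "s = t")
    case False
    then obtain q where "q \<in> \<rat>" "s < q" "q < min t (s + e)"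
      using Rats_dense_in_real[of s "min t (s + e)"] se by auto
    then show ?thesis using se by (intro bexI[of _ q]) auto
  qed (use se in auto)
qed (use \<open>t \<ge> 0\<close> in auto)

lemma run_inf_le:
  assumes f: "spos_path (\<lambda>t. X t w)" and "t \<ge> 0" "s \<in> {0..t}"
  shows "run_inf t w \<le> X s w"
  unfolding run_inf_eq[OF assms(1,2)] by (rule cINF_lower[OF spos_path_bdd(1)[OF f] assms(3)])

end

section \<open>Grid approximation of the reflected process\<close>

context spectrally_positive_levy_process
begin

lemma reflected_laplace_bounds:
  assumes "\<gamma> \<ge> 0"
  shows "0 \<le> reflected_laplace \<gamma> z t" "reflected_laplace \<gamma> z t \<le> 1"
proof -
  show "0 \<le> reflected_laplace \<gamma> z t"
    unfolding reflected_laplace_def by (intro integral_nonneg_AE) auto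
  have [measurable]: "X (max 0 t) \<in> borel_measurable M" "run_inf (max 0 t) \<in> borel_measurable M"
    by (auto intro: random_variable borel_measurable_run_inf)
  have ae: "AE w in M. exp (- \<gamma> * (X (max 0 t) w - min (- z) (run_inf (max 0 t) w))) \<le> 1"
    using AE_spos_path
  proof eventually_elim
    case (elim w)
    have "0 \<le> \<gamma> * (X (max 0 t) w - min (- z) (run_inf (max 0 t) w))"
      using run_inf_le[OF elim, of "max 0 t" "max 0 t"] assms by (intro mult_nonneg_nonneg) auto
    then show ?case by simp
  qed
  have "reflected_laplace \<gamma> z t \<le> expectation (\<lambda>_. 1)"
    unfolding reflected_laplace_def
    by (intro integral_mono_AE integrable_const_bound[where B = 1]) (use ae in auto)
  then show "reflected_laplace \<gamma> z t \<le> 1" by (simp add: prob_space)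
qed

text \<open>Agrees with \<open>X (j / n)\<close> where \<open>X 0 = 0\<close>, that is almost
  surely. Written as a sum of increments it starts at 0 for every outcome and fits
  \<open>reflected_walk_step\<close>.\<close>

definition grid_walk :: "nat \<Rightarrow> 'a \<Rightarrow> nat \<Rightarrow> real" where
  "grid_walk n w j = (\<Sum>i<j. X (real (Suc i) / n) w - X (real i / n) w)"

definition grid_laplace :: "real \<Rightarrow> nat \<Rightarrow> nat \<Rightarrow> real \<Rightarrow> real" where
  "grid_laplace \<gamma> n k z = expectation (\<lambda>w. exp (- \<gamma> * (grid_walk n w k - capped_min z (grid_walk n w) k)))"

lemma borel_measurable_grid_walk [measurable]: "(\<lambda>w. grid_walk n w j) \<in> borel_measurable M"
  unfolding grid_walk_def by (intro borel_measurable_sum borel_measurable_diff random_variable) auto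

lemma grid_walk_eq: "X 0 w = 0 \<Longrightarrow> grid_walk n w j = X (real j / n) w"
  unfolding grid_walk_def using sum_lessThan_telescope[of "\<lambda>i. X (real i / n) w" j] by simp

lemma grid_laplace_bound:
  assumes "\<gamma> \<ge> 0"
  shows "\<bar>grid_laplace \<gamma> n k z\<bar> \<le> 1"
proof -
  have *: "exp (- \<gamma> * (grid_walk n w k - capped_min z (grid_walk n w) k)) \<le> 1" for w
    using capped_min_le[of z "grid_walk n w" k] assms by (simp add: mult_left_mono)
  have "grid_laplace \<gamma> n k z \<le> expectation (\<lambda>_. 1)"
    unfolding grid_laplace_def
    by (intro integral_mono integrable_const_bound[where B = 1]) (use * in auto)
  moreover have "0 \<le> grid_laplace \<gamma> n k z" unfolding grid_laplace_def by (intro integral_nonneg_AE) auto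
  ultimately show ?thesis by (simp add: prob_space)
qed

lemma grid_laplace_tendsto:
  assumes "\<gamma> \<ge> 0"
  shows "(\<lambda>n. grid_laplace \<gamma> n (nat \<lceil>real n * t\<rceil>) z) \<longlonglongrightarrow> reflected_laplace \<gamma> z t"
  unfolding grid_laplace_def reflected_laplace_def
proof (rule integral_dominated_convergence[where w = "\<lambda>_. 1"])
  let ?G = "\<lambda>n w. exp (- \<gamma> * (grid_walk n w (nat \<lceil>real n * t\<rceil>) - capped_min z (grid_walk n w) (nat \<lceil>real n * t\<rceil>)))"
  let ?H = "\<lambda>w. exp (- \<gamma> * (X (max 0 t) w - min (- z) (run_inf (max 0 t) w)))"
  \<comment> \<open>For negative \<open>t\<close> the integer conversion gives 0, in accordance with
    \<open>max 0 t\<close> in \<open>reflected_laplace\<close>.\<close>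
  have c: "nat \<lceil>real n * t\<rceil> = nat \<lceil>real n * max 0 t\<rceil>" for n
    by (auto simp: max_def ceiling_le_zero mult_nonneg_nonpos)
  have [measurable]: "X (max 0 t) \<in> borel_measurable M" "run_inf (max 0 t) \<in> borel_measurable M"
    by (auto intro: random_variable borel_measurable_run_inf)
  show "(\<lambda>w. ?H w) \<in> borel_measurable M"
    by measurable
  show "(\<lambda>w. ?G n w)
    \<in> borel_measurable M" for n by measurable
  show "AE w in M. (\<lambda>n. ?G n w)
      \<longlonglongrightarrow> ?H w"
    using AE_spos_path
  proof eventually_elim
    case (elim w)
    have w: "grid_walk n w = (\<lambda>j. X (real j / n) w)" for n
      using grid_walk_eq[of w] spos_pathD(1)[OF elim] by auto
    show ?case
      unfolding w c capped_min_def run_inf_eq[OF elim max.cobounded1]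
      by (intro tendsto_intros spos_path_grid_above[OF elim]) simp_all
  qed
  show "AE w in M. norm (?G n w) \<le> 1" for n
    using capped_min_le assms by (simp add: mult_left_mono)
qed auto

text \<open>A pointwise limit of functions that depend on the time only through an integer; for each
  fixed integer, measurability in \<open>z\<close> suffices. This avoids joint measurability of the
  process in time and outcome.\<close>

lemma borel_measurable_reflected_laplace [measurable]:
  assumes "\<gamma> \<ge> 0"
  shows "(\<lambda>p. reflected_laplace \<gamma> (snd p) (fst p)) \<in> borel_measurable (borel \<Otimes>\<^sub>M borel)"
proof (rule borel_measurable_LIMSEQ_real)
  show "(\<lambda>n. grid_laplace \<gamma> n (nat \<lceil>real n * fst p\<rceil>) (snd p)) \<longlonglongrightarrow> reflected_laplace \<gamma> (snd p) (fst p)" for p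
    by (rule grid_laplace_tendsto[OF assms])
  have [measurable]: "grid_laplace \<gamma> n k \<in> borel_measurable borel" for n k
    unfolding grid_laplace_def[abs_def]
    by (rule borel_measurable_lebesgue_integral) measurable
  show "(\<lambda>p. grid_laplace \<gamma> n (nat \<lceil>real n * fst p\<rceil>) (snd p)) \<in> borel_measurable (borel \<Otimes>\<^sub>M borel)" for n
  proof (rule measurable_compose_countable)
    show "(\<lambda>p. grid_laplace \<gamma> n k (snd p)) \<in> borel_measurable (borel \<Otimes>\<^sub>M borel)" for k
      by measurable
    show "(\<lambda>p :: real \<times> real. nat \<lceil>real n * fst p\<rceil>) \<in> (borel \<Otimes>\<^sub>M borel) \<rightarrow>\<^sub>M count_space UNIV"
      by measurable
  qed
qed

text \<open>An instance of \<open>renewal_limit\<close> whose two sequences are the grid transforms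
  of order \<gamma> and \<beta>, with initial values \<open>exp (- \<gamma> * z)\<close> and
  \<open>exp (- \<beta> * z)\<close> and \<open>c = \<gamma> / \<beta>\<close>. The condition
  \<open>\<beta> \<le> \<gamma>\<close> gives the comparison of the losses. Rounding
  \<open>n * T\<close> up identifies the limit of the discounted sums with the average over
  \<open>T\<close>.\<close>

lemma reflected_laplace_exponential:
  assumes int: "integrable M (\<lambda>w. exp (- \<beta> * X 1 w))" and "0 < \<beta>" "\<beta> \<le> \<gamma>"
    and l: "l = ln (expectation (\<lambda>w. exp (- \<beta> * X 1 w)))" "0 < l"
    and T: "distributed M lborel T (exponential_density l)" and "0 \<le> z"
  shows "expectation (\<lambda>w. reflected_laplace \<gamma> z (T w)) * ((ln (expectation (\<lambda>w. exp (- \<gamma> * X 1 w))) - l) / l)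
    = \<gamma> / \<beta> * exp (- \<beta> * z) - exp (- \<gamma> * z)"
proof -
  have \<gamma>: "\<gamma> > 0" using assms by simp
  have all: "integrable M (\<lambda>w. exp (- \<theta> * X 1 w))" if "\<theta> \<ge> 0" for \<theta>
    by (rule integrable_exp_all[OF int \<open>0 < \<beta>\<close> that])
  define \<xi> where "\<xi> n i w = X (real (Suc i) / n) w - X (real i / n) w" for n i :: nat and w
  have m\<xi> [measurable]: "\<xi> n i \<in> borel_measurable M" for n i
    unfolding \<xi>_def by (auto intro!: random_variable borel_measurable_diff)
  have mX [measurable]: "X (1 / real n) \<in> borel_measurable M" for n by (auto intro!: random_variable)
  have ind: "indep_vars (\<lambda>_. borel) (\<xi> n) {..<k}" if "n > 0" for n k
    using grid_increments_indep[of 0 "1 / n" k] that by (simp add: \<xi>_def[abs_def])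
  have law: "distr M borel (\<xi> n i) = distr M borel (X (1 / n))" if "n > 0" for n i
    using grid_increments_distr[of 0 "1 / n" i] that by (simp add: \<xi>_def[abs_def])
  have E\<xi>: "expectation (\<lambda>w. F (\<xi> n i w)) = expectation (\<lambda>w. F (X (1 / n) w))"
    "integrable M (\<lambda>w. F (\<xi> n i w)) \<longleftrightarrow> integrable M (\<lambda>w. F (X (1 / n) w))"
    if [measurable]: "F \<in> borel_measurable borel" and "n > 0" for F :: "real \<Rightarrow> real" and n i
    using law[OF \<open>n > 0\<close>, of i] integral_distr[of "\<xi> n i" M borel F] integral_distr[of "X (1 / n)" M borel F]
      integrable_distr_eq[of "\<xi> n i" M borel F] integrable_distr_eq[of "X (1 / n)" M borel F] by simp_all
  have W: "grid_walk n w = (\<lambda>j. \<Sum>i<j. \<xi> n i w)" for n w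
    by (auto simp: grid_walk_def \<xi>_def)
  define o' where "o' n k w = max 0 (capped_min z (grid_walk n w) k - grid_walk n w (Suc k))" for n k w
  let ?d = "\<lambda>\<theta> n k. expectation (\<lambda>w. exp (\<theta> * o' n k w) - 1)"
  have mo [measurable]: "o' n k \<in> borel_measurable M" for n k
    unfolding o'_def by measurable
  have step: "integrable M (\<lambda>w. exp (\<theta> * o' n k w))"
      "grid_laplace \<theta> n (Suc k) z = exp (ln (expectation (\<lambda>w. exp (- \<theta> * X 1 w))) / n) * grid_laplace \<theta> n k z
        - ?d \<theta> n k"
    if "n > 0" "\<theta> \<ge> 0" for n k \<theta>
  proof -
    have i: "integrable M (\<lambda>w. exp (- \<theta> * \<xi> n k w))"
      using exp_moment_inverse_nat(1)[OF all[OF that(2)] that(1)] E\<xi>(2)[of "\<lambda>x. exp (- \<theta> * x)"] that by simp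
    have e: "expectation (\<lambda>w. exp (- \<theta> * \<xi> n k w)) = exp (ln (expectation (\<lambda>w. exp (- \<theta> * X 1 w))) / n)"
      using exp_moment_inverse_nat(2)[OF all[OF that(2)] that(1)] E\<xi>(1)[of "\<lambda>x. exp (- \<theta> * x)"] that by simp
    note rw = reflected_walk_step[OF ind[OF that(1)] i that(2), of z, folded W, unfolded e]
    show "integrable M (\<lambda>w. exp (\<theta> * o' n k w))" using rw(1) by (simp only: o'_def W)
    show "grid_laplace \<theta> n (Suc k) z = exp (ln (expectation (\<lambda>w. exp (- \<theta> * X 1 w))) / n) * grid_laplace \<theta> n k z
        - ?d \<theta> n k"
      using rw(2) by (simp only: o'_def grid_laplace_def W)
  qed
  have init: "grid_laplace \<theta> n 0 z = exp (- \<theta> * z)" for \<theta> n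
    using \<open>0 \<le> z\<close> by (simp add: grid_laplace_def capped_min_0 grid_walk_def prob_space)
  have o0: "0 \<le> o' n k w" for n k w by (simp add: o'_def)
  \<comment> \<open>The minimum lies below the current position, so it cannot fall by more than the
    walk does in that step.\<close>
  have o\<xi>: "o' n k w \<le> max 0 (- \<xi> n k w)" for n k w
    using capped_min_le[of z "grid_walk n w" k] by (auto simp: o'_def W)
  have lim: "(\<lambda>n. expectation (\<lambda>w. grid_laplace \<gamma> n (nat \<lceil>real n * T w\<rceil>) z)) \<longlonglongrightarrow> expectation (\<lambda>w. reflected_laplace \<gamma> z (T w))"
  proof (rule integral_dominated_convergence[where w = "\<lambda>_. 1"])
    have [measurable]: "T \<in> borel_measurable M" using T by (auto simp: distributed_def)
    have "(\<lambda>w. reflected_laplace \<gamma> (snd (T w, z)) (fst (T w, z))) \<in> borel_measurable M"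
      by (rule measurable_compose[OF _ borel_measurable_reflected_laplace]) (use \<gamma> in auto)
    then show "(\<lambda>w. reflected_laplace \<gamma> z (T w)) \<in> borel_measurable M" by simp
    show "AE w in M. (\<lambda>n. grid_laplace \<gamma> n (nat \<lceil>real n * T w\<rceil>) z) \<longlonglongrightarrow> reflected_laplace \<gamma> z (T w)"
      using \<gamma> by (intro AE_I2 grid_laplace_tendsto) simp
    show "AE w in M. norm (grid_laplace \<gamma> n (nat \<lceil>real n * T w\<rceil>) z) \<le> 1" for n
      using \<gamma> by (auto intro!: grid_laplace_bound)
    show "(\<lambda>w. grid_laplace \<gamma> n (nat \<lceil>real n * T w\<rceil>) z) \<in> borel_measurable M" for n
      by (rule measurable_compose[where N = "count_space UNIV"]) measurable
  qed auto
  show ?thesis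
  proof (rule renewal_limit[where g = "\<lambda>n k. grid_laplace \<gamma> n k z" and h = "\<lambda>n k. grid_laplace \<beta> n k z"
        and d = "\<lambda>n k. ?d \<gamma> n k"
        and e = "\<lambda>n k. ?d \<beta> n k"])
    show "\<bar>grid_laplace \<gamma> n k z\<bar> \<le> 1" "\<bar>grid_laplace \<beta> n k z\<bar> \<le> 1" for n k
      using \<gamma> \<open>0 < \<beta>\<close> by (auto intro!: grid_laplace_bound)
    show "grid_laplace \<gamma> n (Suc k) z = exp (ln (expectation (\<lambda>w. exp (- \<gamma> * X 1 w))) / n) * grid_laplace \<gamma> n k z
        - ?d \<gamma> n k" if "n > 0" for n k
      using step(2)[OF that, of \<gamma>] \<gamma> by simp
    show "grid_laplace \<beta> n (Suc k) z = exp (l / n) * grid_laplace \<beta> n k z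
        - ?d \<beta> n k" if "n > 0" for n k
      using step(2)[OF that, of \<beta>] \<open>0 < \<beta>\<close> l(1) by simp
    show "\<gamma> / \<beta> * ?d \<beta> n k \<le> ?d \<gamma> n k"
      if "n > 0" for n k
    proof -
      have "\<gamma> / \<beta> * ?d \<beta> n k = expectation (\<lambda>w. \<gamma> / \<beta> * (exp (\<beta> * o' n k w) - 1))"
        by simp
      also have "\<dots> \<le> ?d \<gamma> n k"
        using step(1)[OF that] \<gamma> \<open>0 < \<beta>\<close>
        by (intro integral_mono exp_excess_nonneg o0 \<open>\<beta> \<le> \<gamma>\<close>) auto
      finally show ?thesis .
    qed
    show "\<exists>r::nat \<Rightarrow> real. (\<lambda>n. n * r n) \<longlonglongrightarrow> 0 \<and>
      (\<forall>n>0. \<forall>k. ?d \<gamma> n k - \<gamma> / \<beta> * ?d \<beta> n k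
        \<le> \<kappa> * ?d \<beta> n k + r n)" if "\<kappa> > 0" for \<kappa>
    proof -
      \<comment> \<open>The first bound keeps \<open>\<gamma> * \<delta> \<le> 1\<close> for the
        exponential estimate, the second turns the coefficient
        \<open>\<gamma>^2 * \<delta> / \<beta>\<close> into at most \<kappa>.\<close>
      define \<delta> where "\<delta> = min (1 / \<gamma>) (\<kappa> * \<beta> / \<gamma>\<^sup>2)"
      have \<delta>: "\<delta> > 0" "\<gamma> * \<delta> \<le> 1" "\<gamma>\<^sup>2 * \<delta> / \<beta> \<le> \<kappa>"
      proof -
        show "\<delta> > 0" using \<gamma> \<open>0 < \<beta>\<close> \<open>\<kappa> > 0\<close> by (simp add: \<delta>_def)
        have "\<delta> \<le> 1 / \<gamma>" "\<delta> \<le> \<kappa> * \<beta> / \<gamma>\<^sup>2" by (auto simp: \<delta>_def)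
        then show "\<gamma> * \<delta> \<le> 1" "\<gamma>\<^sup>2 * \<delta> / \<beta> \<le> \<kappa>" using \<gamma> \<open>0 < \<beta>\<close> by (auto simp: field_simps)
      qed
      define tail where "tail x = (if x < - \<delta> then exp (- \<gamma> * x) else 0)" for x
      have [measurable]: "tail \<in> borel_measurable borel" unfolding tail_def by measurable
      define r where "r n = expectation (\<lambda>w. tail (X (1 / real n) w))" for n :: nat
      have r: "(\<lambda>n. n * r n) \<longlonglongrightarrow> 0"
        unfolding r_def tail_def by (rule lower_tail_exp_moment[OF all \<gamma> \<delta>(1)])
      have "?d \<gamma> n k - \<gamma> / \<beta> * ?d \<beta> n k
        \<le> \<kappa> * ?d \<beta> n k + r n" if "n > 0" for n k
      proof -
        have it: "integrable M (\<lambda>w. tail (X (1 / real n) w))"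
          by (rule Bochner_Integration.integrable_bound[OF exp_moment_inverse_nat(1)[OF all \<open>n > 0\<close>, of \<gamma>]])
            (use \<gamma> in \<open>auto simp: tail_def\<close>)
        then have it': "integrable M (\<lambda>w. tail (\<xi> n k w))"
          using E\<xi>(2)[of tail n k] that by simp
        have ib: "integrable M (\<lambda>w. exp (\<beta> * o' n k w) - 1)" and ig: "integrable M (\<lambda>w. exp (\<gamma> * o' n k w) - 1)"
          using step(1)[OF that] \<gamma> \<open>0 < \<beta>\<close> by auto
        have "?d \<gamma> n k - expectation (\<lambda>w. \<gamma> / \<beta> * (exp (\<beta> * o' n k w) - 1)) =
          expectation (\<lambda>w. exp (\<gamma> * o' n k w) - 1 - \<gamma> / \<beta> * (exp (\<beta> * o' n k w) - 1))"
          by (rule Bochner_Integration.integral_diff[OF ig Bochner_Integration.integrable_mult_right, symmetric])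
            (use ib in blast)
        also have "\<dots> \<le> expectation (\<lambda>w. \<kappa> * (exp (\<beta> * o' n k w) - 1) + tail (\<xi> n k w))"
        proof (rule integral_mono)
          show "integrable M (\<lambda>w. exp (\<gamma> * o' n k w) - 1 - \<gamma> / \<beta> * (exp (\<beta> * o' n k w) - 1))"
            by (rule Bochner_Integration.integrable_diff[OF ig Bochner_Integration.integrable_mult_right]) (use ib in blast)
          show "integrable M (\<lambda>w. \<kappa> * (exp (\<beta> * o' n k w) - 1) + tail (\<xi> n k w))"
            by (rule Bochner_Integration.integrable_add[OF Bochner_Integration.integrable_mult_right it']) (use ib in blast)
          fix w
          have "exp (\<gamma> * o' n k w) - 1 - \<gamma> / \<beta> * (exp (\<beta> * o' n k w) - 1) \<le>
            \<gamma>\<^sup>2 * \<delta> / \<beta> * (exp (\<beta> * o' n k w) - 1) + tail (\<xi> n k w)"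
            unfolding tail_def
            by (rule exp_excess_le[OF \<open>0 < \<beta>\<close> \<open>\<beta> \<le> \<gamma>\<close> o0 o\<xi> \<delta>(2) \<delta>(1)])
          also have "\<dots> \<le> \<kappa> * (exp (\<beta> * o' n k w) - 1) + tail (\<xi> n k w)"
            using \<delta>(3) o0[of n k w] \<open>0 < \<beta>\<close> by (intro add_right_mono mult_right_mono) auto
          finally show "exp (\<gamma> * o' n k w) - 1 - \<gamma> / \<beta> * (exp (\<beta> * o' n k w) - 1) \<le>
            \<kappa> * (exp (\<beta> * o' n k w) - 1) + tail (\<xi> n k w)" .
        qed
        also have "\<dots> = expectation (\<lambda>w. \<kappa> * (exp (\<beta> * o' n k w) - 1)) + expectation (\<lambda>w. tail (\<xi> n k w))"
          by (rule Bochner_Integration.integral_add[OF Bochner_Integration.integrable_mult_right it']) (use ib in blast)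
        also have "\<dots> = \<kappa> * ?d \<beta> n k + r n"
          using E\<xi>(1)[of tail n k] that by (simp add: r_def)
        finally show ?thesis by (simp only: integral_mult_right_zero)
      qed
      with r show ?thesis by blast
    qed
    show "(\<lambda>n. (1 - exp (- l / n)) * (\<Sum>k. exp (- l / n) ^ k * grid_laplace \<gamma> n (Suc k) z))
      \<longlonglongrightarrow> expectation (\<lambda>w. reflected_laplace \<gamma> z (T w))"
    proof (rule Lim_transform_eventually[OF lim])
      show "\<forall>\<^sub>F n in sequentially. expectation (\<lambda>w. grid_laplace \<gamma> n (nat \<lceil>real n * T w\<rceil>) z) =
        (1 - exp (- l / n)) * (\<Sum>k. exp (- l / n) ^ k * grid_laplace \<gamma> n (Suc k) z)"
        using eventually_gt_at_top[of 0]
        by eventually_elim (rule expectation_ceiling_exponential[OF T \<open>0 < l\<close>], auto intro!: grid_laplace_bound less_imp_le[OF \<gamma>])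
    qed
  qed (use init \<open>0 < l\<close> \<gamma> \<open>0 < \<beta>\<close> in auto)
qed

end

subsection \<open>Time reversal\<close>

text \<open>For well-behaved paths starting at 0 this is \<open>exp (- \<gamma> * sup_before r f)\<close>. Using only
  rational times makes it a measurable function of the path, \<open>r\<close> and \<open>f\<close>; the cap at 1 keeps it bounded
  on bad paths.\<close>
definition exp_sup :: "real \<Rightarrow> real \<Rightarrow> (real \<Rightarrow> real) \<Rightarrow> real" where
  "exp_sup \<gamma> r f = (INF q\<in>{0..} \<inter> \<rat>. if q < r then min 1 (exp (- \<gamma> * f q)) else 1)"

lemma exp_sup_bounds: "0 \<le> exp_sup \<gamma> r f" "exp_sup \<gamma> r f \<le> 1"
proof -
  have ne: "{0..} \<inter> \<rat> \<noteq> ({} :: real set)" by (auto intro: exI[of _ 0])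
  show "0 \<le> exp_sup \<gamma> r f"
    unfolding exp_sup_def by (rule cINF_greatest[OF ne]) auto
  have "exp_sup \<gamma> r f \<le> (if 0 < r then min 1 (exp (- \<gamma> * f 0)) else 1)"
    unfolding exp_sup_def by (rule cINF_lower) (auto intro!: bdd_belowI[of _ 0])
  then show "exp_sup \<gamma> r f \<le> 1" by (auto split: if_splits)
qed

text \<open>As \<open>exp (- \<gamma> * _)\<close> is decreasing, an infimum of exponentials encodes
  a supremum. The value \<open>f 0 = 0\<close> makes the cap at 1 harmless, and right-continuity
  passes from rational times to all times below \<open>r\<close>.\<close>

lemma exp_sup_eq:
  assumes "f 0 = 0" "\<gamma> > 0" "r > 0"
    and rc: "\<And>s. 0 \<le> s \<Longrightarrow> s < r \<Longrightarrow> (f \<longlongrightarrow> f s) (at_right s)"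
    and bdd: "bdd_above (f ` {0..<r})"
  shows "exp_sup \<gamma> r f = exp (- \<gamma> * sup_before r f)"
proof (rule antisym)
  have ne: "{0..} \<inter> \<rat> \<noteq> ({} :: real set)" by (auto intro: exI[of _ 0])
  have up: "f s \<le> sup_before r f" if "0 \<le> s" "s < r" for s
    unfolding sup_before_def using that by (intro cSUP_upper[OF _ bdd]) auto
  show ge: "exp (- \<gamma> * sup_before r f) \<le> exp_sup \<gamma> r f"
    unfolding exp_sup_def
  proof (rule cINF_greatest[OF ne])
    fix q :: real assume q: "q \<in> {0..} \<inter> \<rat>"
    show "exp (- \<gamma> * sup_before r f) \<le> (if q < r then min 1 (exp (- \<gamma> * f q)) else 1)"
      using up[of q] up[of 0] q assms(1-3) by (auto simp: mult_left_mono)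
  qed
  \<comment> \<open>Allows the logarithm to be taken, which turns the bound on each exponential into
    one on the supremum.\<close>
  then have pos: "exp_sup \<gamma> r f > 0" by (rule less_le_trans[rotated]) simp
  have le: "exp_sup \<gamma> r f \<le> exp (- \<gamma> * f s)" if s: "0 \<le> s" "s < r" for s
  proof (rule field_le_epsilon)
    fix e :: real assume "e > 0"
    have "((\<lambda>s. exp (- \<gamma> * f s)) \<longlongrightarrow> exp (- \<gamma> * f s)) (at_right s)"
      by (intro tendsto_intros rc s)
    then obtain d where d: "d > 0" "\<forall>y. s < y \<and> y < s + d \<longrightarrow> \<bar>exp (- \<gamma> * f y) - exp (- \<gamma> * f s)\<bar> < e"
      using \<open>e > 0\<close> unfolding tendsto_at_right_real_iff by blast
    obtain q where q: "q \<in> \<rat>" "s < q" "q < min r (s + d)"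
      using Rats_dense_in_real[of s "min r (s + d)"] s d(1) by auto
    have "exp_sup \<gamma> r f \<le> (if q < r then min 1 (exp (- \<gamma> * f q)) else 1)"
      unfolding exp_sup_def by (rule cINF_lower) (use q s in \<open>auto intro!: bdd_belowI[of _ 0]\<close>)
    also have "\<dots> \<le> exp (- \<gamma> * f s) + e"
      using d(2)[rule_format, of q] q by auto
    finally show "exp_sup \<gamma> r f \<le> exp (- \<gamma> * f s) + e" .
  qed
  have "sup_before r f \<le> - ln (exp_sup \<gamma> r f) / \<gamma>"
    unfolding sup_before_def
  proof (rule cSUP_least)
    fix s assume "s \<in> {0..<r}"
    then have "ln (exp_sup \<gamma> r f) \<le> ln (exp (- \<gamma> * f s))"
      using le[of s] pos by (subst ln_le_cancel_iff) auto
    then have "ln (exp_sup \<gamma> r f) \<le> - \<gamma> * f s" by simp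
    then show "f s \<le> - ln (exp_sup \<gamma> r f) / \<gamma>" using \<open>\<gamma> > 0\<close> by (simp add: field_simps)
  qed (use \<open>r > 0\<close> in auto)
  then have "ln (exp_sup \<gamma> r f) \<le> - \<gamma> * sup_before r f" using \<open>\<gamma> > 0\<close> by (simp add: field_simps)
  then have "exp (ln (exp_sup \<gamma> r f)) \<le> exp (- \<gamma> * sup_before r f)" by simp
  then show "exp_sup \<gamma> r f \<le> exp (- \<gamma> * sup_before r f)" using pos by simp
qed

text \<open>The index \<open>n\<close> is left out of the grid because the supremum is over times
  strictly before \<open>v\<close>. A sign change reduces the claim to minima.\<close>

lemma Max_grid_tendsto_sup_before:
  fixes f :: "real \<Rightarrow> real"
  assumes "v > 0"
    and rc: "\<And>s. 0 \<le> s \<Longrightarrow> s < v \<Longrightarrow> (f \<longlongrightarrow> f s) (at_right s)"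
    and bdd: "bdd_above (f ` {0..<v})"
  shows "(\<lambda>n. Max ((\<lambda>k. f (real k * (v / real n))) ` {..<n})) \<longlonglongrightarrow> sup_before v f"
proof -
  have "(\<lambda>n. Min ((\<lambda>s. - f s) ` (\<lambda>k. real k * (v / real n)) ` {..<n})) \<longlonglongrightarrow> (INF s\<in>{0..<v}. - f s)"
  proof (rule Min_tendsto_INF)
    show "bdd_below ((\<lambda>s. - f s) ` {0..<v})"
      using bdd unfolding bdd_above_def bdd_below_def by (force intro: exI[of _ "- _"])
    show "((\<lambda>s. - f s) \<longlongrightarrow> - f s) (at_right s)" if "s \<in> {0..<v}" for s
      using that by (intro tendsto_minus rc) auto
    show "\<forall>\<^sub>F n in sequentially. \<exists>a\<in>(\<lambda>k. real k * (v / real n)) ` {..<n}. s \<le> a \<and> a < s + e"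
      if s: "s \<in> {0..<v}" "e > 0" for s e
    proof -
      \<comment> \<open>A mesh below \<open>v - s\<close> guarantees that the first grid point at or
        after \<open>s\<close> is still before \<open>v\<close>, that is
        \<open>k < n\<close>.\<close>
      have "0 < min e (v - s)" using s by simp
      from eventually_divide_nat_less[where c = v, OF this] eventually_gt_at_top[of 0] show ?thesis
      proof eventually_elim
        case (elim n)
        define k where "k = nat \<lceil>s / (v / n)\<rceil>"
        have h: "v / n > 0" using elim \<open>v > 0\<close> by simp
        have "0 \<le> s / (v / n)" using s h by simp
        then have "s / (v / n) \<le> k" "k < s / (v / n) + 1" unfolding k_def by linarith+
        then have "s / (v / n) \<le> k" "real k - 1 < s / (v / n)" by linarith+
        then have "s \<le> k * (v / n)" "(real k - 1) * (v / n) < s"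
          unfolding pos_divide_le_eq[OF h] pos_less_divide_eq[OF h] .
        then have k: "s \<le> k * (v / n)" "k * (v / n) < s + v / n"
          unfolding left_diff_distrib mult_1 by linarith+
        then have "k * (v / n) < n * (v / n)" using elim by auto
        then have "k < n" using h by (simp only: mult_less_cancel_right_pos of_nat_less_iff)
        then show ?case using k elim by (intro bexI[OF _ imageI[of k]]) auto
      qed
    qed
    show "\<forall>\<^sub>F n in sequentially. (\<lambda>k. real k * (v / real n)) ` {..<n} \<noteq> {}"
      using eventually_gt_at_top[of 0] by eventually_elim auto
    show "\<forall>\<^sub>F n in sequentially. \<forall>a\<in>(\<lambda>k. real k * (v / real n)) ` {..<n}. \<exists>s\<in>{0..<v}. - f s < - f a + e"
      if "e > 0" for e
      using eventually_gt_at_top[of 0]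
    proof eventually_elim
      case (elim n)
      have *: "real k * (v / n) \<in> {0..<v}" if "k < n" for k using that elim \<open>v > 0\<close> by (auto simp: field_simps)
      show ?case
      proof
        fix a assume "a \<in> (\<lambda>k. real k * (v / real n)) ` {..<n}"
        then have "a \<in> {0..<v}" using * by force
        moreover have "- f a < - f a + e" using \<open>e > 0\<close> by simp
        ultimately show "\<exists>s\<in>{0..<v}. - f s < - f a + e" by (rule bexI[rotated])
      qed
    qed
  qed (use \<open>v > 0\<close> in auto)
  then have lim: "(\<lambda>n. - Min ((\<lambda>s. - f s) ` (\<lambda>k. real k * (v / real n)) ` {..<n})) \<longlonglongrightarrow> - (INF s\<in>{0..<v}. - f s)"
    by (rule tendsto_minus)
  have eq: "- (INF s\<in>{0..<v}. - f s) = sup_before v f"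
    unfolding sup_before_def Inf_real_def by (simp add: image_image)
  have "\<forall>\<^sub>F n in sequentially. - Min ((\<lambda>s. - f s) ` (\<lambda>k. real k * (v / real n)) ` {..<n}) =
      Max ((\<lambda>k. f (real k * (v / real n))) ` {..<n})"
    using eventually_gt_at_top[of 0]
  proof eventually_elim
    case (elim n)
    then show ?case
      by (subst minus_Min_eq_Max) (auto simp: image_image)
  qed
  then show ?thesis by (rule Lim_transform_eventually[OF lim[unfolded eq]])
qed

text \<open>The grid contains \<open>t\<close> but not 0, as time reversal produces it;
  right-continuity at 0 makes up for the missing point.\<close>

lemma Min_grid_tendsto_INF:
  fixes f :: "real \<Rightarrow> real"
  assumes "t > 0"
    and rc: "\<And>s. 0 \<le> s \<Longrightarrow> s \<le> t \<Longrightarrow> (f \<longlongrightarrow> f s) (at_right s)"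
    and bdd: "bdd_below (f ` {0..t})"
  shows "(\<lambda>n. Min ((\<lambda>k. f (real k * (t / real n))) ` {1..n})) \<longlonglongrightarrow> (INF s\<in>{0..t}. f s)"
proof -
  have "(\<lambda>n. Min (f ` (\<lambda>k. real k * (t / real n)) ` {1..n})) \<longlonglongrightarrow> (INF s\<in>{0..t}. f s)"
  proof (rule Min_tendsto_INF[OF bdd])
    show "(f \<longlongrightarrow> f s) (at_right s)" if "s \<in> {0..t}" for s
      using that by (intro rc) auto
    show "\<forall>\<^sub>F n in sequentially. \<exists>a\<in>(\<lambda>k. real k * (t / real n)) ` {1..n}. s \<le> a \<and> a < s + e"
      if s: "s \<in> {0..t}" "e > 0" for s e
      using eventually_divide_nat_less[where c = t, OF s(2)] eventually_gt_at_top[of 0]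
    proof eventually_elim
      case (elim n)
      \<comment> \<open>For \<open>s = 0\<close> the ceiling would give the absent index 0, so the
        first grid point is used.\<close>
      define k where "k = (if s = 0 then 1 else nat \<lceil>s / (t / n)\<rceil>)"
      have h: "t / n > 0" using elim \<open>t > 0\<close> by simp
      have sn: "s / (t / n) \<le> n" unfolding pos_divide_le_eq[OF h] using s elim by simp
      have "s \<le> k * (t / n) \<and> k * (t / n) \<le> s + t / n \<and> 1 \<le> k \<and> k \<le> n"
      proof (cases "s = 0")
        case False
        then have "0 < s / (t / n)" using s h elim by (intro divide_pos_pos) auto
        then have "s / (t / n) \<le> k" "k < s / (t / n) + 1" "1 \<le> k" "k \<le> n"
          using sn False unfolding k_def by (simp_all; linarith)+
        moreover from this have "real k - 1 < s / (t / n)" by linarith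
        ultimately have "s \<le> k * (t / n)" "(real k - 1) * (t / n) < s" "1 \<le> k" "k \<le> n"
          unfolding pos_divide_le_eq[OF h] pos_less_divide_eq[OF h] by auto
        then show ?thesis unfolding left_diff_distrib mult_1 by linarith
      qed (use h elim in \<open>auto simp: k_def\<close>)
      then show ?case using elim by (intro bexI[OF _ imageI[of k]]) auto
    qed
    show "\<forall>\<^sub>F n in sequentially. (\<lambda>k. real k * (t / real n)) ` {1..n} \<noteq> {}"
      using eventually_gt_at_top[of 0] by eventually_elim auto
    show "\<forall>\<^sub>F n in sequentially. \<forall>a\<in>(\<lambda>k. real k * (t / real n)) ` {1..n}. \<exists>s\<in>{0..t}. f s < f a + e"
      if "e > 0" for e
      using eventually_gt_at_top[of 0]
    proof eventually_elim
      case (elim n)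
      have *: "real k * (t / n) \<in> {0..t}" if "k \<le> n" for k using that elim \<open>t > 0\<close> by (auto simp: field_simps)
      show ?case
      proof
        fix a assume "a \<in> (\<lambda>k. real k * (t / real n)) ` {1..n}"
        then have "a \<in> {0..t}" using * by force
        moreover have "f a < f a + e" using \<open>e > 0\<close> by simp
        ultimately show "\<exists>s\<in>{0..t}. f s < f a + e" by (rule bexI[rotated])
      qed
    qed
  qed (use \<open>t > 0\<close> in auto)
  then show ?thesis by (simp add: image_image)
qed

section \<open>Reversing and splitting random walks\<close>

lemma (in prob_space) indep_vars_reindex_borel:
  assumes inj: "inj_on f J" and ind: "indep_vars (\<lambda>_. N) X I" and sub: "f ` J \<subseteq> I"
  shows "indep_vars (\<lambda>_. N) (\<lambda>i. X (f i)) J"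
  unfolding indep_vars_def
proof
  show "\<forall>i\<in>J. X (f i) \<in> M \<rightarrow>\<^sub>M N" using ind sub by (auto simp: indep_vars_def)
  let ?F = "\<lambda>i. sigma_sets (space M) {X i -` A \<inter> space M |A. A \<in> sets N}"
  have F: "indep_sets ?F I" using ind by (simp add: indep_vars_def)
  show "indep_sets (\<lambda>i. ?F (f i)) J"
  proof (rule indep_setsI)
    show "?F (f i) \<subseteq> events" if "i \<in> J" for i
      using F sub that by (auto simp: indep_sets_def)
    fix A K assume K: "K \<noteq> {}" "K \<subseteq> J" "finite K" "\<forall>j\<in>K. A j \<in> ?F (f j)"
    have injK: "inj_on f K" using inj K by (auto intro: inj_on_subset)
    define A' where "A' i = A (the_inv_into K f i)" for i
    have A': "A' (f j) = A j" if "j \<in> K" for j using that by (simp add: A'_def the_inv_into_f_f[OF injK])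
    have "prob (\<Inter>i\<in>f ` K. A' i) = (\<Prod>i\<in>f ` K. prob (A' i))"
    proof (rule indep_setsD[OF F])
      show "f ` K \<subseteq> I" using K sub by blast
      show "\<forall>i\<in>f ` K. A' i \<in> ?F i" using K A' by simp
    qed (use K in auto)
    also have "(\<Prod>i\<in>f ` K. prob (A' i)) = (\<Prod>j\<in>K. prob (A j))"
      by (subst prod.reindex[OF injK]) (simp add: A')
    finally show "prob (\<Inter>j\<in>K. A j) = (\<Prod>j\<in>K. prob (A j))" by (simp add: A')
  qed
qed

text \<open>Reversing the order of independent, identically distributed increments preserves their
  joint law. The total is carried along because the maximum has to be reversed jointly with the
  endpoint from which the second phase starts.\<close>

lemma (in prob_space) distr_Max_walk_reverse:
  fixes \<xi> :: "nat \<Rightarrow> 'a \<Rightarrow> real"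
  assumes n: "n > 0" and ind: "indep_vars (\<lambda>_. borel) \<xi> {..<n}"
    and law: "\<And>i. i < n \<Longrightarrow> distr M borel (\<xi> i) = \<mu>"
  shows "distr M (borel \<Otimes>\<^sub>M borel) (\<lambda>w. (Max ((\<lambda>k. \<Sum>i<k. \<xi> i w) ` {..<n}), \<Sum>i<n. \<xi> i w)) =
    distr M (borel \<Otimes>\<^sub>M borel) (\<lambda>w. ((\<Sum>i<n. \<xi> i w) - Min ((\<lambda>k. \<Sum>i<k. \<xi> i w) ` {1..n}), \<Sum>i<n. \<xi> i w))"
proof -
  define f where "f x = (Max ((\<lambda>k. \<Sum>i<k. x i) ` {..<n}), \<Sum>i<n. x i)" for x :: "nat \<Rightarrow> real"
  have f [measurable]: "f \<in> Pi\<^sub>M {..<n} (\<lambda>_. borel) \<rightarrow>\<^sub>M borel \<Otimes>\<^sub>M borel"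
    unfolding f_def by (intro measurable_Pair borel_measurable_Max borel_measurable_sum measurable_component_singleton) auto
  define \<xi>' where "\<xi>' i = \<xi> (n - 1 - i)" for i
  have inj: "inj_on (\<lambda>i. n - 1 - i) {..<n}" by (auto simp: inj_on_def)
  have ind': "indep_vars (\<lambda>_. borel) \<xi>' {..<n}"
    unfolding \<xi>'_def[abs_def] using n by (intro indep_vars_reindex_borel[OF inj ind]) auto
  have rest: "f (\<lambda>i\<in>{..<n}. x i) = f x" for x
    unfolding f_def by (auto intro!: arg_cong[where f = Max] image_cong sum.cong)
  have rv: "(\<lambda>w. \<lambda>i\<in>{..<n}. \<xi> i w) \<in> M \<rightarrow>\<^sub>M Pi\<^sub>M {..<n} (\<lambda>_. borel)" "(\<lambda>w. \<lambda>i\<in>{..<n}. \<xi>' i w) \<in> M \<rightarrow>\<^sub>M Pi\<^sub>M {..<n} (\<lambda>_. borel)"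
    using ind ind' by (auto simp: indep_vars_def intro!: measurable_restrict)
  have "distr M (borel \<Otimes>\<^sub>M borel) (\<lambda>w. f (\<lambda>i. \<xi> i w)) =
      distr (distr M (Pi\<^sub>M {..<n} (\<lambda>_. borel)) (\<lambda>w. \<lambda>i\<in>{..<n}. \<xi> i w)) (borel \<Otimes>\<^sub>M borel) f"
    using rv by (subst distr_distr) (auto simp: comp_def rest)
  also have "distr M (Pi\<^sub>M {..<n} (\<lambda>_. borel)) (\<lambda>w. \<lambda>i\<in>{..<n}. \<xi> i w) =
      distr M (Pi\<^sub>M {..<n} (\<lambda>_. borel)) (\<lambda>w. \<lambda>i\<in>{..<n}. \<xi>' i w)"
    by (rule distr_iid_eq[OF n ind ind']) (simp add: law \<xi>'_def)
  also have "distr \<dots> (borel \<Otimes>\<^sub>M borel) f = distr M (borel \<Otimes>\<^sub>M borel) (\<lambda>w. f (\<lambda>i. \<xi>' i w))"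
    using rv by (subst distr_distr) (auto simp: comp_def rest)
  also have "(\<lambda>w. f (\<lambda>i. \<xi>' i w)) =
      (\<lambda>w. ((\<Sum>i<n. \<xi> i w) - Min ((\<lambda>k. \<Sum>i<k. \<xi> i w) ` {1..n}), \<Sum>i<n. \<xi> i w))"
    unfolding f_def \<xi>'_def
    by (rule ext) (simp only: reversed_walk_Max[OF n, of "\<lambda>i. \<xi> i _"])
  finally show ?thesis by (simp only: f_def)
qed

text \<open>The first \<open>n\<close> increments belong to the phase before the break, the last
  \<open>n\<close> to the phase after it. The blocks are independent, so the first one alone can be
  reversed, and the second one can be replaced by \<eta> with an integration variable of its
  own.\<close>

lemma (in prob_space) two_walks_laplace:
  fixes \<zeta> \<eta> :: "nat \<Rightarrow> 'a \<Rightarrow> real"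
  assumes n: "n > 0" and \<gamma>: "\<gamma> \<ge> 0" and ind: "indep_vars (\<lambda>_. borel) \<zeta> {..<n + n}"
    and law: "\<And>i. i < n \<Longrightarrow> distr M borel (\<zeta> i) = \<mu>"
    and ind': "indep_vars (\<lambda>_. borel) \<eta> {..<n}"
    and law': "\<And>i. i < n \<Longrightarrow> distr M borel (\<zeta> (n + i)) = distr M borel (\<eta> i)"
  shows "expectation (\<lambda>w. exp (- \<gamma> * max (Max ((\<lambda>k. \<Sum>i<k. \<zeta> i w) ` {..<n}))
      ((\<Sum>i<n. \<zeta> i w) + Max ((\<lambda>k. \<Sum>i<k. \<zeta> (n + i) w) ` {..<n})))) =
    expectation (\<lambda>w'. expectation (\<lambda>w. exp (- \<gamma> * max ((\<Sum>i<n. \<zeta> i w) - Min ((\<lambda>k. \<Sum>i<k. \<zeta> i w) ` {1..n}))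
      ((\<Sum>i<n. \<zeta> i w) + Max ((\<lambda>k. \<Sum>i<k. \<eta> i w') ` {..<n})))))"
proof -
  have m\<zeta> [measurable]: "\<zeta> i \<in> borel_measurable M" if "i < n + n" for i
    using ind that by (auto simp: indep_vars_def)
  have m\<eta> [measurable]: "\<eta> i \<in> borel_measurable M" if "i < n" for i
    using ind' that by (auto simp: indep_vars_def)
  define f where "f x = (Max ((\<lambda>k. \<Sum>i<k. x i) ` {..<n}), \<Sum>i<n. x i)" for x :: "nat \<Rightarrow> real"
  have f [measurable]: "f \<in> Pi\<^sub>M {..<n} (\<lambda>_. borel) \<rightarrow>\<^sub>M borel \<Otimes>\<^sub>M borel"
    unfolding f_def by (intro measurable_Pair borel_measurable_Max borel_measurable_sum measurable_component_singleton) auto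
  \<comment> \<open>The dummy second component is there because \<open>indep_var\<close> requires both variables to have the same
    value type.\<close>
  define g' where "g' x = (fst (f x), 0 :: real)" for x :: "nat \<Rightarrow> real"
  have g' [measurable]: "g' \<in> Pi\<^sub>M {..<n} (\<lambda>_. borel) \<rightarrow>\<^sub>M borel \<Otimes>\<^sub>M borel"
    unfolding g'_def by measurable
  define g where "g x = g' (\<lambda>i. x (n + i))" for x :: "nat \<Rightarrow> real"
  have g [measurable]: "g \<in> Pi\<^sub>M {n..<n + n} (\<lambda>_. borel) \<rightarrow>\<^sub>M borel \<Otimes>\<^sub>M borel"
    unfolding g_def g'_def f_def fst_conv
    by (intro measurable_Pair measurable_const borel_measurable_Max borel_measurable_sum measurable_component_singleton) auto
  define A where "A w = f (\<lambda>i. \<zeta> i w)" for w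
  define A' where "A' w = ((\<Sum>i<n. \<zeta> i w) - Min ((\<lambda>k. \<Sum>i<k. \<zeta> i w) ` {1..n}), \<Sum>i<n. \<zeta> i w)" for w
  define B where "B w = g (\<lambda>i. \<zeta> i w)" for w
  define B' where "B' w = g' (\<lambda>i. \<eta> i w)" for w
  have "indep_var (Pi\<^sub>M {..<n} (\<lambda>_. borel)) (\<lambda>w. \<lambda>i\<in>{..<n}. \<zeta> i w) (Pi\<^sub>M {n..<n + n} (\<lambda>_. borel)) (\<lambda>w. \<lambda>i\<in>{n..<n + n}. \<zeta> i w)"
    by (rule indep_var_restrict[OF ind]) auto
  then have "indep_var (borel \<Otimes>\<^sub>M borel) (f \<circ> (\<lambda>w. \<lambda>i\<in>{..<n}. \<zeta> i w)) (borel \<Otimes>\<^sub>M borel) (g \<circ> (\<lambda>w. \<lambda>i\<in>{n..<n + n}. \<zeta> i w))"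
    by (rule indep_var_compose[OF _ f g])
  moreover have restf: "f (\<lambda>i\<in>{..<n}. x i) = f x" for x
    unfolding f_def by (auto intro!: arg_cong[where f = Max] image_cong sum.cong)
  moreover have restg: "g (\<lambda>i\<in>{n..<n + n}. x i) = g x" for x
    unfolding g_def g'_def f_def fst_conv by (auto intro!: arg_cong[where f = Max] image_cong sum.cong)
  moreover have restg': "g' (\<lambda>i\<in>{..<n}. x i) = g' x" for x
    by (simp add: g'_def restf)
  ultimately have iv: "indep_var (borel \<Otimes>\<^sub>M borel) A (borel \<Otimes>\<^sub>M borel) B"
    by (simp add: comp_def A_def[abs_def] B_def[abs_def])
  then have mA [measurable]: "A \<in> M \<rightarrow>\<^sub>M borel \<Otimes>\<^sub>M borel" and mB [measurable]: "B \<in> M \<rightarrow>\<^sub>M borel \<Otimes>\<^sub>M borel"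
    by (auto dest: indep_var_rv1 indep_var_rv2)
  have mB' [measurable]: "B' \<in> M \<rightarrow>\<^sub>M borel \<Otimes>\<^sub>M borel"
    unfolding B'_def g'_def f_def fst_conv by (intro measurable_Pair measurable_const borel_measurable_Max borel_measurable_sum) auto
  have mA' [measurable]: "A' \<in> M \<rightarrow>\<^sub>M borel \<Otimes>\<^sub>M borel"
    unfolding A'_def
    by (intro measurable_Pair borel_measurable_diff borel_measurable_Min borel_measurable_sum m\<zeta>) auto
  have dA: "distr M (borel \<Otimes>\<^sub>M borel) A = distr M (borel \<Otimes>\<^sub>M borel) A'"
    unfolding A_def[abs_def] A'_def[abs_def] f_def
    by (rule distr_Max_walk_reverse[OF n indep_vars_subset[OF ind] law]) auto
  have dB: "distr M (borel \<Otimes>\<^sub>M borel) B = distr M (borel \<Otimes>\<^sub>M borel) B'"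
  proof -
    define \<zeta>' where "\<zeta>' i = \<zeta> (n + i)" for i
    have ind'': "indep_vars (\<lambda>_. borel) \<zeta>' {..<n}"
      unfolding \<zeta>'_def[abs_def] by (rule indep_vars_reindex_borel[OF _ ind]) auto
    have rv: "(\<lambda>w. \<lambda>i\<in>{..<n}. \<zeta>' i w) \<in> M \<rightarrow>\<^sub>M Pi\<^sub>M {..<n} (\<lambda>_. borel)" "(\<lambda>w. \<lambda>i\<in>{..<n}. \<eta> i w) \<in> M \<rightarrow>\<^sub>M Pi\<^sub>M {..<n} (\<lambda>_. borel)"
      using ind' ind'' by (auto simp: indep_vars_def intro!: measurable_restrict)
    have "distr M (borel \<Otimes>\<^sub>M borel) B = distr M (borel \<Otimes>\<^sub>M borel) (\<lambda>w. g' (\<lambda>i. \<zeta>' i w))"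
      by (simp add: B_def[abs_def] g_def \<zeta>'_def)
    also have "\<dots> = distr (distr M (Pi\<^sub>M {..<n} (\<lambda>_. borel)) (\<lambda>w. \<lambda>i\<in>{..<n}. \<zeta>' i w)) (borel \<Otimes>\<^sub>M borel) g'"
      using rv by (subst distr_distr) (auto simp: comp_def restg')
    also have "distr M (Pi\<^sub>M {..<n} (\<lambda>_. borel)) (\<lambda>w. \<lambda>i\<in>{..<n}. \<zeta>' i w) =
        distr M (Pi\<^sub>M {..<n} (\<lambda>_. borel)) (\<lambda>w. \<lambda>i\<in>{..<n}. \<eta> i w)"
      by (rule distr_iid_eq[OF n ind'' ind']) (simp add: law' \<zeta>'_def)
    also have "distr \<dots> (borel \<Otimes>\<^sub>M borel) g' = distr M (borel \<Otimes>\<^sub>M borel) B'"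
      using rv by (subst distr_distr) (auto simp: comp_def restg' B'_def[abs_def])
    finally show ?thesis .
  qed
  \<comment> \<open>The extra \<open>max 0\<close> bounds \<open>F\<close> by 1 for all arguments.
    It changes nothing on the actual values, by \<open>M0\<close> before and \<open>m0\<close> after
    the reversal.\<close>
  define F where "F p = exp (- \<gamma> * max (max 0 (fst (fst p))) (snd (fst p) + fst (snd p)))" for p :: "(real \<times> real) \<times> (real \<times> real)"
  have F [measurable]: "F \<in> borel_measurable ((borel \<Otimes>\<^sub>M borel) \<Otimes>\<^sub>M (borel \<Otimes>\<^sub>M borel))"
    unfolding F_def by measurable
  have F1: "\<bar>F p\<bar> \<le> 1" for p using \<gamma> by (simp add: F_def)
  interpret PA: prob_space "distr M (borel \<Otimes>\<^sub>M borel) A'" by (rule prob_space_distr) simp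
  interpret PB: prob_space "distr M (borel \<Otimes>\<^sub>M borel) B'" by (rule prob_space_distr) simp
  interpret P: pair_prob_space "distr M (borel \<Otimes>\<^sub>M borel) A'" "distr M (borel \<Otimes>\<^sub>M borel) B'" ..
  have M0: "0 \<le> Max ((\<lambda>k. \<Sum>i<k. \<zeta> i w) ` {..<n})" for w
    using n by (intro Max_ge) (auto intro!: image_eqI[of _ _ 0])
  have m0: "0 \<le> (\<Sum>i<n. \<zeta> i w) - Min ((\<lambda>k. \<Sum>i<k. \<zeta> i w) ` {1..n})" for w
    using n by simp
  have "expectation (\<lambda>w. exp (- \<gamma> * max (Max ((\<lambda>k. \<Sum>i<k. \<zeta> i w) ` {..<n}))
      ((\<Sum>i<n. \<zeta> i w) + Max ((\<lambda>k. \<Sum>i<k. \<zeta> (n + i) w) ` {..<n})))) = expectation (\<lambda>w. F (A w, B w))"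
    using M0 by (simp add: F_def A_def B_def f_def g_def g'_def max_def[of 0])
  also have "\<dots> = (\<integral>p. F p \<partial>distr M ((borel \<Otimes>\<^sub>M borel) \<Otimes>\<^sub>M (borel \<Otimes>\<^sub>M borel)) (\<lambda>w. (A w, B w)))"
    by (subst integral_distr) auto
  also have "distr M ((borel \<Otimes>\<^sub>M borel) \<Otimes>\<^sub>M (borel \<Otimes>\<^sub>M borel)) (\<lambda>w. (A w, B w)) = distr M (borel \<Otimes>\<^sub>M borel) A' \<Otimes>\<^sub>M distr M (borel \<Otimes>\<^sub>M borel) B'"
    using iv unfolding indep_var_distribution_eq dA dB by simp
  also have "(\<integral>p. F p \<partial>\<dots>) = (\<integral>b. \<integral>a. F (a, b) \<partial>distr M (borel \<Otimes>\<^sub>M borel) A' \<partial>distr M (borel \<Otimes>\<^sub>M borel) B')"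
  proof -
    have "integrable (distr M (borel \<Otimes>\<^sub>M borel) A' \<Otimes>\<^sub>M distr M (borel \<Otimes>\<^sub>M borel) B') F"
      using F1 by (intro P.integrable_const_bound[where B = 1]) (auto simp: measurable_cong_sets[OF sets_pair_measure_cong[OF sets_distr sets_distr] refl])
    then show ?thesis using P.integral_snd[of "\<lambda>a b. F (a, b)"] by simp
  qed
  also have "\<dots> = (\<integral>b. expectation (\<lambda>w. F (A' w, b)) \<partial>distr M (borel \<Otimes>\<^sub>M borel) B')"
    by (intro Bochner_Integration.integral_cong refl integral_distr) auto
  also have "\<dots> = expectation (\<lambda>w'. expectation (\<lambda>w. F (A' w, B' w')))"
    by (rule integral_distr) auto
  finally show ?thesis
    using m0 by (simp add: F_def A'_def B'_def g'_def f_def max_absorb2)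
qed

lemma exp_sup_cong: "(\<And>q. 0 \<le> q \<Longrightarrow> f q = g q) \<Longrightarrow> exp_sup \<gamma> r f = exp_sup \<gamma> r g"
  unfolding exp_sup_def by (intro arg_cong[where f = Inf] image_cong) auto

lemma borel_measurable_exp_sup [measurable (raw)]:
  assumes "\<And>q. 0 \<le> q \<Longrightarrow> (\<lambda>x. f x q) \<in> borel_measurable N" "r \<in> borel_measurable N"
  shows "(\<lambda>x. exp_sup \<gamma> (r x) (f x)) \<in> borel_measurable N"
proof -
  have [measurable]: "(\<lambda>x. f x q) \<in> borel_measurable N" if "q \<in> {0..} \<inter> \<rat>" for q using that assms(1) by simp
  note [measurable] = assms(2)
  show ?thesis
    unfolding exp_sup_def by (intro borel_measurable_cINF_real) (auto intro: countable_rat)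
qed

lemma spos_path_drift:
  assumes "spos_path f"
  shows "spos_path (\<lambda>t. f t - c * t)"
  unfolding spos_path_def
proof (intro conjI allI impI)
  show "f 0 - c * 0 = 0" using spos_pathD(1)[OF assms] by simp
  show "((\<lambda>t. f t - c * t) \<longlongrightarrow> f t - c * t) (at_right t)" if "0 \<le> t" for t
    by (intro tendsto_intros spos_pathD(2)[OF assms that])
  show "\<exists>l\<le>f t - c * t. ((\<lambda>t. f t - c * t) \<longlongrightarrow> l) (at_left t)" if t: "0 < t" for t
  proof -
    obtain l where l: "l \<le> f t" "(f \<longlongrightarrow> l) (at_left t)" using spos_pathD(3)[OF assms t] by blast
    then have "((\<lambda>t. f t - c * t) \<longlongrightarrow> l - c * t) (at_left t)" by (intro tendsto_intros)
    with l(1) show ?thesis by (intro exI[of _ "l - c * t"]) auto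
  qed
qed

lemma spos_path_exp_sup:
  assumes f: "spos_path f" and "\<gamma> > 0" "r > 0"
  shows "exp_sup \<gamma> r f = exp (- \<gamma> * sup_before r f)"
    and "(\<lambda>n. Max ((\<lambda>k. f (real k * (r / real n))) ` {..<n})) \<longlonglongrightarrow> sup_before r f"
    and "0 \<le> sup_before r f"
proof -
  have bdd: "bdd_above (f ` {0..<r})"
    by (rule bdd_above_mono[OF spos_path_bdd(2)[OF f, of r]]) auto
  show "exp_sup \<gamma> r f = exp (- \<gamma> * sup_before r f)"
    by (rule exp_sup_eq[OF spos_pathD(1)[OF f] \<open>\<gamma> > 0\<close> \<open>r > 0\<close> spos_pathD(2)[OF f] bdd])
  show "(\<lambda>n. Max ((\<lambda>k. f (real k * (r / real n))) ` {..<n})) \<longlonglongrightarrow> sup_before r f"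
    by (rule Max_grid_tendsto_sup_before[OF \<open>r > 0\<close> spos_pathD(2)[OF f] bdd])
  have "f 0 \<le> sup_before r f"
    unfolding sup_before_def using \<open>r > 0\<close> by (intro cSUP_upper[OF _ bdd]) auto
  then show "0 \<le> sup_before r f" using spos_pathD(1)[OF f] by simp
qed

text \<open>The supremum splits at the break: before \<open>t\<close> it is that of the path with
  slope \<open>c1\<close>, afterwards it is \<open>y\<close> plus that of the restarted path
  \<open>h\<close> with slope \<open>c2\<close>. Each part is a limit of grid maxima.\<close>

lemma spos_path_broken_drift:
  fixes f :: "real \<Rightarrow> real" and c1 c2 t v \<gamma> :: real
  assumes f: "spos_path f" and "\<gamma> > 0" "t > 0" "v > 0"
  defines "y \<equiv> f t - c1 * t"
  shows "(\<lambda>n. max (Max ((\<lambda>k. f (real k * (t / real n)) - c1 * (real k * (t / real n))) ` {..<n}))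
      (y + Max ((\<lambda>k. f (t + real k * (v / real n)) - f t - c2 * (real k * (v / real n))) ` {..<n})))
      \<longlonglongrightarrow> sup_before (t + v) (\<lambda>s. f s - broken_drift c1 c2 t s)"
    and "exp_sup \<gamma> (t + v) (\<lambda>s. f s - broken_drift c1 c2 t s) =
      exp (- \<gamma> * sup_before (t + v) (\<lambda>s. f s - broken_drift c1 c2 t s))"
proof -
  define g where "g s = f s - broken_drift c1 c2 t s" for s
  define h where "h u = f (t + u) - f t - c2 * u" for u
  have fY: "spos_path (\<lambda>s. f s - c1 * s)" by (rule spos_path_drift[OF f])
  have gY: "g s = f s - c1 * s" if "s \<le> t" for s using that by (simp add: g_def broken_drift_def)
  have gh: "g s = y + h (s - t)" if "t \<le> s" for s
    using that by (cases "s = t") (auto simp: g_def h_def y_def broken_drift_def)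
  \<comment> \<open>In this form the broken drift is visibly continuous in \<open>s\<close>, also at
    the break.\<close>
  have bd: "broken_drift c1 c2 t s = c1 * min s t + c2 * max 0 (s - t)" for s
    by (auto simp: broken_drift_def)
  have rcg: "(g \<longlongrightarrow> g s) (at_right s)" if "0 \<le> s" for s
    unfolding g_def[abs_def] bd by (intro tendsto_intros spos_pathD(2)[OF f that])
  have shift: "filterlim (\<lambda>u. t + u) (at_right (t + u0)) (at_right u0)" for u0
    by (auto intro!: filterlim_at_withinI tendsto_intros simp: eventually_at_filter)
  have rch: "(h \<longlongrightarrow> h u) (at_right u)" if "0 \<le> u" for u
    unfolding h_def[abs_def]
    by (intro tendsto_intros filterlim_compose[OF spos_pathD(2)[OF f] shift]) (use that \<open>t > 0\<close> in auto)
  have bf: "bounded (f ` {0..t + v})" by (rule spos_path_bounded[OF f]) (use \<open>t > 0\<close> \<open>v > 0\<close> in auto)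
  then obtain B where B: "\<And>s. 0 \<le> s \<Longrightarrow> s \<le> t + v \<Longrightarrow> \<bar>f s\<bar> \<le> B"
    unfolding bounded_iff by force
  have bg: "bdd_above (g ` {0..<t + v})"
  proof (rule bdd_aboveI2)
    fix s assume "s \<in> {0..<t + v}"
    then have s: "0 \<le> s" "s \<le> t + v" by auto
    have "\<bar>c1 * min s t\<bar> \<le> \<bar>c1\<bar> * t" using s \<open>t > 0\<close> by (auto simp: abs_mult intro!: mult_left_mono)
    moreover have "\<bar>c2 * max 0 (s - t)\<bar> \<le> \<bar>c2\<bar> * v" using s \<open>v > 0\<close> by (auto simp: abs_mult intro!: mult_left_mono)
    ultimately show "g s \<le> B + \<bar>c1\<bar> * t + \<bar>c2\<bar> * v" using B[OF s] unfolding g_def bd by linarith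
  qed
  have bh: "bdd_above (h ` {0..<v})"
  proof (rule bdd_aboveI2)
    fix u assume u: "u \<in> {0..<v}"
    have "g (t + u) \<le> sup_before (t + v) g"
      unfolding sup_before_def using u \<open>t > 0\<close> by (intro cSUP_upper[OF _ bg]) auto
    then show "h u \<le> sup_before (t + v) g - y" using gh[of "t + u"] u by simp
  qed
  have S: "max (sup_before t (\<lambda>s. f s - c1 * s)) (y + sup_before v h) = sup_before (t + v) g"
  proof (rule antisym)
    have up: "g s \<le> sup_before (t + v) g" if "0 \<le> s" "s < t + v" for s
      unfolding sup_before_def using that by (intro cSUP_upper[OF _ bg]) auto
    have "sup_before t (\<lambda>s. f s - c1 * s) \<le> sup_before (t + v) g"
      unfolding sup_before_def[of t]
    proof (rule cSUP_least)
      fix s assume "s \<in> {0..<t}"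
      then show "f s - c1 * s \<le> sup_before (t + v) g" using up[of s] gY[of s] \<open>v > 0\<close> by simp
    qed (use \<open>t > 0\<close> in auto)
    moreover have "sup_before v h \<le> sup_before (t + v) g - y"
      unfolding sup_before_def[of v]
    proof (rule cSUP_least)
      fix u assume "u \<in> {0..<v}"
      then show "h u \<le> sup_before (t + v) g - y" using up[of "t + u"] gh[of "t + u"] \<open>t > 0\<close> by simp
    qed (use \<open>v > 0\<close> in auto)
    ultimately show "max (sup_before t (\<lambda>s. f s - c1 * s)) (y + sup_before v h) \<le> sup_before (t + v) g"
      by simp
    have bY: "bdd_above ((\<lambda>s. f s - c1 * s) ` {0..<t})"
      by (rule bdd_above_mono[OF spos_path_bdd(2)[OF fY, of t]]) auto
    show "sup_before (t + v) g \<le> max (sup_before t (\<lambda>s. f s - c1 * s)) (y + sup_before v h)"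
      unfolding sup_before_def[of "t + v"]
    proof (rule cSUP_least)
      fix s assume s: "s \<in> {0..<t + v}"
      show "g s \<le> max (sup_before t (\<lambda>s. f s - c1 * s)) (y + sup_before v h)"
      proof (cases "s < t")
        case True
        then have "f s - c1 * s \<le> sup_before t (\<lambda>s. f s - c1 * s)"
          unfolding sup_before_def using s by (intro cSUP_upper[OF _ bY]) auto
        then show ?thesis using gY[of s] True by simp
      next
        case False
        then have "h (s - t) \<le> sup_before v h"
          unfolding sup_before_def using s by (intro cSUP_upper[OF _ bh]) auto
        then show ?thesis using gh[of s] False by simp
      qed
    qed (use \<open>t > 0\<close> \<open>v > 0\<close> in auto)
  qed
  have "(\<lambda>n. max (Max ((\<lambda>k. f (real k * (t / real n)) - c1 * (real k * (t / real n))) ` {..<n}))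
      (y + Max ((\<lambda>k. h (real k * (v / real n))) ` {..<n}))) \<longlonglongrightarrow> max (sup_before t (\<lambda>s. f s - c1 * s)) (y + sup_before v h)"
    by (intro tendsto_max tendsto_add tendsto_const spos_path_exp_sup(2)[OF fY zero_less_one \<open>t > 0\<close>]
        Max_grid_tendsto_sup_before[OF \<open>v > 0\<close> rch bh])
  then show "(\<lambda>n. max (Max ((\<lambda>k. f (real k * (t / real n)) - c1 * (real k * (t / real n))) ` {..<n}))
      (y + Max ((\<lambda>k. f (t + real k * (v / real n)) - f t - c2 * (real k * (v / real n))) ` {..<n})))
      \<longlonglongrightarrow> sup_before (t + v) (\<lambda>s. f s - broken_drift c1 c2 t s)"
    unfolding S unfolding h_def g_def[abs_def] .
  have "g 0 = 0" using gY[of 0] spos_pathD(1)[OF f] \<open>t > 0\<close> by simp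
  then show "exp_sup \<gamma> (t + v) (\<lambda>s. f s - broken_drift c1 c2 t s) =
      exp (- \<gamma> * sup_before (t + v) (\<lambda>s. f s - broken_drift c1 c2 t s))"
    using exp_sup_eq[OF _ \<open>\<gamma> > 0\<close> _ rcg bg] \<open>t > 0\<close> \<open>v > 0\<close> unfolding g_def[abs_def] by simp
qed

section \<open>From walks to the process at fixed times\<close>

context spectrally_positive_levy_process
begin

lemma grid_sums:
  assumes "X 0 w = 0"
  shows "(\<Sum>i<k. X (real (Suc i) * h) w - X (real i * h) w) = X (real k * h) w"
  using sum_lessThan_telescope[of "\<lambda>i. X (real i * h) w" k] assms by simp

lemma Min_grid_tendsto_run_inf:
  assumes "spos_path (\<lambda>t. X t w)" "t > 0"
  shows "(\<lambda>n. Min ((\<lambda>k. X (real k * (t / real n)) w) ` {1..n})) \<longlonglongrightarrow> run_inf t w"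
  unfolding run_inf_eq[OF assms(1) less_imp_le[OF assms(2)]]
  by (rule Min_grid_tendsto_INF[OF assms(2) spos_pathD(2)[OF assms(1)] spos_path_bdd(1)[OF assms(1)]])

text \<open>Both sides are limits of the same grid expectations, written once through the maxima and
  once through the reversed walk. For \<open>z = 0\<close> the cap is inactive because the running
  infimum is at most \<open>X 0 = 0\<close>.\<close>

lemma expectation_exp_sup:
  assumes "t > 0" "\<gamma> > 0"
  shows "expectation (\<lambda>w. exp_sup \<gamma> t (\<lambda>s. X s w)) = reflected_laplace \<gamma> 0 t"
proof -
  note [measurable] = random_variable
  define \<xi> where "\<xi> n i w = X (real (Suc i) * (t / n)) w - X (real i * (t / n)) w" for n i :: nat and w
  have [measurable]: "\<xi> n i \<in> borel_measurable M" for n i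
    unfolding \<xi>_def using \<open>t > 0\<close> by (intro borel_measurable_diff random_variable) auto
  let ?A = "\<lambda>n w. exp (- \<gamma> * Max ((\<lambda>k. \<Sum>i<k. \<xi> n i w) ` {..<n}))"
    and ?B = "\<lambda>n w. exp (- \<gamma> * ((\<Sum>i<n. \<xi> n i w) - Min ((\<lambda>k. \<Sum>i<k. \<xi> n i w) ` {1..n})))"
  define L where "L n = expectation (\<lambda>w. ?A n w)" for n
  have mX [measurable]: "X t \<in> borel_measurable M" "run_inf t \<in> borel_measurable M"
    using \<open>t > 0\<close> by (auto intro: random_variable borel_measurable_run_inf)
  \<comment> \<open>Using \<open>Suc n\<close> keeps the grids nonempty, so that every maximum is at
    least the value 0 at index 0.\<close>
  have "(\<lambda>n. L (Suc n)) \<longlonglongrightarrow> expectation (\<lambda>w. exp_sup \<gamma> t (\<lambda>s. X s w))"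
    unfolding L_def
  proof (rule integral_dominated_convergence[where w = "\<lambda>_. 1"])
    show "AE w in M. (\<lambda>n. ?A (Suc n) w) \<longlonglongrightarrow> exp_sup \<gamma> t (\<lambda>s. X s w)"
      using AE_spos_path
    proof eventually_elim
      case (elim w)
      show ?case
        unfolding spos_path_exp_sup(1)[OF elim \<open>\<gamma> > 0\<close> \<open>t > 0\<close>] \<xi>_def grid_sums[OF spos_pathD(1)[OF elim]]
        by (rule LIMSEQ_Suc) (intro tendsto_intros spos_path_exp_sup(2)[OF elim \<open>\<gamma> > 0\<close> \<open>t > 0\<close>])
    qed
    show "AE w in M. norm (?A (Suc n) w) \<le> 1" for n
    proof (rule AE_I2)
      fix w
      have "0 \<le> Max ((\<lambda>k. \<Sum>i<k. \<xi> (Suc n) i w) ` {..<Suc n})"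
        by (intro Max_ge) (auto intro!: image_eqI[of _ _ 0])
      then show "norm (?A (Suc n) w) \<le> 1"
        using \<open>\<gamma> > 0\<close> by simp
    qed
    show "(\<lambda>w. exp_sup \<gamma> t (\<lambda>s. X s w)) \<in> borel_measurable M"
      by (intro borel_measurable_exp_sup random_variable) auto
    show "(\<lambda>w. ?A (Suc n) w) \<in> borel_measurable M" for n
      by measurable
  qed auto
  moreover have "(\<lambda>n. L (Suc n)) \<longlonglongrightarrow> reflected_laplace \<gamma> 0 t"
  proof -
    have "L (Suc n) = expectation (\<lambda>w. ?B (Suc n) w)" for n
    proof -
      have ind: "indep_vars (\<lambda>_. borel) (\<xi> (Suc n)) {..<Suc n}"
        using grid_increments_indep[of 0 "t / Suc n" "Suc n"] \<open>t > 0\<close> by (simp add: \<xi>_def[abs_def])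
      have law: "distr M borel (\<xi> (Suc n) i) = distr M borel (X (t / Suc n))" for i
        using grid_increments_distr[of 0 "t / Suc n" i] \<open>t > 0\<close> by (simp add: \<xi>_def[abs_def])
      have m1: "(\<lambda>w. (Max ((\<lambda>k. \<Sum>i<k. \<xi> (Suc n) i w) ` {..<Suc n}), \<Sum>i<Suc n. \<xi> (Suc n) i w)) \<in> M \<rightarrow>\<^sub>M borel \<Otimes>\<^sub>M borel"
        by (intro measurable_Pair borel_measurable_Max borel_measurable_sum) auto
      have m2: "(\<lambda>w. ((\<Sum>i<Suc n. \<xi> (Suc n) i w) - Min ((\<lambda>k. \<Sum>i<k. \<xi> (Suc n) i w) ` {1..Suc n}), \<Sum>i<Suc n. \<xi> (Suc n) i w)) \<in> M \<rightarrow>\<^sub>M borel \<Otimes>\<^sub>M borel"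
        by (intro measurable_Pair borel_measurable_Min borel_measurable_sum borel_measurable_diff) auto
      have F: "(\<lambda>p. exp (- \<gamma> * fst p)) \<in> borel_measurable (borel \<Otimes>\<^sub>M borel)" by measurable
      show ?thesis
        unfolding L_def
        using integral_distr[OF m1 F] integral_distr[OF m2 F] distr_Max_walk_reverse[OF zero_less_Suc ind law]
        by simp
    qed
    moreover have "(\<lambda>n. expectation (\<lambda>w. ?B (Suc n) w))
      \<longlonglongrightarrow> reflected_laplace \<gamma> 0 t"
      unfolding reflected_laplace_def
    proof (rule integral_dominated_convergence[where w = "\<lambda>_. 1"])
      show "AE w in M. (\<lambda>n. ?B (Suc n) w)
        \<longlonglongrightarrow> exp (- \<gamma> * (X (max 0 t) w - min (- 0) (run_inf (max 0 t) w)))"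
        using AE_spos_path
      proof eventually_elim
        case (elim w)
        have "run_inf t w \<le> 0"
          using run_inf_le[OF elim, of t 0] \<open>t > 0\<close> spos_pathD(1)[OF elim] by simp
        then have e: "X (max 0 t) w - min (- 0) (run_inf (max 0 t) w) = X t w - run_inf t w"
          using \<open>t > 0\<close> by (simp add: max_def min_def)
        have "(\<lambda>n. exp (- \<gamma> * (X t w - Min ((\<lambda>k. X (real k * (t / real (Suc n))) w) ` {1..Suc n})))) \<longlonglongrightarrow> exp (- \<gamma> * (X t w - run_inf t w))"
          by (rule LIMSEQ_Suc) (intro tendsto_intros Min_grid_tendsto_run_inf[OF elim \<open>t > 0\<close>])
        then show ?case
          unfolding e \<xi>_def grid_sums[OF spos_pathD(1)[OF elim]] by simp
      qed
      show "AE w in M. norm (?B (Suc n) w) \<le> 1" for n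
      proof (rule AE_I2)
        fix w
        have "Min ((\<lambda>k. \<Sum>i<k. \<xi> (Suc n) i w) ` {1..Suc n}) \<le> (\<Sum>i<Suc n. \<xi> (Suc n) i w)"
          by (intro Min_le image_eqI[where x = "Suc n"]) auto
        then show "norm (?B (Suc n) w) \<le> 1"
          using \<open>\<gamma> > 0\<close> by (simp del: sum.lessThan_Suc)
      qed
      show "(\<lambda>w. ?B (Suc n) w) \<in> borel_measurable M" for n
        by measurable
      show "(\<lambda>w. exp (- \<gamma> * (X (max 0 t) w - min (- 0) (run_inf (max 0 t) w)))) \<in> borel_measurable M"
        using \<open>t > 0\<close> by (simp add: max_def)
    qed auto
    ultimately show ?thesis by simp
  qed
  ultimately show ?thesis by (rule LIMSEQ_unique)
qed

interpretation drift: spectrally_positive_levy_process M "\<lambda>t w. X t w - c * t" for c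
  by (rule spectrally_positive_drift)

text \<open>The term \<open>- ln (exp_sup 1 v _)\<close> is a measurable version of the supremum
  \<open>Z\<close> after the break, taken on the independent copy \<open>w'\<close>. Again both
  sides are limits of one sequence, rewritten by \<open>two_walks_laplace\<close>.\<close>

lemma expectation_exp_sup_broken_drift:
  assumes "t > 0" "v > 0" "\<gamma> > 0"
  shows "expectation (\<lambda>w. exp_sup \<gamma> (t + v) (\<lambda>s. X s w - broken_drift c1 c2 t s)) =
    expectation (\<lambda>w'. drift.reflected_laplace c1 \<gamma> (- ln (exp_sup 1 v (\<lambda>s. X s w' - c2 * s))) t)"
proof -
  note [measurable] = random_variable
  let ?Y = "\<lambda>s w. X s w - c1 * s" and ?W = "\<lambda>s w. X s w - c2 * s"
  \<comment> \<open>Indices below \<open>n\<close> give increments of mesh \<open>t / n\<close> with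
    drift \<open>c1\<close> on \<open>[0, t]\<close>, the others increments of mesh
    \<open>v / n\<close> with drift \<open>c2\<close> on \<open>[t, t + v]\<close>.\<close>
  define \<zeta> where "\<zeta> n i w = (if i < n then ?Y (real (Suc i) * (t / n)) w - ?Y (real i * (t / n)) w
    else ?W (t + real (Suc i - n) * (v / n)) w - ?W (t + real (i - n) * (v / n)) w)" for n i :: nat and w
  define \<eta> where "\<eta> n i w = ?W (real (Suc i) * (v / n)) w - ?W (real i * (v / n)) w" for n i :: nat and w
  have m\<zeta> [measurable]: "\<zeta> n i \<in> borel_measurable M" for n i
  proof -
    have *: "0 \<le> real k * (t / n)" "0 \<le> t + real k * (v / n)" for k using assms by auto
    show ?thesis
      unfolding \<zeta>_def
      by (cases "i < n"; simp only: if_True if_False;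
          intro borel_measurable_diff random_variable borel_measurable_const *)
  qed
  have m\<eta> [measurable]: "\<eta> n i \<in> borel_measurable M" for n i
    unfolding \<eta>_def using assms by (intro borel_measurable_diff random_variable borel_measurable_const) auto
  have ind: "indep_vars (\<lambda>_. borel) (\<zeta> n) {..<n + n}" if n: "n > 0" for n
  proof -
    \<comment> \<open>The two grids joined at \<open>t\<close>, so that one application of
      \<open>independent_increments\<close> covers both phases and their mutual
      independence.\<close>
    define \<tau> where "\<tau> i = (if i \<le> n then real i * (t / n) else t + real (i - n) * (v / n))" for i
    have \<tau>2: "\<tau> i = t + real (i - n) * (v / n)" if "n \<le> i" for i using that n by (auto simp: \<tau>_def)
    have mono: "\<tau> i < \<tau> (Suc i)" for i
    proof (cases "i < n")
      case True
      then show ?thesis using n assms by (simp add: \<tau>_def divide_strict_right_mono)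
    next
      case False
      then show ?thesis using n assms by (simp add: \<tau>2 Suc_diff_le divide_strict_right_mono)
    qed
    have "indep_vars (\<lambda>_. borel) (\<lambda>i w. X (\<tau> (Suc i)) w - X (\<tau> i) w) {..<n + n}"
      by (rule independent_increments) (use mono in \<open>auto simp: \<tau>_def\<close>)
    then have "indep_vars (\<lambda>_. borel) (\<lambda>i w. (X (\<tau> (Suc i)) w - X (\<tau> i) w) - (if i < n then c1 * (t / n) else c2 * (v / n))) {..<n + n}"
      by (rule indep_vars_compose2[where Y = "\<lambda>i x. x - (if i < n then c1 * (t / n) else c2 * (v / n))"]) simp
    also have "?this \<longleftrightarrow> ?thesis"
    proof (rule indep_vars_cong[OF refl _ refl])
      fix i assume "i \<in> {..<n + n}"
      show "(\<lambda>w. (X (\<tau> (Suc i)) w - X (\<tau> i) w) - (if i < n then c1 * (t / n) else c2 * (v / n))) = \<zeta> n i"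
      proof (cases "i < n")
        case True
        then show ?thesis by (simp add: \<zeta>_def \<tau>_def fun_eq_iff algebra_simps add_divide_distrib)
      next
        case False
        then show ?thesis by (simp add: \<zeta>_def \<tau>2 fun_eq_iff Suc_diff_le algebra_simps add_divide_distrib)
      qed
    qed
    finally show ?thesis .
  qed
  have law: "distr M borel (\<zeta> n i) = distr M borel (?Y (t / n))" if "i < n" for n i
    using drift.grid_increments_distr[where c = c1, of 0 "t / n" i] assms that by (simp add: \<zeta>_def[abs_def])
  have ind': "indep_vars (\<lambda>_. borel) (\<eta> n) {..<n}" if "n > 0" for n
    using drift.grid_increments_indep[where c = c2, of 0 "v / n" n] assms that by (simp add: \<eta>_def[abs_def])
  have law': "distr M borel (\<zeta> n (n + i)) = distr M borel (\<eta> n i)" if "i < n" for n i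
    using drift.grid_increments_distr[where c = c2, of 0 "v / n" i]
      drift.grid_increments_distr[where c = c2, of t "v / n" i] assms that
    by (simp add: \<zeta>_def[abs_def] \<eta>_def[abs_def] Suc_diff_le)
  let ?L = "\<lambda>n w. exp (- \<gamma> * max (Max ((\<lambda>k. \<Sum>i<k. \<zeta> n i w) ` {..<n}))
      ((\<Sum>i<n. \<zeta> n i w) + Max ((\<lambda>k. \<Sum>i<k. \<zeta> n (n + i) w) ` {..<n})))"
  let ?R = "\<lambda>n z w. exp (- \<gamma> * max ((\<Sum>i<n. \<zeta> n i w) - Min ((\<lambda>k. \<Sum>i<k. \<zeta> n i w) ` {1..n}))
      ((\<Sum>i<n. \<zeta> n i w) + z))"
  define L where "L n = expectation (\<lambda>w. ?L n w)" for n
  define R where "R n z = expectation (\<lambda>w. ?R n z w)" for n z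
  define Z where "Z n w = Max ((\<lambda>k. \<Sum>i<k. \<eta> n i w) ` {..<n})" for n w
  have LR: "L n = expectation (\<lambda>w. R n (Z n w))" if "n > 0" for n
    unfolding L_def R_def Z_def
    by (rule two_walks_laplace[OF that _ ind[OF that] law ind'[OF that] law']) (use \<open>\<gamma> > 0\<close> in auto)
  have s1: "(\<Sum>i<k. \<zeta> n i w) = ?Y (real k * (t / n)) w" if "k \<le> n" "X 0 w = 0" for n k w
  proof -
    have "(\<Sum>i<k. \<zeta> n i w) = (\<Sum>i<k. ?Y (real (Suc i) * (t / n)) w - ?Y (real i * (t / n)) w)"
      by (rule sum.cong) (use that in \<open>simp_all add: \<zeta>_def\<close>)
    also have "\<dots> = ?Y (real k * (t / n)) w"
      by (rule drift.grid_sums) (simp add: that)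
    finally show ?thesis .
  qed
  have s2: "(\<Sum>i<k. \<zeta> n (n + i) w) = X (t + real k * (v / n)) w - X t w - c2 * (real k * (v / n))" for n k w
    using sum_lessThan_telescope[of "\<lambda>i. ?W (t + real i * (v / n)) w" k]
    by (simp add: \<zeta>_def Suc_diff_le algebra_simps)
  have s3: "(\<Sum>i<k. \<eta> n i w) = ?W (real k * (v / n)) w" if "X 0 w = 0" for n k w
    using drift.grid_sums[where c = c2, of w "v / n" k] that by (simp add: \<eta>_def)
  have limL: "(\<lambda>n. L (Suc n)) \<longlonglongrightarrow> expectation (\<lambda>w. exp_sup \<gamma> (t + v) (\<lambda>s. X s w - broken_drift c1 c2 t s))"
    unfolding L_def
  proof (rule integral_dominated_convergence[where w = "\<lambda>_. 1"])
    show "AE w in M. (\<lambda>n. ?L (Suc n) w)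
      \<longlonglongrightarrow> exp_sup \<gamma> (t + v) (\<lambda>s. X s w - broken_drift c1 c2 t s)"
      using AE_spos_path
    proof eventually_elim
      case (elim w)
      have X0: "X 0 w = 0" by (rule spos_pathD(1)[OF elim])
      have e1: "(\<Sum>i<n. \<zeta> n i w) = ?Y t w" if "n > 0" for n
        using s1[OF order_refl X0, of n] that by simp
      have e2: "Max ((\<lambda>k. \<Sum>i<k. \<zeta> n i w) ` {..<n}) = Max ((\<lambda>k. ?Y (real k * (t / n)) w) ` {..<n})" for n
        by (intro arg_cong[where f = Max] image_cong refl s1 X0) auto
      show ?case
        unfolding e2 s2 spos_path_broken_drift(2)[OF elim \<open>\<gamma> > 0\<close> \<open>t > 0\<close> \<open>v > 0\<close>] e1[OF zero_less_Suc]
        by (intro tendsto_exp tendsto_mult tendsto_const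
            LIMSEQ_Suc[OF spos_path_broken_drift(1)[OF elim \<open>\<gamma> > 0\<close> \<open>t > 0\<close> \<open>v > 0\<close>]])
    qed
    show "AE w in M. norm (?L (Suc n) w) \<le> 1" for n
    proof (rule AE_I2)
      fix w
      have "0 \<le> Max ((\<lambda>k. \<Sum>i<k. \<zeta> (Suc n) i w) ` {..<Suc n})"
        by (intro Max_ge) (auto intro!: image_eqI[of _ _ 0])
      then show "norm (?L (Suc n) w) \<le> 1"
        using \<open>\<gamma> > 0\<close> by (simp add: le_max_iff_disj)
    qed
    show "(\<lambda>w. exp_sup \<gamma> (t + v) (\<lambda>s. X s w - broken_drift c1 c2 t s)) \<in> borel_measurable M"
      by (intro borel_measurable_exp_sup borel_measurable_diff random_variable) auto
    show "(\<lambda>w. ?L (Suc n) w) \<in> borel_measurable M" for n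
      by measurable
  qed auto
  have mX [measurable]: "X t \<in> borel_measurable M" "drift.run_inf c1 t \<in> borel_measurable M"
    using \<open>t > 0\<close> by (auto intro: random_variable drift.borel_measurable_run_inf)
  have R1: "norm (?R (Suc n) z w) \<le> 1" for n z w
  proof -
    have "Min ((\<lambda>k. \<Sum>i<k. \<zeta> (Suc n) i w) ` {1..Suc n}) \<le> (\<Sum>i<Suc n. \<zeta> (Suc n) i w)"
      by (intro Min_le image_eqI[where x = "Suc n"]) auto
    then show ?thesis
      using \<open>\<gamma> > 0\<close> by (simp del: sum.lessThan_Suc add: le_max_iff_disj)
  qed
  have mR [measurable]: "R n \<in> borel_measurable borel" for n
    unfolding R_def[abs_def] by (rule borel_measurable_lebesgue_integral) measurable
  have R1': "norm (R (Suc n) z) \<le> 1" for n z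
  proof -
    have "norm (R (Suc n) z) \<le> expectation (\<lambda>w. norm (?R (Suc n) z w))"
      unfolding R_def by (rule integral_norm_bound)
    also have "\<dots> \<le> expectation (\<lambda>_. 1)"
    proof (rule integral_mono)
      show "integrable M (\<lambda>w. norm (?R (Suc n) z w))"
        by (rule integrable_const_bound[where B = 1]) (use R1 in \<open>auto simp del: sum.lessThan_Suc\<close>)
    qed (use R1 in auto)
    finally show ?thesis by (simp add: prob_space)
  qed
  \<comment> \<open>The argument varies with \<open>n\<close>, because for a fixed outcome the grid
    maxima \<open>Z n\<close> only converge to the supremum.\<close>
  have limR: "(\<lambda>n. R (Suc n) (z n)) \<longlonglongrightarrow> drift.reflected_laplace c1 \<gamma> b t" if z: "z' \<longlonglongrightarrow> b" "\<And>n. z n = z' (Suc n)" for z z' b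
    unfolding R_def drift.reflected_laplace_def
  proof (rule integral_dominated_convergence[where w = "\<lambda>_. 1"])
    show "AE w in M. (\<lambda>n. ?R (Suc n) (z n) w)
      \<longlonglongrightarrow> exp (- \<gamma> * (X (max 0 t) w - c1 * max 0 t - min (- b) (drift.run_inf c1 (max 0 t) w)))"
      using AE_spos_path
    proof eventually_elim
      case (elim w)
      have X0: "X 0 w = 0" by (rule spos_pathD(1)[OF elim])
      have fY: "spos_path (\<lambda>s. ?Y s w)" by (rule spos_path_drift[OF elim])
      have e1: "(\<Sum>i<n. \<zeta> n i w) = ?Y t w" if "n > 0" for n
        using s1[OF order_refl X0, of n] that by simp
      have e2: "Min ((\<lambda>k. \<Sum>i<k. \<zeta> n i w) ` {1..n}) = Min ((\<lambda>k. ?Y (real k * (t / n)) w) ` {1..n})" for n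
        by (intro arg_cong[where f = Min] image_cong refl s1 X0) auto
      have m: "X (max 0 t) w - c1 * max 0 t - min (- b) (drift.run_inf c1 (max 0 t) w) =
        max (?Y t w - drift.run_inf c1 t w) (?Y t w + b)"
        using \<open>t > 0\<close> by (auto simp: max_def min_def)
      show ?case
        unfolding m e1[OF zero_less_Suc] e2 z(2)
        by (intro tendsto_exp tendsto_mult tendsto_max tendsto_add tendsto_diff tendsto_const LIMSEQ_Suc[OF z(1)]
            LIMSEQ_Suc[OF drift.Min_grid_tendsto_run_inf[OF fY \<open>t > 0\<close>]])
    qed
    show "AE w in M. norm (?R (Suc n) (z n) w) \<le> 1" for n
      by (intro AE_I2 R1)
    show "(\<lambda>w. ?R (Suc n) (z n) w) \<in> borel_measurable M" for n
      by measurable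
    show "(\<lambda>w. exp (- \<gamma> * (X (max 0 t) w - c1 * max 0 t - min (- b) (drift.run_inf c1 (max 0 t) w)))) \<in> borel_measurable M"
      using \<open>t > 0\<close> by (simp add: max_def)
  qed auto
  have "(\<lambda>n. expectation (\<lambda>w. R (Suc n) (Z (Suc n) w))) \<longlonglongrightarrow>
    expectation (\<lambda>w'. drift.reflected_laplace c1 \<gamma> (- ln (exp_sup 1 v (\<lambda>s. X s w' - c2 * s))) t)"
  proof (rule integral_dominated_convergence[where w = "\<lambda>_. 1"])
    show "AE w in M. (\<lambda>n. R (Suc n) (Z (Suc n) w)) \<longlonglongrightarrow>
      drift.reflected_laplace c1 \<gamma> (- ln (exp_sup 1 v (\<lambda>s. X s w - c2 * s))) t"
      using AE_spos_path
    proof eventually_elim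
      case (elim w)
      have fW: "spos_path (\<lambda>s. ?W s w)" by (rule spos_path_drift[OF elim])
      have e: "- ln (exp_sup 1 v (\<lambda>s. X s w - c2 * s)) = sup_before v (\<lambda>s. ?W s w)"
        using spos_path_exp_sup(1)[OF fW zero_less_one \<open>v > 0\<close>] by simp
      show ?case
        unfolding e
      proof (rule limR)
        show "(\<lambda>n. Z n w) \<longlonglongrightarrow> sup_before v (\<lambda>s. ?W s w)"
          unfolding Z_def s3[OF spos_pathD(1)[OF elim]]
          by (rule spos_path_exp_sup(2)[OF fW zero_less_one \<open>v > 0\<close>])
      qed simp
    qed
    show "AE w in M. norm (R (Suc n) (Z (Suc n) w)) \<le> 1" for n by (intro AE_I2 R1')
    have mZ [measurable]: "Z (Suc n) \<in> borel_measurable M" for n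
      unfolding Z_def[abs_def] by (intro borel_measurable_Max borel_measurable_sum) auto
    show "(\<lambda>w. R (Suc n) (Z (Suc n) w)) \<in> borel_measurable M" for n
      by (rule measurable_compose[OF mZ mR])
    have me: "(\<lambda>w. exp_sup 1 v (\<lambda>s. X s w - c2 * s)) \<in> borel_measurable M"
      by (intro borel_measurable_exp_sup borel_measurable_diff random_variable) auto
    have "(\<lambda>w. drift.reflected_laplace c1 \<gamma> (snd (t, - ln (exp_sup 1 v (\<lambda>s. X s w - c2 * s)))) (fst (t, - ln (exp_sup 1 v (\<lambda>s. X s w - c2 * s)))))
      \<in> borel_measurable M"
      by (rule measurable_compose[OF _ drift.borel_measurable_reflected_laplace[where c = c1, OF less_imp_le[OF \<open>\<gamma> > 0\<close>]]])
        (use me in measurable)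
    then show "(\<lambda>w. drift.reflected_laplace c1 \<gamma> (- ln (exp_sup 1 v (\<lambda>s. X s w - c2 * s))) t) \<in> borel_measurable M"
      by simp
  qed auto
  with limL show ?thesis
    unfolding LR[OF zero_less_Suc] by (rule LIMSEQ_unique)
qed

end

subsection \<open>Joint law and conclusion\<close>

text \<open>The second and third elements are first merged into one pair with product law.
  Independence of the first element from this pair follows because the preimage families are closed
  under intersection and can be collected into generated sigma-algebras.\<close>

lemma (in prob_space) indep_vars3_distr:
  assumes ind: "indep_vars3 N1 Y1 N2 Y2 N3 Y3"
  shows "distr M N1 Y1 \<Otimes>\<^sub>M (distr M N2 Y2 \<Otimes>\<^sub>M distr M N3 Y3) =
    distr M (N1 \<Otimes>\<^sub>M (N2 \<Otimes>\<^sub>M N3)) (\<lambda>\<omega>. (Y1 \<omega>, Y2 \<omega>, Y3 \<omega>))"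
proof -
  have Y1 [measurable]: "Y1 \<in> M \<rightarrow>\<^sub>M N1" and Y2 [measurable]: "Y2 \<in> M \<rightarrow>\<^sub>M N2" and Y3 [measurable]: "Y3 \<in> M \<rightarrow>\<^sub>M N3"
    using ind by (auto simp: indep_vars3_def)
  define F where "F i = (if i = 0 then {Y1 -` A \<inter> space M | A. A \<in> sets N1}
         else if i = 1 then {Y2 -` A \<inter> space M | A. A \<in> sets N2}
         else {Y3 -` A \<inter> space M | A. A \<in> sets N3})" for i :: nat
  have F: "indep_sets F {0, 1, 2}"
    using ind unfolding indep_vars3_def F_def[abs_def] by simp
  have Fev: "F i \<subseteq> events" for i
    unfolding F_def by auto
  have pre: "Int_stable {Y -` A \<inter> space M | A. A \<in> sets N}" for Y :: "'a \<Rightarrow> 'z" and N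
  proof (rule Int_stableI)
    fix a b assume "a \<in> {Y -` A \<inter> space M | A. A \<in> sets N}" "b \<in> {Y -` A \<inter> space M | A. A \<in> sets N}"
    then obtain A B where "A \<in> sets N" "B \<in> sets N" "a = Y -` A \<inter> space M" "b = Y -` B \<inter> space M" by blast
    then show "a \<inter> b \<in> {Y -` A \<inter> space M | A. A \<in> sets N}"
      by (auto intro!: exI[of _ "A \<inter> B"])
  qed
  have stable: "Int_stable (F i)" for i
    unfolding F_def by (auto intro: pre)
  define I where "I j = (if j = 0 then {0} else {1, 2 :: nat})" for j :: nat
  have G: "indep_sets (\<lambda>j. sigma_sets (space M) (\<Union>i\<in>I j. F i)) {0, 1 :: nat}"
  proof (rule indep_sets_collect_sigma[OF _ stable])
    show "indep_sets F (\<Union>j\<in>{0, 1}. I j)" using F by (simp add: I_def insert_commute)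
    show "disjoint_family_on I {0, 1}" by (auto simp: disjoint_family_on_def I_def)
  qed
  interpret D1: prob_space "distr M N1 Y1" by (rule prob_space_distr) simp
  interpret D2: prob_space "distr M N2 Y2" by (rule prob_space_distr) simp
  interpret D3: prob_space "distr M N3 Y3" by (rule prob_space_distr) simp
  have em: "emeasure (distr M N Y) A = emeasure M (Y -` A \<inter> space M)" if "Y \<in> M \<rightarrow>\<^sub>M N" "A \<in> sets N" for N Y A
    using that by (rule emeasure_distr)
  have D23: "distr M N2 Y2 \<Otimes>\<^sub>M distr M N3 Y3 = distr M (N2 \<Otimes>\<^sub>M N3) (\<lambda>\<omega>. (Y2 \<omega>, Y3 \<omega>))"
  proof (rule pair_measure_eqI)
    fix A B assume "A \<in> sets (distr M N2 Y2)" "B \<in> sets (distr M N3 Y3)"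
    then have AB [measurable]: "A \<in> sets N2" "B \<in> sets N3" by simp_all
    have "prob (\<Inter>i\<in>{1, 2 :: nat}. if i = 1 then Y2 -` A \<inter> space M else Y3 -` B \<inter> space M) =
      (\<Prod>i\<in>{1, 2 :: nat}. prob (if i = 1 then Y2 -` A \<inter> space M else Y3 -` B \<inter> space M))"
      by (rule indep_setsD[OF F]) (use AB in \<open>auto simp: F_def\<close>)
    then have "prob ((Y2 -` A \<inter> space M) \<inter> (Y3 -` B \<inter> space M)) = prob (Y2 -` A \<inter> space M) * prob (Y3 -` B \<inter> space M)"
      by (simp add: Int_commute)
    moreover have "(\<lambda>\<omega>. (Y2 \<omega>, Y3 \<omega>)) -` (A \<times> B) \<inter> space M = (Y2 -` A \<inter> space M) \<inter> (Y3 -` B \<inter> space M)" by auto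
    ultimately show "emeasure (distr M N2 Y2) A * emeasure (distr M N3 Y3) B =
      emeasure (distr M (N2 \<Otimes>\<^sub>M N3) (\<lambda>\<omega>. (Y2 \<omega>, Y3 \<omega>))) (A \<times> B)"
      by (simp add: emeasure_distr emeasure_eq_measure ennreal_mult')
  qed (auto intro: D2.sigma_finite_measure_axioms D3.sigma_finite_measure_axioms)
  interpret D23: prob_space "distr M (N2 \<Otimes>\<^sub>M N3) (\<lambda>\<omega>. (Y2 \<omega>, Y3 \<omega>))" by (rule prob_space_distr) simp
  show ?thesis
    unfolding D23
  proof (rule pair_measure_eqI)
    fix A B assume "A \<in> sets (distr M N1 Y1)" "B \<in> sets (distr M (N2 \<Otimes>\<^sub>M N3) (\<lambda>\<omega>. (Y2 \<omega>, Y3 \<omega>)))"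
    then have AB [measurable]: "A \<in> sets N1" "B \<in> sets (N2 \<Otimes>\<^sub>M N3)" by simp_all
    \<comment> \<open>The sigma-algebra generated by \<open>Y2\<close> and \<open>Y3\<close>;
      measurability of the pair with respect to it places the preimage of \<open>B\<close> in the
      collected family.\<close>
    define S where "S = sigma (space M) (F 1 \<union> F 2)"
    have sub: "F 1 \<union> F 2 \<subseteq> Pow (space M)" unfolding F_def by auto
    have S: "space S = space M" "sets S = sigma_sets (space M) (F 1 \<union> F 2)"
      unfolding S_def using sub by (auto simp: space_measure_of_conv sets_measure_of)
    have "Y2 \<in> S \<rightarrow>\<^sub>M N2"
      using measurable_space[OF Y2] by (intro measurableI) (auto simp: S F_def intro!: sigma_sets.Basic)
    moreover have "Y3 \<in> S \<rightarrow>\<^sub>M N3"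
      using measurable_space[OF Y3] by (intro measurableI) (auto simp: S F_def intro!: sigma_sets.Basic)
    ultimately have "(\<lambda>\<omega>. (Y2 \<omega>, Y3 \<omega>)) \<in> S \<rightarrow>\<^sub>M N2 \<Otimes>\<^sub>M N3" by (rule measurable_Pair)
    then have B': "(\<lambda>\<omega>. (Y2 \<omega>, Y3 \<omega>)) -` B \<inter> space M \<in> sigma_sets (space M) (F 1 \<union> F 2)"
      using measurable_sets[OF _ AB(2)] S by metis
    let ?A = "Y1 -` A \<inter> space M" and ?B = "(\<lambda>\<omega>. (Y2 \<omega>, Y3 \<omega>)) -` B \<inter> space M"
    have "prob (\<Inter>i\<in>{0, 1 :: nat}. if i = 0 then ?A else ?B) = (\<Prod>i\<in>{0, 1 :: nat}. prob (if i = 0 then ?A else ?B))"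
      by (rule indep_setsD[OF G]) (use B' AB in \<open>auto simp: I_def F_def intro!: sigma_sets.Basic\<close>)
    then have "prob (?A \<inter> ?B) = prob ?A * prob ?B" by (simp add: Int_commute)
    moreover have "(\<lambda>\<omega>. (Y1 \<omega>, Y2 \<omega>, Y3 \<omega>)) -` (A \<times> B) \<inter> space M = ?A \<inter> ?B" by auto
    ultimately show "emeasure (distr M N1 Y1) A * emeasure (distr M (N2 \<Otimes>\<^sub>M N3) (\<lambda>\<omega>. (Y2 \<omega>, Y3 \<omega>))) B =
      emeasure (distr M (N1 \<Otimes>\<^sub>M (N2 \<Otimes>\<^sub>M N3)) (\<lambda>\<omega>. (Y1 \<omega>, Y2 \<omega>, Y3 \<omega>))) (A \<times> B)"
      by (simp add: emeasure_distr emeasure_eq_measure ennreal_mult')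
  qed (auto intro: D1.sigma_finite_measure_axioms D23.sigma_finite_measure_axioms)
qed

text \<open>The path is integrated innermost: with both times frozen, the results for fixed times
  apply to it.\<close>

lemma (in prob_space) expectation_indep_vars3:
  fixes \<Phi> :: "'b \<times> 'c \<times> 'd \<Rightarrow> real"
  assumes ind: "indep_vars3 N1 Y1 N2 Y2 N3 Y3"
    and \<Phi> [measurable]: "\<Phi> \<in> borel_measurable (N1 \<Otimes>\<^sub>M (N2 \<Otimes>\<^sub>M N3))" and bound: "\<And>p. \<bar>\<Phi> p\<bar> \<le> B"
  shows "expectation (\<lambda>\<omega>. \<Phi> (Y1 \<omega>, Y2 \<omega>, Y3 \<omega>)) =
    expectation (\<lambda>\<omega>3. expectation (\<lambda>\<omega>2. expectation (\<lambda>\<omega>1. \<Phi> (Y1 \<omega>1, Y2 \<omega>2, Y3 \<omega>3))))"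
proof -
  have Y1 [measurable]: "Y1 \<in> M \<rightarrow>\<^sub>M N1" and Y2 [measurable]: "Y2 \<in> M \<rightarrow>\<^sub>M N2" and Y3 [measurable]: "Y3 \<in> M \<rightarrow>\<^sub>M N3"
    using ind by (auto simp: indep_vars3_def)
  let ?D1 = "distr M N1 Y1" and ?D2 = "distr M N2 Y2" and ?D3 = "distr M N3 Y3"
  interpret D1: prob_space ?D1 by (rule prob_space_distr) simp
  interpret D2: prob_space ?D2 by (rule prob_space_distr) simp
  interpret D3: prob_space ?D3 by (rule prob_space_distr) simp
  interpret D23: pair_prob_space ?D2 ?D3 ..
  interpret D: pair_prob_space ?D1 "?D2 \<Otimes>\<^sub>M ?D3" ..
  have s: "sets (?D1 \<Otimes>\<^sub>M (?D2 \<Otimes>\<^sub>M ?D3)) = sets (N1 \<Otimes>\<^sub>M (N2 \<Otimes>\<^sub>M N3))"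
    by (intro sets_pair_measure_cong sets_distr)
  have m: "\<Phi> \<in> borel_measurable (?D1 \<Otimes>\<^sub>M (?D2 \<Otimes>\<^sub>M ?D3))"
    using \<Phi> by (simp cong: measurable_cong_sets add: measurable_cong_sets[OF s refl])
  have int: "integrable (?D1 \<Otimes>\<^sub>M (?D2 \<Otimes>\<^sub>M ?D3)) \<Phi>"
    using bound by (intro D.integrable_const_bound[where B = B] m) auto
  define \<Psi> where "\<Psi> q = (\<integral>x. \<Phi> (x, q) \<partial>?D1)" for q
  have m\<Psi>: "\<Psi> \<in> borel_measurable (?D2 \<Otimes>\<^sub>M ?D3)"
    unfolding \<Psi>_def[abs_def]
  proof (rule D1.borel_measurable_lebesgue_integral)
    have "(\<lambda>p. \<Phi> (snd p, fst p)) \<in> borel_measurable ((?D2 \<Otimes>\<^sub>M ?D3) \<Otimes>\<^sub>M ?D1)"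
      by (rule measurable_compose[OF _ m]) measurable
    then show "(\<lambda>(q, x). \<Phi> (x, q)) \<in> borel_measurable ((?D2 \<Otimes>\<^sub>M ?D3) \<Otimes>\<^sub>M ?D1)"
      by (simp add: split_beta')
  qed
  have b\<Psi>: "\<bar>\<Psi> q\<bar> \<le> B" for q
  proof -
    have "norm (\<Psi> q) \<le> (\<integral>x. norm (\<Phi> (x, q)) \<partial>?D1)" unfolding \<Psi>_def by (rule integral_norm_bound)
    also have "\<dots> \<le> (\<integral>x. B \<partial>?D1)"
    proof (rule integral_mono')
      show "norm (\<Phi> (x, q)) \<le> B" for x using bound by simp
    qed (use order_trans[OF abs_ge_zero bound] in auto)
    finally show ?thesis using D1.prob_space by simp
  qed
  have int\<Psi>: "integrable (?D2 \<Otimes>\<^sub>M ?D3) \<Psi>"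
    using b\<Psi> by (intro D23.integrable_const_bound[where B = B] m\<Psi>) auto
  have "expectation (\<lambda>\<omega>. \<Phi> (Y1 \<omega>, Y2 \<omega>, Y3 \<omega>)) = (\<integral>p. \<Phi> p \<partial>distr M (N1 \<Otimes>\<^sub>M (N2 \<Otimes>\<^sub>M N3)) (\<lambda>\<omega>. (Y1 \<omega>, Y2 \<omega>, Y3 \<omega>)))"
    by (subst integral_distr) auto
  also have "\<dots> = (\<integral>p. \<Phi> p \<partial>(?D1 \<Otimes>\<^sub>M (?D2 \<Otimes>\<^sub>M ?D3)))"
    by (simp add: indep_vars3_distr[OF ind])
  also have "\<dots> = (\<integral>q. \<Psi> q \<partial>(?D2 \<Otimes>\<^sub>M ?D3))"
    using D.integral_snd[of "\<lambda>x q. \<Phi> (x, q)"] int by (simp add: \<Psi>_def)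
  also have "\<dots> = (\<integral>c. \<integral>b. \<Psi> (b, c) \<partial>?D2 \<partial>?D3)"
    using D23.integral_snd[of "\<lambda>b c. \<Psi> (b, c)"] int\<Psi> by simp
  finally have eq: "expectation (\<lambda>\<omega>. \<Phi> (Y1 \<omega>, Y2 \<omega>, Y3 \<omega>)) = (\<integral>c. \<integral>b. \<Psi> (b, c) \<partial>?D2 \<partial>?D3)" .
  have m\<Psi>': "\<Psi> \<in> borel_measurable (N2 \<Otimes>\<^sub>M N3)"
    using m\<Psi> by (simp add: measurable_cong_sets[OF sets_pair_measure_cong[OF sets_distr sets_distr] refl])
  have inner: "(\<integral>b. \<Psi> (b, c) \<partial>?D2) = expectation (\<lambda>\<omega>2. \<Psi> (Y2 \<omega>2, c))" if "c \<in> space N3" for c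
    by (rule integral_distr[OF Y2]) (rule measurable_compose[OF _ m\<Psi>'], use that in measurable)
  have "(\<integral>c. \<integral>b. \<Psi> (b, c) \<partial>?D2 \<partial>?D3) = expectation (\<lambda>\<omega>3. \<integral>b. \<Psi> (b, Y3 \<omega>3) \<partial>?D2)"
  proof (rule integral_distr[OF Y3])
    have "(\<lambda>c. \<integral>b. (\<lambda>(c, b). \<Psi> (b, c)) (c, b) \<partial>?D2) \<in> borel_measurable N3"
    proof (rule D2.borel_measurable_lebesgue_integral)
      have "(\<lambda>p. \<Psi> (snd p, fst p)) \<in> borel_measurable (N3 \<Otimes>\<^sub>M ?D2)"
        by (rule measurable_compose[OF _ m\<Psi>']) measurable
      then show "case_prod (\<lambda>c b. (\<lambda>(c, b). \<Psi> (b, c)) (c, b)) \<in> borel_measurable (N3 \<Otimes>\<^sub>M ?D2)"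
        by (simp add: split_beta')
    qed
    then show "(\<lambda>c. \<integral>b. \<Psi> (b, c) \<partial>?D2) \<in> borel_measurable N3" by simp
  qed
  also have "\<dots> = expectation (\<lambda>\<omega>3. expectation (\<lambda>\<omega>2. \<Psi> (Y2 \<omega>2, Y3 \<omega>3)))"
    by (intro Bochner_Integration.integral_cong refl inner) (rule measurable_space[OF Y3])
  also have "\<dots> = expectation (\<lambda>\<omega>3. expectation (\<lambda>\<omega>2. expectation (\<lambda>\<omega>1. \<Phi> (Y1 \<omega>1, Y2 \<omega>2, Y3 \<omega>3))))"
  proof (intro Bochner_Integration.integral_cong refl)
    fix \<omega>3 \<omega>2 assume "\<omega>3 \<in> space M" "\<omega>2 \<in> space M"
    then have sp: "(Y2 \<omega>2, Y3 \<omega>3) \<in> space (N2 \<Otimes>\<^sub>M N3)"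
      using measurable_space[OF Y2] measurable_space[OF Y3] by (auto simp: space_pair_measure)
    show "\<Psi> (Y2 \<omega>2, Y3 \<omega>3) = expectation (\<lambda>\<omega>1. \<Phi> (Y1 \<omega>1, Y2 \<omega>2, Y3 \<omega>3))"
      unfolding \<Psi>_def
      by (rule integral_distr[OF Y1]) (rule measurable_compose[OF _ \<Phi>], use sp in measurable)
  qed
  finally show ?thesis using eq by simp
qed

text \<open>The function \<open>f\<close> may fail to be measurable for \<open>M\<close>, but it
  differs from \<open>g\<close> only on a subset of a null set, and the completion makes all such
  sets measurable.\<close>

lemma integral_completion_cong_AE:
  fixes f g :: "'a \<Rightarrow> real"
  assumes ae: "AE x in M. f x = g x" and g: "g \<in> borel_measurable M"
  shows "(\<integral>x. f x \<partial>completion M) = (\<integral>x. g x \<partial>M)"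
proof -
  have g': "g \<in> borel_measurable (completion M)" using g by (rule measurable_completion)
  have f': "f \<in> borel_measurable (completion M)"
  proof (rule measurableI)
    fix A :: "real set" assume A: "A \<in> sets borel"
    have n1: "Measurable.pred (completion M) (\<lambda>x. f x \<noteq> g x)"
      by (rule sets_completion_AE) (use ae in auto)
    have n2: "Measurable.pred (completion M) (\<lambda>x. f x \<noteq> g x \<and> f x \<in> A)"
      by (rule sets_completion_AE) (use ae in auto)
    have n3: "Measurable.pred (completion M) (\<lambda>x. g x \<in> A)"
      using g' A by measurable
    have "Measurable.pred (completion M) (\<lambda>x. (g x \<in> A \<and> \<not> f x \<noteq> g x) \<or> (f x \<noteq> g x \<and> f x \<in> A))"
      by (intro pred_intros_logic n1 n2 n3)
    also have "(\<lambda>x. (g x \<in> A \<and> \<not> f x \<noteq> g x) \<or> (f x \<noteq> g x \<and> f x \<in> A)) = (\<lambda>x. f x \<in> A)" by auto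
    finally show "f -` A \<inter> space (completion M) \<in> sets (completion M)"
      by (simp add: pred_def vimage_def Int_def conj_commute)
  qed simp
  have "(\<integral>x. f x \<partial>completion M) = (\<integral>x. g x \<partial>completion M)"
    by (rule integral_cong_AE[OF f' g']) (rule AE_completion[OF ae])
  also have "\<dots> = (\<integral>x. g x \<partial>M)" by (rule integral_completion[OF g])
  finally show ?thesis .
qed

lemma borel_measurable_broken_drift [measurable (raw)]:
  assumes [measurable]: "t \<in> borel_measurable N"
  shows "(\<lambda>x. broken_drift c1 c2 (t x) s) \<in> borel_measurable N"
  unfolding broken_drift_def by measurable

theorem theorem6:
  fixes M :: "'a measure" and X :: "real \<Rightarrow> 'a \<Rightarrow> real" and T V :: "'a \<Rightarrow> real"
    and c1 c2 l \<gamma> :: real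
  assumes "spectrally_positive_levy_process M X"
    and "c1 \<ge> 0" and "c2 \<ge> 0" and "l > 0"
    and "distributed M lborel T (exponential_density l)"
    and "AE \<omega> in M. V \<omega> > 0"
    and "prob_space.indep_vars3 M (\<Pi>\<^sub>M t\<in>{0..}. borel) (sample_path X) borel T borel V"
    and "\<exists>\<beta>>0. laplace_exponent M X c1 \<beta> = l"
    and "\<gamma> > laplace_exponent_inv M X c1 l"
  shows "laplace_transform M
           (\<lambda>\<omega>. sup_before (T \<omega> + V \<omega>) (\<lambda>t. X t \<omega> - broken_drift c1 c2 (T \<omega>) t)) \<gamma>
       = laplace_transform M (\<lambda>\<omega>. sup_before (T \<omega>) (\<lambda>t. X t \<omega> - c1 * t)) \<gamma>
         + \<gamma> * l / (laplace_exponent M X c1 \<gamma> - l) *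
           ((1 - laplace_transform M (\<lambda>\<omega>. sup_before (V \<omega>) (\<lambda>t. X t \<omega> - c2 * t)) \<gamma>) / \<gamma>
          - (1 - laplace_transform M (\<lambda>\<omega>. sup_before (V \<omega>) (\<lambda>t. X t \<omega> - c2 * t))
                   (laplace_exponent_inv M X c1 l)) / laplace_exponent_inv M X c1 l)"
proof -
  interpret X: spectrally_positive_levy_process M X by fact
  interpret Y: spectrally_positive_levy_process M "\<lambda>t \<omega>. X t \<omega> - c1 * t"
    by (rule X.spectrally_positive_drift)
  note l = \<open>l > 0\<close> and T = assms(5)
  note ind = assms(7)
  have mT [measurable]: "T \<in> borel_measurable M" and mV [measurable]: "V \<in> borel_measurable M"
    using ind by (auto simp: X.indep_vars3_def)
  have mX [measurable (raw)]: "(\<lambda>p. X q (g p)) \<in> borel_measurable N"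
    if "0 \<le> q" "g \<in> N \<rightarrow>\<^sub>M M" for q g and N :: "'z measure"
    by (rule measurable_compose[OF that(2) X.random_variable[OF that(1)]])
  let ?exponent = "laplace_exponent M X c1"
  have exponent: "?exponent \<theta> = ln (X.expectation (\<lambda>\<omega>. exp (- \<theta> * (X 1 \<omega> - c1 * 1))))" for \<theta>
    unfolding laplace_exponent_def laplace_transform_def
    by (subst integral_completion) (auto intro!: borel_measurable_exp borel_measurable_times borel_measurable_diff X.random_variable)
  have core: "X.expectation (\<lambda>\<omega>. Y.reflected_laplace \<theta> z (T \<omega>)) * ((?exponent \<theta> - l) / l) =
      \<theta> / b * exp (- b * z) - exp (- \<theta> * z)"
    if "b > 0" "?exponent b = l" "b \<le> \<theta>" "0 \<le> z" for b \<theta> z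
  proof -
    have "integrable M (\<lambda>\<omega>. exp (- b * (X 1 \<omega> - c1 * 1)))"
    proof (rule ccontr)
      assume "\<not> ?thesis"
      \<comment> \<open>A non-integrable function has integral 0, and \<open>ln 0 = 0\<close>; so a
        positive exponent forces integrability.\<close>
      then have "?exponent b = 0" unfolding exponent by (simp add: not_integrable_integral_eq)
      with that l show False by simp
    qed
    then show ?thesis
      unfolding exponent
      by (rule Y.reflected_laplace_exponential[OF _ \<open>b > 0\<close> \<open>b \<le> \<theta>\<close> _ l T \<open>0 \<le> z\<close>])
        (use that(2) in \<open>simp add: exponent\<close>)
  qed
  obtain \<beta> where \<beta>: "\<beta> > 0" "?exponent \<beta> = l" using assms(8) by blast
  \<comment> \<open>For a larger root the left side of \<open>core\<close> at \<open>z = 0\<close>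
    vanishes, while the right side is the ratio of the two roots minus 1.\<close>
  have inj: "b \<ge> \<beta>'" if "b > 0" "?exponent b = l" "?exponent \<beta>' = l" for b \<beta>'
  proof (rule ccontr)
    assume "\<not> b \<ge> \<beta>'"
    then have "0 = \<beta>' / b - 1" using core[OF that(1,2), of \<beta>' 0] that(3) by simp
    then show False using \<open>\<not> b \<ge> \<beta>'\<close> that(1) by (simp add: field_simps)
  qed
  have inv: "laplace_exponent_inv M X c1 l = \<beta>"
    unfolding laplace_exponent_inv_def
    by (rule the_equality) (use \<beta> inj in \<open>auto intro: antisym\<close>)
  have \<gamma>: "\<gamma> > \<beta>" "\<gamma> > 0" using assms(9) \<beta> unfolding inv by auto
  define \<phi> where "\<phi> = ?exponent \<gamma>"
  \<comment> \<open>At \<open>z = 0\<close> the right side of \<open>core\<close> is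
    \<open>\<gamma> / \<beta> - 1 > 0\<close>, so the factor \<open>\<phi> - l\<close> cannot
    vanish.\<close>
  have \<phi>: "\<phi> \<noteq> l"
    using core[OF \<beta>, of \<gamma> 0] \<gamma> \<beta> by (auto simp: \<phi>_def)
  have K: "X.expectation (\<lambda>\<omega>. Y.reflected_laplace \<gamma> z (T \<omega>)) =
      l / (\<phi> - l) * (\<gamma> / \<beta> * exp (- \<beta> * z) - exp (- \<gamma> * z))" if "0 \<le> z" for z
    using core[OF \<beta> less_imp_le[OF \<gamma>(1)] that] \<phi> l by (simp add: \<phi>_def field_simps)
  have posT: "AE \<omega> in M. 0 < T \<omega>" by (rule X.AE_exponential_pos[OF T l])
  have path: "exp_sup \<theta> r (\<lambda>q. sample_path X \<omega> q - d q) = exp_sup \<theta> r (\<lambda>q. X q \<omega> - d q)" for \<theta> r \<omega> d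
    by (rule exp_sup_cong) (simp add: sample_path_def)
  have mpath [measurable]: "(\<lambda>p. fst p q) \<in> borel_measurable ((\<Pi>\<^sub>M t\<in>{0..}. borel) \<Otimes>\<^sub>M N)"
    if "0 \<le> q" for q :: real and N :: "'z measure"
    by (rule measurable_compose[OF measurable_fst]) (use that in simp)
  \<comment> \<open>One statement for all three transforms: \<open>r\<close> is the time horizon as
    a function of both random times, \<open>d\<close> the drift, which may depend on the break. It
    moves from the completion to \<open>M\<close> and separates the three sources of
    randomness.\<close>
  have joint: "laplace_transform M (\<lambda>\<omega>. sup_before (r (T \<omega>) (V \<omega>)) (\<lambda>q. X q \<omega> - d (T \<omega>) q)) \<theta> =
      X.expectation (\<lambda>\<omega>3. X.expectation (\<lambda>\<omega>2. X.expectation (\<lambda>\<omega>1.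
        exp_sup \<theta> (r (T \<omega>2) (V \<omega>3)) (\<lambda>q. X q \<omega>1 - d (T \<omega>2) q))))"
    if r: "(\<lambda>p. r (fst p) (snd p)) \<in> borel_measurable (borel \<Otimes>\<^sub>M borel)"
      and d: "\<And>q. (\<lambda>t. d t q) \<in> borel_measurable borel"
      and eq: "\<And>\<omega>. spos_path (\<lambda>q. X q \<omega>) \<Longrightarrow> 0 < T \<omega> \<Longrightarrow> 0 < V \<omega> \<Longrightarrow>
        exp_sup \<theta> (r (T \<omega>) (V \<omega>)) (\<lambda>q. X q \<omega> - d (T \<omega>) q) =
        exp (- \<theta> * sup_before (r (T \<omega>) (V \<omega>)) (\<lambda>q. X q \<omega> - d (T \<omega>) q))"
    for r d :: "real \<Rightarrow> real \<Rightarrow> real" and \<theta>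
  proof -
    define \<Phi> where "\<Phi> = (\<lambda>(w, t, v). exp_sup \<theta> (r t v) (\<lambda>q. w q - d t q))"
    have m: "\<Phi> \<in> borel_measurable ((\<Pi>\<^sub>M t\<in>{0..}. borel) \<Otimes>\<^sub>M (borel \<Otimes>\<^sub>M borel))"
      unfolding \<Phi>_def split_beta'
      by (intro borel_measurable_exp_sup borel_measurable_diff mpath measurable_compose[OF measurable_snd r]
          measurable_compose[OF measurable_compose[OF measurable_snd measurable_fst] d])
    have "laplace_transform M (\<lambda>\<omega>. sup_before (r (T \<omega>) (V \<omega>)) (\<lambda>q. X q \<omega> - d (T \<omega>) q)) \<theta> =
      X.expectation (\<lambda>\<omega>. \<Phi> (sample_path X \<omega>, T \<omega>, V \<omega>))"
      unfolding laplace_transform_def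
    proof (rule integral_completion_cong_AE)
      show "AE \<omega> in M. exp (- \<theta> * sup_before (r (T \<omega>) (V \<omega>)) (\<lambda>q. X q \<omega> - d (T \<omega>) q)) =
          \<Phi> (sample_path X \<omega>, T \<omega>, V \<omega>)"
        using X.AE_spos_path posT assms(6) by eventually_elim (simp add: \<Phi>_def path eq)
      show "(\<lambda>\<omega>. \<Phi> (sample_path X \<omega>, T \<omega>, V \<omega>)) \<in> borel_measurable M"
        by (rule measurable_compose[OF _ m]) (use ind in \<open>auto simp: X.indep_vars3_def\<close>)
    qed
    also have "\<dots> = X.expectation (\<lambda>\<omega>3. X.expectation (\<lambda>\<omega>2. X.expectation (\<lambda>\<omega>1. \<Phi> (sample_path X \<omega>1, T \<omega>2, V \<omega>3))))"
      by (rule X.expectation_indep_vars3[OF ind m, where B = 1])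
        (auto simp: \<Phi>_def exp_sup_bounds abs_le_iff intro: order_trans[OF _ exp_sup_bounds(1)])
    finally show ?thesis by (simp add: \<Phi>_def path)
  qed
  define A where "A \<theta> v = X.expectation (\<lambda>\<omega>. exp_sup \<theta> v (\<lambda>q. X q \<omega> - c2 * q))" for \<theta> v
  have LV: "laplace_transform M (\<lambda>\<omega>. sup_before (V \<omega>) (\<lambda>t. X t \<omega> - c2 * t)) \<theta> = X.expectation (\<lambda>\<omega>. A \<theta> (V \<omega>))"
    if "\<theta> > 0" for \<theta>
    using joint[of "\<lambda>t v. v" "\<lambda>t q. c2 * q" \<theta>] spos_path_exp_sup(1)[OF spos_path_drift that]
    by (simp add: A_def X.prob_space)
  have LT: "laplace_transform M (\<lambda>\<omega>. sup_before (T \<omega>) (\<lambda>t. X t \<omega> - c1 * t)) \<gamma> = l / (\<phi> - l) * (\<gamma> / \<beta> - 1)"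
  proof -
    have "laplace_transform M (\<lambda>\<omega>. sup_before (T \<omega>) (\<lambda>t. X t \<omega> - c1 * t)) \<gamma> =
      X.expectation (\<lambda>\<omega>. X.expectation (\<lambda>\<omega>1. exp_sup \<gamma> (T \<omega>) (\<lambda>q. X q \<omega>1 - c1 * q)))"
      using joint[of "\<lambda>t v. t" "\<lambda>t q. c1 * q" \<gamma>] spos_path_exp_sup(1)[OF spos_path_drift \<open>\<gamma> > 0\<close>]
      by (simp add: X.prob_space)
    also have "\<dots> = X.expectation (\<lambda>\<omega>. Y.reflected_laplace \<gamma> 0 (T \<omega>))"
    proof (rule integral_cong_AE)
      show "(\<lambda>\<omega>. X.expectation (\<lambda>\<omega>1. exp_sup \<gamma> (T \<omega>) (\<lambda>q. X q \<omega>1 - c1 * q))) \<in> borel_measurable M"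
        unfolding split_beta'
        by (intro X.borel_measurable_lebesgue_integral, unfold split_beta', intro borel_measurable_exp_sup borel_measurable_diff mX) auto
      show "(\<lambda>\<omega>. Y.reflected_laplace \<gamma> 0 (T \<omega>)) \<in> borel_measurable M"
        using measurable_compose[OF _ Y.borel_measurable_reflected_laplace[OF less_imp_le[OF \<gamma>(2)]], of "\<lambda>\<omega>. (T \<omega>, 0)" M]
        by simp
      show "AE \<omega> in M. X.expectation (\<lambda>\<omega>1. exp_sup \<gamma> (T \<omega>) (\<lambda>q. X q \<omega>1 - c1 * q)) = Y.reflected_laplace \<gamma> 0 (T \<omega>)"
        using posT by eventually_elim (rule Y.expectation_exp_sup[OF _ \<gamma>(2)])
    qed
    also have "\<dots> = l / (\<phi> - l) * (\<gamma> / \<beta> - 1)" using K[of 0] by simp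
    finally show ?thesis .
  qed
  define Z where "Z v \<omega> = - ln (exp_sup 1 v (\<lambda>q. X q \<omega> - c2 * q))" for v \<omega>
  have inner: "X.expectation (\<lambda>\<omega>2. X.expectation (\<lambda>\<omega>1. exp_sup \<gamma> (T \<omega>2 + v) (\<lambda>q. X q \<omega>1 - broken_drift c1 c2 (T \<omega>2) q)))
      = l / (\<phi> - l) * (\<gamma> / \<beta> * A \<beta> v - A \<gamma> v)" if "v > 0" for v
  proof -
    have mZ [measurable]: "Z v \<in> borel_measurable M"
      unfolding Z_def by (intro borel_measurable_uminus borel_measurable_ln borel_measurable_exp_sup borel_measurable_diff mX) auto
    have mE [measurable]: "(\<lambda>\<omega>. exp_sup \<theta> v (\<lambda>q. X q \<omega> - c2 * q)) \<in> borel_measurable M" for \<theta>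
      by (intro borel_measurable_exp_sup borel_measurable_diff mX) auto
    have mR: "(\<lambda>(\<omega>2, \<omega>1). Y.reflected_laplace \<gamma> (Z v \<omega>1) (T \<omega>2)) \<in> borel_measurable (M \<Otimes>\<^sub>M M)"
      unfolding split_beta'
      using measurable_compose[OF _ Y.borel_measurable_reflected_laplace[OF less_imp_le[OF \<gamma>(2)]], of "\<lambda>p. (T (fst p), Z v (snd p))" "M \<Otimes>\<^sub>M M"]
      by simp
    interpret MM: pair_prob_space M M ..
    have "X.expectation (\<lambda>\<omega>2. X.expectation (\<lambda>\<omega>1. exp_sup \<gamma> (T \<omega>2 + v) (\<lambda>q. X q \<omega>1 - broken_drift c1 c2 (T \<omega>2) q)))
      = X.expectation (\<lambda>\<omega>2. X.expectation (\<lambda>\<omega>1. Y.reflected_laplace \<gamma> (Z v \<omega>1) (T \<omega>2)))"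
    proof (rule integral_cong_AE)
      show "(\<lambda>\<omega>2. X.expectation (\<lambda>\<omega>1. exp_sup \<gamma> (T \<omega>2 + v) (\<lambda>q. X q \<omega>1 - broken_drift c1 c2 (T \<omega>2) q))) \<in> borel_measurable M"
        by (intro X.borel_measurable_lebesgue_integral, unfold split_beta', intro borel_measurable_exp_sup borel_measurable_diff mX borel_measurable_broken_drift) auto
      show "(\<lambda>\<omega>2. X.expectation (\<lambda>\<omega>1. Y.reflected_laplace \<gamma> (Z v \<omega>1) (T \<omega>2))) \<in> borel_measurable M"
        by (rule X.borel_measurable_lebesgue_integral[OF mR])
      show "AE \<omega>2 in M. X.expectation (\<lambda>\<omega>1. exp_sup \<gamma> (T \<omega>2 + v) (\<lambda>q. X q \<omega>1 - broken_drift c1 c2 (T \<omega>2) q)) =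
          X.expectation (\<lambda>\<omega>1. Y.reflected_laplace \<gamma> (Z v \<omega>1) (T \<omega>2))"
        using posT unfolding Z_def
        by eventually_elim (rule X.expectation_exp_sup_broken_drift[OF _ that \<gamma>(2)])
    qed
    \<comment> \<open>Exchanging the integrals lets \<open>T\<close> be averaged with the level
      \<open>Z\<close> held constant, which is the situation of \<open>K\<close>.\<close>
    also have "\<dots> = X.expectation (\<lambda>\<omega>1. X.expectation (\<lambda>\<omega>2. Y.reflected_laplace \<gamma> (Z v \<omega>1) (T \<omega>2)))"
    proof (rule MM.Fubini_integral[symmetric])
      show "integrable (M \<Otimes>\<^sub>M M) (\<lambda>(\<omega>2, \<omega>1). Y.reflected_laplace \<gamma> (Z v \<omega>1) (T \<omega>2))"
        using Y.reflected_laplace_bounds[OF less_imp_le[OF \<gamma>(2)]]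
        by (intro MM.integrable_const_bound[where B = 1] mR) auto
    qed
    also have "\<dots> = X.expectation (\<lambda>\<omega>. l / (\<phi> - l) * (\<gamma> / \<beta> * exp_sup \<beta> v (\<lambda>q. X q \<omega> - c2 * q) - exp_sup \<gamma> v (\<lambda>q. X q \<omega> - c2 * q)))"
    proof (rule integral_cong_AE)
      show "(\<lambda>\<omega>1. X.expectation (\<lambda>\<omega>2. Y.reflected_laplace \<gamma> (Z v \<omega>1) (T \<omega>2))) \<in> borel_measurable M"
      proof (rule X.borel_measurable_lebesgue_integral)
        show "(\<lambda>(\<omega>1, \<omega>2). Y.reflected_laplace \<gamma> (Z v \<omega>1) (T \<omega>2)) \<in> borel_measurable (M \<Otimes>\<^sub>M M)"
          using measurable_compose[OF _ Y.borel_measurable_reflected_laplace[OF less_imp_le[OF \<gamma>(2)]], of "\<lambda>p. (T (snd p), Z v (fst p))" "M \<Otimes>\<^sub>M M"]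
          by (simp add: split_beta')
      qed
      show "AE \<omega> in M. X.expectation (\<lambda>\<omega>2. Y.reflected_laplace \<gamma> (Z v \<omega>) (T \<omega>2)) =
        l / (\<phi> - l) * (\<gamma> / \<beta> * exp_sup \<beta> v (\<lambda>q. X q \<omega> - c2 * q) - exp_sup \<gamma> v (\<lambda>q. X q \<omega> - c2 * q))"
        using X.AE_spos_path
      proof eventually_elim
        case (elim \<omega>)
        have W: "spos_path (\<lambda>q. X q \<omega> - c2 * q)" by (rule spos_path_drift[OF elim])
        have "Z v \<omega> = sup_before v (\<lambda>q. X q \<omega> - c2 * q)"
          using spos_path_exp_sup(1)[OF W zero_less_one that] by (simp add: Z_def)
        then show ?case
          using K[of "Z v \<omega>"] spos_path_exp_sup(3)[OF W zero_less_one that]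
            spos_path_exp_sup(1)[OF W \<open>\<beta> > 0\<close> that] spos_path_exp_sup(1)[OF W \<gamma>(2) that] by simp
      qed
    qed measurable
    also have "\<dots> = l / (\<phi> - l) * (\<gamma> / \<beta> * A \<beta> v - A \<gamma> v)"
    proof -
      have i: "integrable M (\<lambda>\<omega>. exp_sup \<theta> v (\<lambda>q. X q \<omega> - c2 * q))" for \<theta>
        using exp_sup_bounds by (intro X.integrable_const_bound[where B = 1] mE) auto
      show ?thesis unfolding A_def using i[of \<beta>] i[of \<gamma>] by simp
    qed
    finally show ?thesis .
  qed
  have mA: "A \<theta> \<in> borel_measurable borel" for \<theta>
    unfolding A_def[abs_def]
    by (intro X.borel_measurable_lebesgue_integral, unfold split_beta', intro borel_measurable_exp_sup borel_measurable_diff mX) auto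
  have bA: "\<bar>A \<theta> v\<bar> \<le> 1" for \<theta> v
  proof -
    have m: "(\<lambda>\<omega>. exp_sup \<theta> v (\<lambda>q. X q \<omega> - c2 * q)) \<in> borel_measurable M"
      by (intro borel_measurable_exp_sup borel_measurable_diff mX) auto
    have "A \<theta> v \<le> X.expectation (\<lambda>_. 1)"
      unfolding A_def using exp_sup_bounds
      by (intro integral_mono X.integrable_const_bound[where B = 1] m) auto
    moreover have "0 \<le> A \<theta> v" unfolding A_def by (intro integral_nonneg_AE) (auto simp: exp_sup_bounds)
    ultimately show ?thesis by (simp add: X.prob_space)
  qed
  have iA: "integrable M (\<lambda>\<omega>. A \<theta> (V \<omega>))" for \<theta>
    using bA by (intro X.integrable_const_bound[where B = 1] measurable_compose[OF mV mA]) auto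
  have "laplace_transform M (\<lambda>\<omega>. sup_before (T \<omega> + V \<omega>) (\<lambda>t. X t \<omega> - broken_drift c1 c2 (T \<omega>) t)) \<gamma> =
    l / (\<phi> - l) * (\<gamma> / \<beta> * X.expectation (\<lambda>\<omega>. A \<beta> (V \<omega>)) - X.expectation (\<lambda>\<omega>. A \<gamma> (V \<omega>)))"
  proof -
    have "laplace_transform M (\<lambda>\<omega>. sup_before (T \<omega> + V \<omega>) (\<lambda>t. X t \<omega> - broken_drift c1 c2 (T \<omega>) t)) \<gamma> =
      X.expectation (\<lambda>\<omega>3. X.expectation (\<lambda>\<omega>2. X.expectation (\<lambda>\<omega>1.
        exp_sup \<gamma> (T \<omega>2 + V \<omega>3) (\<lambda>q. X q \<omega>1 - broken_drift c1 c2 (T \<omega>2) q))))"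
      using \<gamma>(2) by (intro joint spos_path_broken_drift(2) borel_measurable_broken_drift) auto
    also have "\<dots> = X.expectation (\<lambda>\<omega>. l / (\<phi> - l) * (\<gamma> / \<beta> * A \<beta> (V \<omega>) - A \<gamma> (V \<omega>)))"
    proof (rule integral_cong_AE)
      show "(\<lambda>\<omega>3. X.expectation (\<lambda>\<omega>2. X.expectation (\<lambda>\<omega>1. exp_sup \<gamma> (T \<omega>2 + V \<omega>3) (\<lambda>q. X q \<omega>1 - broken_drift c1 c2 (T \<omega>2) q))))
        \<in> borel_measurable M"
        by (intro X.borel_measurable_lebesgue_integral, unfold split_beta', intro X.borel_measurable_lebesgue_integral, unfold split_beta',
          intro borel_measurable_exp_sup borel_measurable_diff mX borel_measurable_broken_drift) auto
      show "(\<lambda>\<omega>. l / (\<phi> - l) * (\<gamma> / \<beta> * A \<beta> (V \<omega>) - A \<gamma> (V \<omega>))) \<in> borel_measurable M"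
        by (intro borel_measurable_times borel_measurable_diff borel_measurable_const measurable_compose[OF mV mA])
      show "AE \<omega> in M. X.expectation (\<lambda>\<omega>2. X.expectation (\<lambda>\<omega>1. exp_sup \<gamma> (T \<omega>2 + V \<omega>) (\<lambda>q. X q \<omega>1 - broken_drift c1 c2 (T \<omega>2) q)))
        = l / (\<phi> - l) * (\<gamma> / \<beta> * A \<beta> (V \<omega>) - A \<gamma> (V \<omega>))"
        using assms(6) by eventually_elim (rule inner)
    qed
    also have "\<dots> = l / (\<phi> - l) * (\<gamma> / \<beta> * X.expectation (\<lambda>\<omega>. A \<beta> (V \<omega>)) - X.expectation (\<lambda>\<omega>. A \<gamma> (V \<omega>)))"
      using iA[of \<beta>] iA[of \<gamma>] by simp
    finally show ?thesis .
  qed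
  \<comment> \<open>With \<open>x\<close> and \<open>y\<close> the transforms of order \<beta> and
    \<gamma> for \<open>V\<close>, this is \<open>l / d\<close> times the difference of
    \<open>\<gamma> / \<beta> * x - y\<close> and \<open>\<gamma> / \<beta> - 1\<close>, that is of
    the expressions for \<open>T + V\<close> and for \<open>T\<close>.\<close>
  moreover have "\<gamma> * l / d * ((1 - y) / \<gamma> - (1 - x) / \<beta>) = l / d * ((1 - y) - \<gamma> / \<beta> * (1 - x))" for d x y
  proof -
    have "\<gamma> * l / d * e = l / d * (\<gamma> * e)" for e by simp
    moreover have "\<gamma> * ((1 - y) / \<gamma> - (1 - x) / \<beta>) = (1 - y) - \<gamma> / \<beta> * (1 - x)"
      using \<gamma>(2) by (simp add: right_diff_distrib[of \<gamma> "(1 - y) / \<gamma>"])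
    ultimately show ?thesis by simp
  qed
  ultimately show ?thesis
    unfolding inv LT LV[OF \<gamma>(2)] LV[OF \<beta>(1)] \<phi>_def[symmetric]
    by (simp add: right_diff_distrib)
qed

end
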